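(* Let $u\in B(\mathcal{X})$ be an eigenvector of $U_\mu'$ with eigenvalue $\lambda\ne1$, and let $V\subset\mathbb{C}$ be an open subset such that $V\cap\sigma(U_\mu')=\{\lambda\}$. Let $\mathrm{Pr}_n$ be the spectral projection of $\sigma(U_{n,\mu}')\cap V$ (for the operator $U_{n,\mu}'$). Let $L_\delta$ be the minimum number of balls of radius $\delta$ needed to cover $\mathcal{X}$. Suppose that there exist $C_L,C_\omega,m,m'>0$ such that $$L_\delta\le C_L\frac1{\delta^m},\qquad \omega(\delta)\le C_\omega\delta^{m'},$$ and let $\tilde\gamma=M^2\gamma/a$ with $\gamma=32M^2/a^2+\frac83M/a$. Let $\alpha\ge1$ be such that $$\frac{\alpha}{\tilde\gamma}-\frac{m}{2m'}>1.$$ Then there exists $\overline C_{\lambda,T_\mu}>0$ such that for all $N\in\mathbb{N}$ with $N\ge2$, $$\mathbb{P}\left(\bigcap_{n\ge N}\left\{\|u-\mathrm{Pr}_nu\|_{B(\mathcal{X})}\le4\overline C_{\lambda,T_\mu}\frac{\alpha}{\sqrt n}\sqrt{\ln(n)}\right\}\right)\ge1-\frac{16\tilde C}{\alpha^{\frac{2m}{m'}}}\,\frac{\tilde\gamma m'}{\alpha m'-\tilde\gamma m-\tilde\gamma m'}\,\frac1{(N-1)^{\frac{\alpha}{\tilde\gamma}-\frac m{2m'}}}-4\frac{C_a}{C_e}\exp\{-(N-1)C_e\},$$ where $\tilde C:=C_L\left(\frac{8MC_\omega}{a\ln(2)}\left(\frac1a+\frac{2M}{a}\right)\right)^{\frac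 m{m'}}$, $C_a:=C_L\left(\frac{16C_\omega}{a}\right)^{\frac m{m'}}$ and $C_e:=\frac{(a/2)^2}{32M^2+\frac83M(a/2)}$.
   Context: Let $(\Omega,\mathcal{F},\mathbb{P})$ be a probability space, $(\mathcal{X},d)$ a compact metric space with a Borel probability measure $\mu$, and $k:\mathcal{X}\times\mathcal{X}\to[0,\infty)$ a symmetric measurable kernel. Let $X_1,X_2,\dots:\Omega\to\mathcal{X}$ be independent random variables with law $\mu$ and $\mu_n=\frac1n\sum_{i=1}^n\delta_{X_i}$. $B_\delta(x)$ denotes the ball of radius $\delta$ around $x$. $B(\mathcal{X})$ is the Banach space of bounded measurable functions $f:\mathcal{X}\to\mathbb{R}$ with $\|f\|_{B(\mathcal{X})}=\sup_{x}|f(x)|$; $\sigma(S)\subset\mathbb{C}$ is the spectrum of a bounded operator $S$ (of its complexification). Put $d_\mu(x)=\int k(x,y)\,d\mu(y)$, $d_{n,\mu}(x)=\int k(x,y)\,d\mu_n(y)$, and, for $\delta>0$, $k_\delta(x;z)=\sup_{y\in B_\delta(x)}|k(x,z)-k(y,z)|$. Standing assumptions: there are constants $0<a\le 1\le M<\infty$ and a continuous increasing function $\omega:[0,+\infty]\to\mathbb{R}$ with $\lim_{\delta\to0}\omega(\delta)=0$ such that $\sup_{x,y}k(x,y)<M$; $a<\inf_x d_\mu(x)$; and $\int k_\delta(x;z)\,d\mu(z)\le\omega(\delta)$ for all $x\in\mathcal{X}$, $\delta>0$. Define $h_\mu(x,y)=\frac12k(x,y)\left(\frac1{d_\mu(x)}+\frac1{d_\mu(y)}\right)$,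 $h_{n,\mu}(x,y)=\frac12k(x,y)\left(\frac1{d_{n,\mu}(x)}+\frac1{d_{n,\mu}(y)}\right)$, and operators on $B(\mathcal{X})$: $T_\mu f(x)=\int h_\mu(x,y)f(y)\,d\mu(y)$, $\hat T_{n,\mu}f(x)=\int h_{n,\mu}(x,y)f(y)\,d\mu_n(y)$ (defined when $\inf_x d_{n,\mu}(x)>0$), $U_\mu'=I-T_\mu$, $U_{n,\mu}'=I-\hat T_{n,\mu}$. Spectral projection: for a bounded operator $S$ and $W\subset\mathbb{C}$, if $\gamma_0$ is a (positively oriented) simple closed curve not meeting $\sigma(S)$ whose interior $\Gamma_{\mathrm{int}}$ satisfies $\Gamma_{\mathrm{int}}\cap\sigma(S)=W\cap\sigma(S)$, the spectral projection of $\sigma(S)\cap W$ is $-\frac1{2\pi i}\int_{\gamma_0}(S-zI)^{-1}dz$.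
   Formalization: Added: αm'−γ̃m−γ̃m'>0 (otherwise the stated lower bound exceeds 1 for large N or is undefined) and 1 is not a boundary point of V (otherwise false). The bounds on L_δ and ω(δ), contradictory for all δ>0, are required only for δ with C_ω δ^{m'} ≤ a/16. *)

theory Defs
  imports "HOL-Probability.Probability" "HOL-Complex_Analysis.Complex_Analysis"
begin

section \<open>Bounded measurable functions with the supremum norm\<close>

typedef (overloaded) ('x, 'b) bmfun =
  "{f :: 'x::topological_space \<Rightarrow> 'b::{second_countable_topology, real_normed_vector}.
      f \<in> borel_measurable borel \<and> bounded (range f)}"
  morphisms bm_apply Bmfun
  by (rule exI[of _ "\<lambda>_. 0"]) (auto simp: bounded_def)

setup_lifting type_definition_bmfun

declare [[coercion "bm_apply :: ('x::topological_space,
  'b::{second_countable_topology, real_normed_vector}) bmfun \<Rightarrow> 'x \<Rightarrow> 'b"]]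

lemma bm_measurable [measurable, simp]: "bm_apply f \<in> borel_measurable borel"
  and bm_bounded [simp]: "bounded (range (bm_apply f))"
  using bm_apply[of f] by auto

lemma bm_eqI: "(\<And>x. bm_apply f x = bm_apply g x) \<Longrightarrow> f = g"
  by transfer auto

lemma Bmfun_apply:
  fixes f :: "'x::topological_space \<Rightarrow> 'b::{second_countable_topology, real_normed_vector}"
  assumes "f \<in> borel_measurable borel" "\<And>x. norm (f x) \<le> B"
  shows "bm_apply (Bmfun f) = f"
  using assms by (intro Bmfun_inverse) (auto intro!: boundedI[of _ B])

instantiation bmfun :: (topological_space, "{second_countable_topology, real_normed_vector}") real_vector
begin

lift_definition uminus_bmfun :: "('a, 'b) bmfun \<Rightarrow> ('a, 'b) bmfun" is "\<lambda>f x. - f x"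
  by (auto simp: bounded_minus_comp)

lift_definition plus_bmfun :: "('a, 'b) bmfun \<Rightarrow> ('a, 'b) bmfun \<Rightarrow> ('a, 'b) bmfun"
  is "\<lambda>f g x. f x + g x"
  by (auto simp: bounded_plus_comp)

lift_definition minus_bmfun :: "('a, 'b) bmfun \<Rightarrow> ('a, 'b) bmfun \<Rightarrow> ('a, 'b) bmfun"
  is "\<lambda>f g x. f x - g x"
  by (auto simp: bounded_minus_comp)

lift_definition zero_bmfun :: "('a, 'b) bmfun" is "\<lambda>_. 0"
  by (auto simp: bounded_def)

lift_definition scaleR_bmfun :: "real \<Rightarrow> ('a, 'b) bmfun \<Rightarrow> ('a, 'b) bmfun"
  is "\<lambda>r f x. r *\<^sub>R f x"
  by (auto simp: bounded_scaleR_comp)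

lemmas [simp] =
  uminus_bmfun.rep_eq plus_bmfun.rep_eq minus_bmfun.rep_eq zero_bmfun.rep_eq scaleR_bmfun.rep_eq

instance
  by standard (auto intro!: bm_eqI simp: algebra_simps)

end

instantiation bmfun :: (topological_space, "{second_countable_topology, real_normed_vector}")
  real_normed_vector
begin

definition norm_bmfun :: "('a, 'b) bmfun \<Rightarrow> real"
  where "norm_bmfun f = (SUP x. norm (f x))"

definition dist_bmfun :: "('a, 'b) bmfun \<Rightarrow> ('a, 'b) bmfun \<Rightarrow> real"
  where "dist_bmfun f g = norm (f - g)"

definition sgn_bmfun :: "('a, 'b) bmfun \<Rightarrow> ('a, 'b) bmfun"
  where "sgn_bmfun f = f /\<^sub>R norm f"

definition uniformity_bmfun :: "(('a, 'b) bmfun \<times> ('a, 'b) bmfun) filter"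
  where "uniformity_bmfun = (INF e\<in>{0 <..}. principal {(x, y). dist x y < e})"

definition open_bmfun :: "('a, 'b) bmfun set \<Rightarrow> bool"
  where "open_bmfun S = (\<forall>x\<in>S. \<forall>\<^sub>F (x', y) in uniformity. x' = x \<longrightarrow> y \<in> S)"

lemma norm_bm_apply_le: "norm (bm_apply f x) \<le> norm f"
  unfolding norm_bmfun_def
  by (intro cSUP_upper bounded_imp_bdd_above) (auto simp: bounded_norm_comp)

lemma norm_bmfun_le: "(\<And>x. norm (bm_apply f x) \<le> B) \<Longrightarrow> norm f \<le> B"
  unfolding norm_bmfun_def by (intro cSUP_least) auto

instance
proof
  fix f g :: "('a, 'b) bmfun" and a :: real
  have nonneg: "0 \<le> norm f" for f :: "('a, 'b) bmfun"
    using norm_bm_apply_le[of f undefined] norm_ge_zero order_trans by blast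
  show "norm f = 0 \<longleftrightarrow> f = 0"
  proof
    assume "norm f = 0"
    then show "f = 0" by (metis bm_eqI norm_bm_apply_le norm_le_zero_iff zero_bmfun.rep_eq)
  next
    assume "f = 0"
    then show "norm f = 0" using nonneg[of f] norm_bmfun_le[of f 0] by auto
  qed
  show "norm (f + g) \<le> norm f + norm g"
    by (intro norm_bmfun_le) (auto intro!: norm_triangle_le add_mono norm_bm_apply_le)
  have le: "norm (a *\<^sub>R f) \<le> \<bar>a\<bar> * norm f" for a and f :: "('a, 'b) bmfun"
    by (intro norm_bmfun_le) (auto intro!: mult_left_mono norm_bm_apply_le)
  show "norm (a *\<^sub>R f) = \<bar>a\<bar> * norm f"
  proof (cases "a = 0")
    case True
    then show ?thesis using nonneg[of "a *\<^sub>R f"] le[of a f] by auto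
  next
    case False
    have "norm f \<le> \<bar>inverse a\<bar> * norm (a *\<^sub>R f)"
      using le[of "inverse a" "a *\<^sub>R f"] False by simp
    then show ?thesis using le[of a f] False by (auto simp: field_simps)
  qed
qed (auto simp: dist_bmfun_def sgn_bmfun_def uniformity_bmfun_def open_bmfun_def)

end

instance bmfun :: (topological_space, "{second_countable_topology, banach}") banach
proof
  fix F :: "nat \<Rightarrow> ('a, 'b) bmfun"
  assume C: "Cauchy F"
  have "uniformly_Cauchy_on UNIV (\<lambda>n. bm_apply (F n))"
  proof (rule uniformly_Cauchy_onI)
    fix e :: real assume "0 < e"
    then obtain N where "\<And>m n. m \<ge> N \<Longrightarrow> n \<ge> N \<Longrightarrow> dist (F m) (F n) < e"
      using metric_CauchyD[OF C] by blast
    moreover have "dist (F m x) (F n x) \<le> dist (F m) (F n)" for m n x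
      using norm_bm_apply_le[of "F m - F n" x] by (simp add: dist_norm)
    ultimately show "\<exists>N. \<forall>x\<in>UNIV. \<forall>m\<ge>N. \<forall>n\<ge>N. dist (F m x) (F n x) < e"
      by (meson order_le_less_trans)
  qed
  then obtain g where g: "uniform_limit UNIV (\<lambda>n. bm_apply (F n)) g sequentially"
    using Cauchy_uniformly_convergent uniformly_convergent_on_def by blast
  have lim: "(\<lambda>n. F n x) \<longlonglongrightarrow> g x" for x
    using g by (rule tendsto_uniform_limitI) simp
  have meas: "g \<in> borel_measurable borel"
    by (rule borel_measurable_LIMSEQ_metric[OF _ lim]) simp
  have ev: "\<forall>\<^sub>F n in sequentially. \<forall>x. dist (F n x) (g x) < e" if "e > 0" for e
    using uniform_limitD[OF g that] by simp
  then obtain n where n: "\<And>x. dist (F n x) (g x) < 1"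
    using eventually_happens'[OF sequentially_bot ev[of 1]] by auto
  have "norm (g x) \<le> norm (F n) + 1" for x
    using n[of x] norm_bm_apply_le[of "F n" x] norm_triangle_sub[of "g x" "F n x"]
    by (simp add: dist_norm norm_minus_commute)
  then have G: "bm_apply (Bmfun g) = g"
    by (rule Bmfun_apply[OF meas])
  have "F \<longlonglongrightarrow> Bmfun g"
  proof (rule tendstoI)
    fix e :: real assume "0 < e"
    then have "e / 2 > 0" by simp
    from ev[OF this] show "\<forall>\<^sub>F n in sequentially. dist (F n) (Bmfun g) < e"
    proof eventually_elim
      case (elim n)
      have "norm (F n - Bmfun g) \<le> e / 2"
        using elim by (intro norm_bmfun_le) (auto simp: G dist_norm less_imp_le)
      then show ?case using \<open>0 < e\<close> by (simp add: dist_norm)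
    qed
  qed
  then show "convergent F" by (rule convergentI)
qed

lift_definition bm_map :: "('b \<Rightarrow>\<^sub>L 'c) \<Rightarrow> ('x::topological_space,
    'b::{second_countable_topology, real_normed_vector}) bmfun \<Rightarrow>
    ('x, 'c::{second_countable_topology, real_normed_vector}) bmfun"
  is "\<lambda>A f x. blinfun_apply A (f x)"
  by (auto intro!: bounded_linear_image[unfolded image_image] blinfun.bounded_linear_right
        borel_measurable_continuous_on[OF linear_continuous_on[OF blinfun.bounded_linear_right]]
        simp: image_image[symmetric] simp del: image_image)

lift_definition bm_post :: "('b \<Rightarrow>\<^sub>L 'c) \<Rightarrow> ('x::topological_space,
    'b::{second_countable_topology, real_normed_vector}) bmfun \<Rightarrow>\<^sub>L
    ('x, 'c::{second_countable_topology, real_normed_vector}) bmfun"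
  is bm_map
proof -
  fix A :: "'b \<Rightarrow>\<^sub>L 'c"
  show "bounded_linear (bm_map A :: ('x, 'b) bmfun \<Rightarrow> ('x, 'c) bmfun)"
  proof (rule bounded_linear_intro[of _ "norm A"])
    fix f :: "('x, 'b) bmfun"
    have "norm (blinfun_apply A (f x)) \<le> norm f * norm A" for x
      using norm_blinfun[of A "f x"] mult_left_mono[OF norm_bm_apply_le[of f x] norm_ge_zero[of A]]
      by (simp add: mult.commute)
    then show "norm (bm_map A f) \<le> norm f * norm A"
      by (intro norm_bmfun_le) (simp add: bm_map.rep_eq)
  qed (auto intro!: bm_eqI simp: bm_map.rep_eq blinfun.bilinear_simps)
qed

lemma bm_post_apply: "bm_post A f x = blinfun_apply A (f x)"
  by (simp add: bm_post.rep_eq bm_map.rep_eq)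


section \<open>Complexification, spectrum and spectral projections\<close>

type_synonym 'x bop = "('x, real) bmfun \<Rightarrow>\<^sub>L ('x, real) bmfun"
type_synonym 'x cbop = "('x, complex) bmfun \<Rightarrow>\<^sub>L ('x, complex) bmfun"

definition bm_of_real :: "('x::topological_space, real) bmfun \<Rightarrow>\<^sub>L ('x, complex) bmfun"
  where "bm_of_real = bm_post (Blinfun complex_of_real)"

definition bm_Re :: "('x::topological_space, complex) bmfun \<Rightarrow>\<^sub>L ('x, real) bmfun"
  where "bm_Re = bm_post (Blinfun Re)"

definition bm_Im :: "('x::topological_space, complex) bmfun \<Rightarrow>\<^sub>L ('x, real) bmfun"
  where "bm_Im = bm_post (Blinfun Im)"

definition cmult :: "complex \<Rightarrow> ('x::topological_space) cbop"
  where "cmult c = bm_post (Blinfun ((*) c))"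

lemma bm_of_real_apply: "bm_of_real f x = complex_of_real (f x)"
  by (simp add: bm_of_real_def bm_post_apply bounded_linear_Blinfun_apply bounded_linear_of_real)

lemma bm_Re_apply: "bm_Re f x = Re (f x)"
  by (simp add: bm_Re_def bm_post_apply bounded_linear_Blinfun_apply bounded_linear_Re)

lemma bm_Im_apply: "bm_Im f x = Im (f x)"
  by (simp add: bm_Im_def bm_post_apply bounded_linear_Blinfun_apply bounded_linear_Im)

lemma cmult_apply: "cmult c f x = c * f x"
  by (simp add: cmult_def bm_post_apply bounded_linear_Blinfun_apply bounded_linear_mult_right)

definition complexify :: "('x::topological_space) bop \<Rightarrow> 'x cbop"
  where "complexify S =
    (bm_of_real o\<^sub>L S o\<^sub>L bm_Re) + (cmult \<i> o\<^sub>L bm_of_real o\<^sub>L S o\<^sub>L bm_Im)"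

lemma complexify_apply:
  "complexify S f x = Complex (S (bm_Re f) x) (S (bm_Im f) x)"
  by (simp add: complexify_def blinfun.bilinear_simps bm_of_real_apply cmult_apply complex_eq_iff)

definition is_resolvent :: "('x::topological_space) bop \<Rightarrow> complex \<Rightarrow> 'x cbop \<Rightarrow> bool"
  where "is_resolvent S z R \<longleftrightarrow>
    R o\<^sub>L (complexify S - cmult z) = id_blinfun \<and> (complexify S - cmult z) o\<^sub>L R = id_blinfun"

definition spectrum :: "('x::topological_space) bop \<Rightarrow> complex set"
  where "spectrum S = {z. \<not> (\<exists>R. is_resolvent S z R)}"

definition resolvent :: "('x::topological_space) bop \<Rightarrow> complex \<Rightarrow> 'x cbop"
  where "resolvent S z = (THE R. is_resolvent S z R)"

lemma resolvent_eqI: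
  assumes "is_resolvent S z R"
  shows "resolvent S z = R"
  unfolding resolvent_def
proof (rule the_equality)
  show "is_resolvent S z R" by fact
next
  fix R' assume R': "is_resolvent S z R'"
  have "R' = R' o\<^sub>L ((complexify S - cmult z) o\<^sub>L R)"
    using assms by (auto simp: is_resolvent_def intro!: blinfun_eqI)
  also have "\<dots> = R' o\<^sub>L (complexify S - cmult z) o\<^sub>L R"
    by (rule blinfun_eqI) simp
  also have "\<dots> = R"
    using R' by (auto simp: is_resolvent_def intro!: blinfun_eqI)
  finally show "R' = R" .
qed

text \<open>The contour integral of the resolvent is a norm-convergent integral in the Banach space
  of operators; positive orientation means winding number 1 around the interior points.\<close>

definition is_spectral_projection ::
    "('x::topological_space) bop \<Rightarrow> complex set \<Rightarrow> 'x cbop \<Rightarrow> bool"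
  where "is_spectral_projection S W Q \<longleftrightarrow>
    (\<exists>\<gamma> J. valid_path \<gamma> \<and> simple_path \<gamma> \<and> pathfinish \<gamma> = pathstart \<gamma> \<and>
       (\<forall>z\<in>inside (path_image \<gamma>). winding_number \<gamma> z = 1) \<and>
       path_image \<gamma> \<inter> spectrum S = {} \<and>
       inside (path_image \<gamma>) \<inter> spectrum S = W \<inter> spectrum S \<and>
       ((\<lambda>t. cmult (vector_derivative \<gamma> (at t within {0..1})) o\<^sub>L resolvent S (\<gamma> t))
          has_integral J) {0..1} \<and>
       Q = cmult (- 1 / (2 * of_real pi * \<i>)) o\<^sub>L J)"

definition spectral_projection :: "('x::topological_space) bop \<Rightarrow> complex set \<Rightarrow> 'x cbop"
  where "spectral_projection S W = (THE Q. is_spectral_projection S W Q)"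


section \<open>Normalised kernels and the associated operators\<close>

definition degree_fun :: "('x \<Rightarrow> 'x \<Rightarrow> real) \<Rightarrow> 'x measure \<Rightarrow> 'x \<Rightarrow> real"
  where "degree_fun k \<nu> x = (\<integral>y. k x y \<partial>\<nu>)"

definition normalized_kernel :: "('x \<Rightarrow> 'x \<Rightarrow> real) \<Rightarrow> 'x measure \<Rightarrow> 'x \<Rightarrow> 'x \<Rightarrow> real"
  where "normalized_kernel k \<nu> x y =
    1 / 2 * k x y * (1 / degree_fun k \<nu> x + 1 / degree_fun k \<nu> y)"

text \<open>The wrappers \<open>Bmfun\<close> and \<open>Blinfun\<close> are meaningful once the integral operator is known to
  act boundedly on bounded measurable functions; see \<open>T_op_apply\<close>.\<close>

definition kernel_op :: "'x measure \<Rightarrow> ('x \<Rightarrow> 'x \<Rightarrow> real) \<Rightarrow> ('x::topological_space) bop"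
  where "kernel_op \<nu> h = Blinfun (\<lambda>f. Bmfun (\<lambda>x. \<integral>y. h x y * bm_apply f y \<partial>\<nu>))"

definition T_op :: "('x \<Rightarrow> 'x \<Rightarrow> real) \<Rightarrow> 'x measure \<Rightarrow> ('x::topological_space) bop"
  where "T_op k \<nu> = kernel_op \<nu> (normalized_kernel k \<nu>)"

definition U_op :: "('x \<Rightarrow> 'x \<Rightarrow> real) \<Rightarrow> 'x measure \<Rightarrow> ('x::topological_space) bop"
  where "U_op k \<nu> = id_blinfun - T_op k \<nu>"

lemma kernel_op_apply:
  fixes h :: "'x::topological_space \<Rightarrow> 'x \<Rightarrow> real"
  assumes "prob_space \<nu>" and sets: "sets \<nu> = sets borel"
    and h: "(\<lambda>(x, y). h x y) \<in> borel_measurable (borel \<Otimes>\<^sub>M borel)"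
    and B: "\<And>x y. \<bar>h x y\<bar> \<le> B"
  shows "kernel_op \<nu> h f x = (\<integral>y. h x y * f y \<partial>\<nu>)"
proof -
  interpret prob_space \<nu> by fact
  note sets[measurable_cong] h[measurable]
  have B0: "0 \<le> B" using B[of undefined undefined] by linarith
  have bd: "\<bar>h x y * bm_apply f y\<bar> \<le> B * norm f" for x y and f :: "('x, real) bmfun"
    unfolding abs_mult using B[of x y] norm_bm_apply_le[of f y] B0
    by (intro mult_mono) auto
  have int: "integrable \<nu> (\<lambda>y. h x y * bm_apply f y)" for x and f :: "('x, real) bmfun"
    by (rule integrable_const_bound[of _ "B * norm f"]) (use bd in auto)
  have nb: "norm (\<integral>y. h x y * bm_apply f y \<partial>\<nu>) \<le> norm f * B" for x and f :: "('x, real) bmfun"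
  proof -
    have "norm (\<integral>y. h x y * bm_apply f y \<partial>\<nu>) \<le> (\<integral>y. norm (h x y * bm_apply f y) \<partial>\<nu>)"
      by (rule integral_norm_bound)
    also have "\<dots> \<le> (\<integral>y. B * norm f \<partial>\<nu>)"
      by (intro integral_mono integrable_norm int) (use bd in auto)
    finally show ?thesis by (simp add: prob_space mult.commute)
  qed
  have ap: "bm_apply (Bmfun (\<lambda>x. \<integral>y. h x y * bm_apply f y \<partial>\<nu>))
      = (\<lambda>x. \<integral>y. h x y * bm_apply f y \<partial>\<nu>)" for f :: "('x, real) bmfun"
    by (rule Bmfun_apply[OF _ nb]) measurable
  have "bounded_linear (\<lambda>f :: ('x, real) bmfun. Bmfun (\<lambda>x. \<integral>y. h x y * bm_apply f y \<partial>\<nu>))"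
  proof (rule bounded_linear_intro[of _ B])
    fix f g :: "('x, real) bmfun" and r :: real
    show "Bmfun (\<lambda>x. \<integral>y. h x y * bm_apply (f + g) y \<partial>\<nu>)
        = Bmfun (\<lambda>x. \<integral>y. h x y * bm_apply f y \<partial>\<nu>) + Bmfun (\<lambda>x. \<integral>y. h x y * bm_apply g y \<partial>\<nu>)"
      by (rule bm_eqI, subst ap, subst plus_bmfun.rep_eq)
        (simp add: ap distrib_left Bochner_Integration.integral_add int)
    show "Bmfun (\<lambda>x. \<integral>y. h x y * bm_apply (r *\<^sub>R f) y \<partial>\<nu>)
        = r *\<^sub>R Bmfun (\<lambda>x. \<integral>y. h x y * bm_apply f y \<partial>\<nu>)"
      by (rule bm_eqI, subst ap, subst scaleR_bmfun.rep_eq) (simp add: ap mult.left_commute)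
    show "norm (Bmfun (\<lambda>x. \<integral>y. h x y * bm_apply f y \<partial>\<nu>)) \<le> norm f * B"
      by (rule norm_bmfun_le) (simp only: ap nb)
  qed
  then show ?thesis
    by (simp add: kernel_op_def bounded_linear_Blinfun_apply ap)
qed

lemma T_op_apply:
  fixes k :: "'x::topological_space \<Rightarrow> 'x \<Rightarrow> real"
  assumes "prob_space \<nu>" and sets: "sets \<nu> = sets borel"
    and k: "(\<lambda>(x, y). k x y) \<in> borel_measurable (borel \<Otimes>\<^sub>M borel)"
    and B: "\<And>x y. \<bar>k x y\<bar> \<le> B" and c: "0 < c" "\<And>x. c \<le> degree_fun k \<nu> x"
  shows "T_op k \<nu> f x = (\<integral>y. normalized_kernel k \<nu> x y * f y \<partial>\<nu>)"
  unfolding T_op_def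
proof (rule kernel_op_apply[OF assms(1,2)])
  interpret prob_space \<nu> by fact
  note sets[measurable_cong] k[measurable]
  have [measurable]: "degree_fun k \<nu> \<in> borel_measurable borel"
    unfolding degree_fun_def[abs_def] by measurable
  show "(\<lambda>(x, y). normalized_kernel k \<nu> x y) \<in> borel_measurable (borel \<Otimes>\<^sub>M borel)"
    unfolding normalized_kernel_def by measurable
  fix x y
  have pos: "0 < degree_fun k \<nu> z" for z using c less_le_trans by blast
  have inv: "1 / degree_fun k \<nu> z \<le> 1 / c" for z using c by (intro divide_left_mono) (auto simp: pos)
  have "\<bar>normalized_kernel k \<nu> x y\<bar>
      = 1 / 2 * \<bar>k x y\<bar> * (1 / degree_fun k \<nu> x + 1 / degree_fun k \<nu> y)"
    unfolding normalized_kernel_def abs_mult using pos[of x] pos[of y] by (simp add: less_imp_le)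
  also have "\<dots> \<le> 1 / 2 * B * (1 / c + 1 / c)"
    using B[of x y] inv[of x] inv[of y] pos[of x] pos[of y] c(1)
    by (intro mult_mono add_mono) auto
  finally show "\<bar>normalized_kernel k \<nu> x y\<bar> \<le> 1 / 2 * B * (1 / c + 1 / c)" .
qed


section \<open>Samples, moduli and covering numbers\<close>

text \<open>The image of the uniform distribution on the indices \<open>1, \<dots>, n\<close> is
  \<open>(1/n) (\<Sum>i=1..n. \<delta>\<^bsub>X i w\<^esub>)\<close>, counted with multiplicity.\<close>

definition empirical :: "(nat \<Rightarrow> 'w \<Rightarrow> 'x::topological_space) \<Rightarrow> 'w \<Rightarrow> nat \<Rightarrow> 'x measure"
  where "empirical X w n = distr (uniform_count_measure {1..n}) borel (\<lambda>i. X i w)"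

lemma integral_empirical:
  fixes f :: "'x::topological_space \<Rightarrow> real"
  assumes "f \<in> borel_measurable borel"
  shows "(\<integral>y. f y \<partial>empirical X w n) = (\<Sum>i=1..n. f (X i w)) / n"
  unfolding empirical_def using assms
  by (subst integral_distr)
    (auto simp: measurable_def space_uniform_count_measure sets_uniform_count_measure
       uniform_count_measure_def lebesgue_integral_point_measure_finite sum_divide_distrib)

definition modulus :: "('x::metric_space \<Rightarrow> 'x \<Rightarrow> real) \<Rightarrow> real \<Rightarrow> 'x \<Rightarrow> 'x \<Rightarrow> real"
  where "modulus k \<delta> x z = (SUP y\<in>ball x \<delta>. \<bar>k x z - k y z\<bar>)"

definition covering_number :: "'x::metric_space itself \<Rightarrow> real \<Rightarrow> nat"
  where "covering_number _ \<delta> =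
    (LEAST n. \<exists>A :: 'x set. finite A \<and> card A = n \<and> (\<Union>x\<in>A. ball x \<delta>) = UNIV)"

end

theory Submission
  imports Defs
begin

text \<open>
  The empirical operator \<open>T\<^sub>n\<close> has a symmetric kernel, so it is symmetric for the semi-inner product
  \<open>\<langle>f, g\<rangle>\<^sub>n = (1/n) \<Sum>\<^sub>i f (X\<^sub>i) g (X\<^sub>i)\<close>, it has finite rank, and it smooths:
  \<open>\<parallel>T\<^sub>n f\<parallel> \<le> (2 M / a) \<langle>f, f\<rangle>\<^sub>n\<^sup>1\<^sup>/\<^sup>2\<close> as soon as the empirical degrees are at least \<open>a / 2\<close>. These three
  properties replace the compactness arguments of general perturbation theory and give an explicit
  bound for every \<open>n\<close>, not only for large \<open>n\<close>.

  Symmetry and finite rank make \<open>T\<^sub>n\<close> diagonalisable with real eigenvalues, up to a nilpotent part of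
  order two at the eigenvalue \<open>0\<close>, which comes from functions that vanish on the sample
  (\<open>spectral_decomposition\<close>). The resolvent of \<open>I - T\<^sub>n\<close> is then an explicit rational function, its
  contour integral counts residues, and the spectral projection for \<open>V\<close> is the sum of the
  eigenprojections for the eigenvalues in \<open>V\<close>, whatever admissible curve is chosen
  (\<open>is_spectral_projection_iff\<close>). Such a curve exists because a finite real spectrum can be separated
  arbitrarily by the preimage of a circle under a shear of the plane (\<open>enclosing_curve\<close>).

  Let \<open>T u = \<tau> u\<close> and \<open>g = T\<^sub>n u - \<tau> u\<close>. On the range of the complementary projection the eigenvalues of
  \<open>T\<^sub>n\<close> keep a fixed distance from \<open>\<tau>\<close>, because \<open>V\<close> contains a disc around \<open>1 - \<tau>\<close>. By orthogonality
  the part of \<open>u\<close> that the projection misses has a seminorm of order \<open>\<parallel>g\<parallel>\<close>. Smoothing turns the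
  seminorm into the supremum norm; it needs eigenvalues away from \<open>0\<close>, which is where \<open>1\<close> not being a
  frontier point of \<open>V\<close> enters (\<open>projection_error\<close>).

  It remains to bound \<open>g = (T\<^sub>n - T) u\<close>. Its values are controlled by how far the sample means of
  \<open>k x \<cdot> v\<close> are from their expectations, for the three functions \<open>v = 1, u, u / d\<^sub>\<mu>\<close> (\<open>T_op_difference\<close>). Hoeffding's inequality on a finite net, with the modulus of the kernel
  controlling the points between (\<open>uniform_deviation\<close>), bounds these deviations uniformly in \<open>x\<close> by a multiple of
  \<open>\<epsilon>\<^sub>n = c\<^sub>0 \<alpha> (ln n / n)\<^sup>1\<^sup>/\<^sup>2\<close>, with a failure probability of order \<open>n\<close> to a power proportional to
  \<open>- c\<^sub>0\<^sup>2 \<alpha>\<^sup>2\<close>. The factor \<open>c\<^sub>0\<close> is absorbed in the constant of the theorem and may be as large as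
  desired, so this power beats every factor in the claimed bound, and the failure probabilities can be
  summed over \<open>n \<ge> N\<close> (\<open>convergence_event\<close>). The exponential term of the bound is the price of the
  lower bound on the empirical degrees (\<open>degree_event\<close>).
\<close>

section \<open>Polynomials in a bounded operator\<close>

definition blinfun_pow :: "('a::real_normed_vector \<Rightarrow>\<^sub>L 'a) \<Rightarrow> nat \<Rightarrow> 'a \<Rightarrow>\<^sub>L 'a"
  where "blinfun_pow T i = (((o\<^sub>L) T) ^^ i) id_blinfun"

definition poly_op :: "('a::real_normed_vector \<Rightarrow>\<^sub>L 'a) \<Rightarrow> real poly \<Rightarrow> 'a \<Rightarrow>\<^sub>L 'a"
  where "poly_op T p = (\<Sum>i\<le>degree p. coeff p i *\<^sub>R blinfun_pow T i)"

lemma blinfun_pow_simps [simp]: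
  "blinfun_pow T 0 = id_blinfun" "blinfun_pow T (Suc i) = T o\<^sub>L blinfun_pow T i"
  by (simp_all add: blinfun_pow_def)

lemma poly_op_eq_sum:
  assumes "degree p \<le> n"
  shows "poly_op T p = (\<Sum>i\<le>n. coeff p i *\<^sub>R blinfun_pow T i)"
  unfolding poly_op_def using assms
  by (intro sum.mono_neutral_left) (auto simp: coeff_eq_0)

lemma poly_op_0 [simp]: "poly_op T 0 = 0"
  by (simp add: poly_op_def)

lemma poly_op_1 [simp]: "poly_op T 1 = id_blinfun"
  by (simp add: poly_op_def)

lemma poly_op_add: "poly_op T (p + q) = poly_op T p + poly_op T q"
proof -
  let ?n = "max (degree p) (degree q)"
  have "degree (p + q) \<le> ?n" by (rule degree_add_le) auto
  then show ?thesis
    using poly_op_eq_sum[of "p+q" ?n T] poly_op_eq_sum[of p ?n T] poly_op_eq_sum[of q ?n T]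
    by (simp add: scaleR_left_distrib sum.distrib)
qed

lemma poly_op_smult: "poly_op T (smult c p) = c *\<^sub>R poly_op T p"
  using poly_op_eq_sum[of "smult c p" "degree p" T] poly_op_eq_sum[of p "degree p" T]
  by (simp add: degree_smult_le scaleR_sum_right)

lemma poly_op_pCons: "poly_op T (pCons c p) = c *\<^sub>R id_blinfun + (T o\<^sub>L poly_op T p)"
proof -
  have "poly_op T (pCons c p) = (\<Sum>i\<le>Suc (degree p). coeff (pCons c p) i *\<^sub>R blinfun_pow T i)"
    by (rule poly_op_eq_sum) (rule degree_pCons_le)
  also have "\<dots> = c *\<^sub>R id_blinfun + (\<Sum>i\<le>degree p. coeff p i *\<^sub>R (T o\<^sub>L blinfun_pow T i))"
    by (subst sum.atMost_Suc_shift) simp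
  also have "(\<Sum>i\<le>degree p. coeff p i *\<^sub>R (T o\<^sub>L blinfun_pow T i)) = (T o\<^sub>L poly_op T p)"
    unfolding poly_op_def
    by (rule blinfun_eqI) (simp add: blinfun.bilinear_simps blinfun.sum_left blinfun.sum_right)
  finally show ?thesis .
qed

lemma poly_op_mult: "poly_op T (p * q) = poly_op T p o\<^sub>L poly_op T q"
proof (induction p)
  case 0
  then show ?case by (simp add: blinfun_eqI)
next
  case (pCons c p)
  show ?case
    unfolding mult_pCons_left poly_op_add poly_op_smult poly_op_pCons pCons.IH
    by (rule blinfun_eqI) (simp add: blinfun.bilinear_simps)
qed

lemma poly_op_uminus: "poly_op T (- p) = - poly_op T p"
  using poly_op_smult[of T "-1" p] by simp

lemma poly_op_diff: "poly_op T (p - q) = poly_op T p - poly_op T q"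
  using poly_op_add[of T p "- q"] by (simp add: poly_op_uminus)

lemma poly_op_sum: "poly_op T (sum p A) = (\<Sum>x\<in>A. poly_op T (p x))"
  by (induction A rule: infinite_finite_induct) (auto simp: poly_op_add)

lemma poly_op_linear: "poly_op T [:c, 1:] = c *\<^sub>R id_blinfun + T"
  by (simp add: poly_op_pCons blinfun_eqI blinfun.bilinear_simps)

lemma poly_op_X: "poly_op T [:0, 1:] = T"
  by (simp add: poly_op_linear)

lemma poly_op_dvd_eq_0:
  assumes "poly_op T p = 0" "p dvd q"
  shows "poly_op T q = 0"
proof -
  obtain r where "q = r * p" using assms(2) by (metis dvdE mult.commute)
  then show ?thesis using assms(1) by (simp add: poly_op_mult blinfun_eqI)
qed

lemma poly_op_monom: "poly_op T (monom 1 i) = blinfun_pow T i"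
  by (induction i) (auto simp: monom_Suc monom_0 poly_op_pCons one_pCons[symmetric])

text \<open>The range has dimension at most \<open>card S\<close>, so \<open>T f, T\<^sup>2 f, \<dots>\<close> become linearly dependent after
  \<open>card S + 1\<close> steps. If two of these vectors coincide, a difference of monomials already does it;
  \<open>dependent\<close> alone cannot see a repetition.\<close>
lemma vector_annihilating_polynomial:
  fixes T :: "'a::real_normed_vector \<Rightarrow>\<^sub>L 'a"
  assumes S: "finite S" "range (blinfun_apply T) \<subseteq> span S"
  shows "\<exists>p. p \<noteq> 0 \<and> poly_op T p f = 0"
proof -
  define v where "v i = blinfun_pow T (Suc i) f" for i
  have vs: "v i \<in> span S" for i using S(2) by (auto simp: v_def)
  define n where "n = card S"
  show ?thesis
  proof (cases "inj_on v {..n}")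
    case False
    then obtain i j where ij: "i \<noteq> j" "v i = v j" by (auto simp: inj_on_def)
    let ?p = "monom 1 (Suc i) - monom (1::real) (Suc j)"
    have "coeff ?p (Suc i) = 1" using ij by simp
    then have "?p \<noteq> 0" by (metis coeff_0 zero_neq_one)
    moreover have "poly_op T ?p f = 0"
      using ij by (simp add: poly_op_diff poly_op_monom blinfun.bilinear_simps v_def)
    ultimately show ?thesis by blast
  next
    case True
    have "dependent (v ` {..n})"
    proof (rule ccontr)
      assume "independent (v ` {..n})"
      from independent_span_bound[OF S(1) this] vs have "card (v ` {..n}) \<le> n"
        by (auto simp: n_def)
      then show False using card_image[OF True] by simp
    qed
    then obtain c x where c: "(\<Sum>y\<in>v ` {..n}. c y *\<^sub>R y) = 0" "x \<in> v ` {..n}" "c x \<noteq> 0"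
      by (auto simp: dependent_finite)
    then obtain i0 where i0: "i0 \<le> n" "c (v i0) \<noteq> 0" by auto
    let ?p = "\<Sum>i\<le>n. monom (c (v i)) (Suc i)"
    have "coeff ?p (Suc i0) = (\<Sum>i\<le>n. if i = i0 then c (v i) else 0)"
      by (simp add: coeff_sum)
    then have "coeff ?p (Suc i0) = c (v i0)" using i0 by simp
    then have "?p \<noteq> 0" using i0 by (metis coeff_0)
    moreover have "poly_op T ?p f = 0"
    proof -
      have "monom (c (v i)) (Suc i) = smult (c (v i)) (monom 1 (Suc i))" for i
        by (simp add: smult_monom)
      then have "poly_op T ?p f = (\<Sum>i\<le>n. c (v i) *\<^sub>R v i)"
        by (simp add: poly_op_sum poly_op_smult poly_op_monom blinfun.sum_left blinfun.scaleR_left v_def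
            del: blinfun_pow_simps)
      also have "\<dots> = 0" using c(1) by (simp add: sum.reindex[OF True])
      finally show ?thesis .
    qed
    ultimately show ?thesis by blast
  qed
qed

text \<open>The product of the annihilators of a finite spanning set kills the range of \<open>T\<close>; one more factor
  \<open>X\<close> makes it kill everything.\<close>
lemma annihilating_polynomial:
  fixes T :: "'a::real_normed_vector \<Rightarrow>\<^sub>L 'a"
  assumes S: "finite S" "range (blinfun_apply T) \<subseteq> span S"
  shows "\<exists>p. p \<noteq> 0 \<and> poly_op T p = 0"
proof -
  obtain q where q: "\<And>f. q f \<noteq> 0" "\<And>f. poly_op T (q f) f = 0"
    using vector_annihilating_polynomial[OF assms] by metis
  define p where "p = (\<Prod>f\<in>S. q f)"
  have p0: "p \<noteq> 0" using q S by (simp add: p_def)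
  have z: "poly_op T p f = 0" if "f \<in> S" for f
  proof -
    have "p = (\<Prod>f\<in>S - {f}. q f) * q f"
      using that S by (simp add: p_def prod.remove mult.commute)
    then show ?thesis using q by (simp add: poly_op_mult blinfun.bilinear_simps)
  qed
  have "poly_op T p f = 0" if "f \<in> span S" for f
    using that
  proof (induction rule: span_induct_alt)
    case base show ?case by (simp add: blinfun.bilinear_simps)
  next
    case (step c x y) then show ?case by (simp add: z blinfun.bilinear_simps)
  qed
  then have "poly_op T (p * [:0,1:]) = 0"
    unfolding poly_op_mult poly_op_X using S by (intro blinfun_eqI) auto
  moreover have "p * [:0,1:] \<noteq> 0" using p0 by simp
  ultimately show ?thesis by blast
qed

section \<open>Roots of real polynomials\<close>

text \<open>A real polynomial at a complex point, kept as a function of the real polynomial so that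
  divisibility can be discussed over the reals.\<close>
definition complex_eval :: "complex \<Rightarrow> real poly \<Rightarrow> complex"
  where "complex_eval z p = poly (map_poly complex_of_real p) z"

lemma complex_eval_0 [simp]: "complex_eval z 0 = 0"
  by (simp add: complex_eval_def)

lemma complex_eval_pCons [simp]: "complex_eval z (pCons a p) = of_real a + z * complex_eval z p"
  by (simp add: complex_eval_def map_poly_pCons)

lemma complex_eval_add: "complex_eval z (p + q) = complex_eval z p + complex_eval z q"
  by (induction p q rule: poly_induct2) (simp_all add: algebra_simps)

lemma complex_eval_smult: "complex_eval z (smult c p) = of_real c * complex_eval z p"
  by (induction p) (simp_all add: algebra_simps)

lemma complex_eval_mult: "complex_eval z (p * q) = complex_eval z p * complex_eval z q"
  by (induction p) (simp_all add: complex_eval_add complex_eval_smult algebra_simps)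

lemma complex_root_exists:
  assumes "degree p > 0"
  shows "\<exists>z. complex_eval z p = 0"
proof -
  let ?p = "map_poly complex_of_real p"
  have "coeff ?p (degree p) \<noteq> 0" using assms by (auto simp: coeff_map_poly)
  then obtain z where "(\<Sum>i\<le>degree p. coeff ?p i * z ^ i) = 0"
    using assms fundamental_theorem_of_algebra[of "coeff ?p" "degree p"] by fastforce
  then show ?thesis by (auto simp: complex_eval_def poly_altdef degree_map_poly)
qed

lemma nonreal_root_dvd:
  assumes root: "complex_eval z p = 0" and nr: "Im z \<noteq> 0"
  shows "[:(Re z)\<^sup>2 + (Im z)\<^sup>2, - 2 * Re z, 1:] dvd p"
proof -
  let ?d = "[:(Re z)\<^sup>2 + (Im z)\<^sup>2, - 2 * Re z, 1:] :: real poly"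
  define r where "r = p mod ?d"
  have d: "complex_eval z ?d = 0"
    by (simp add: complex_eq_iff power2_eq_square algebra_simps)
  have "degree r < 2"
    using degree_mod_less'[of ?d p] by (cases "r = 0") (auto simp: r_def)
  then have r2: "coeff r (Suc (Suc i)) = 0" for i by (intro coeff_eq_0) simp
  have r: "r = [:coeff r 0, coeff r 1:]"
  proof (rule poly_eqI)
    fix i show "coeff r i = coeff [:coeff r 0, coeff r 1:] i"
      using r2 by (cases i; cases "i - 1") auto
  qed
  have "p = (p div ?d) * ?d + r" unfolding r_def by (rule div_mult_mod_eq[symmetric])
  then have "complex_eval z r = 0"
    using root d by (metis complex_eval_add complex_eval_mult mult_zero_right add_0)
  then have "of_real (coeff r 0) + z * of_real (coeff r 1) = 0"
    by (subst (asm) r) simp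
  then have "coeff r 1 = 0" "coeff r 0 = 0" using nr by (auto simp: complex_eq_iff)
  then have "r = 0" using r by simp
  then show ?thesis by (simp add: r_def dvd_eq_mod_eq_0)
qed

lemma real_root_dvd:
  assumes root: "complex_eval z p = 0" and r: "Im z = 0"
  shows "[:- Re z, 1:] dvd p"
proof -
  have "complex_eval (of_real x) p = of_real (poly p x)" for x
    by (induction p) auto
  from this[of "Re z"] root r have "poly p (Re z) = 0"
    by (metis complex_is_Real_iff of_real_Re of_real_eq_0_iff)
  then show ?thesis by (simp add: poly_eq_0_iff_dvd)
qed

lemma root_product_dvd:
  fixes p :: "real poly"
  assumes "finite F" "\<And>t. t \<in> F \<Longrightarrow> poly p t = 0"
  shows "(\<Prod>t\<in>F. [:- t, 1:]) dvd p"
  using assms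
proof (induction F arbitrary: p rule: finite_induct)
  case empty show ?case by simp
next
  case (insert t F)
  then obtain q where q: "p = [:- t, 1:] * q" by (metis poly_eq_0_iff_dvd dvdE insertI1)
  have "poly q s = 0" if "s \<in> F" for s
    using insert.prems[of s] insert.hyps that by (auto simp: q)
  then have "(\<Prod>t\<in>F. [:- t, 1:]) dvd q" by (rule insert.IH)
  then have "[:- t, 1:] * (\<Prod>t\<in>F. [:- t, 1:]) dvd p" unfolding q by (intro mult_dvd_mono dvd_refl)
  then show ?case unfolding prod.insert[OF insert.hyps(1,2)] .
qed

section \<open>Spectral decomposition of symmetric operators of finite rank\<close>

text \<open>The form may be degenerate. The model is the empirical semi-inner product, whose null vectors are
  the functions that vanish on the sample; an operator that reads its argument only on the sample
  kills them.\<close>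
locale finite_rank_symmetric =
  fixes T :: "'a::real_normed_vector \<Rightarrow>\<^sub>L 'a" and B :: "'a \<Rightarrow> 'a \<Rightarrow> real"
  assumes form: "bilinear B" "\<And>f g. B f g = B g f" "\<And>f. 0 \<le> B f f"
    and symmetric: "\<And>f g. B (T f) g = B f (T g)"
    and null: "\<And>f. B f f = 0 \<Longrightarrow> T f = 0"
    and finite_rank: "\<exists>S. finite S \<and> range (blinfun_apply T) \<subseteq> span S"
begin

lemmas B_simps = bilinear_ladd[OF form(1)] bilinear_radd[OF form(1)] bilinear_lmul[OF form(1)]
  bilinear_rmul[OF form(1)] bilinear_lzero[OF form(1)] bilinear_rzero[OF form(1)]
  bilinear_lsub[OF form(1)] bilinear_rsub[OF form(1)]

lemma poly_op_symmetric: "B (poly_op T p f) g = B f (poly_op T p g)"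
proof (induction p arbitrary: f g)
  case 0 show ?case by (simp add: B_simps blinfun.bilinear_simps)
next
  case (pCons c p)
  have "poly_op T (pCons c p) = poly_op T ([:c:] + p * [:0,1:])"
    by simp
  then have "poly_op T (pCons c p) g = c *\<^sub>R g + poly_op T p (T g)" for g
    unfolding poly_op_add poly_op_mult poly_op_X by (simp add: poly_op_pCons blinfun.bilinear_simps)
  then show ?case
    by (simp add: poly_op_pCons blinfun.bilinear_simps B_simps symmetric[symmetric] pCons.IH)
      (metis pCons.IH symmetric)
qed

text \<open>The Cauchy-Schwarz inequality in the degenerate case: otherwise the form would be negative
  somewhere on the line \<open>w + t y\<close>.\<close>
lemma form_null_orthogonal:
  assumes "B y y = 0"
  shows "B w y = 0"
proof (rule ccontr)
  assume nz: "B w y \<noteq> 0"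
  define t where "t = - (B w w + 1) / (2 * B w y)"
  have "B (w + t *\<^sub>R y) (w + t *\<^sub>R y) = B w w + 2 * t * B w y"
    using assms form(2)[of y w] by (simp add: B_simps algebra_simps)
  also have "\<dots> = - 1" using nz by (simp add: t_def field_simps)
  finally show False using form(3)[of "w + t *\<^sub>R y"] by simp
qed

text \<open>The eigenvalues are real: pairing \<open>((T - a)\<^sup>2 + b\<^sup>2) w = 0\<close> with \<open>w\<close> gives
  \<open>B ((T - a) w) ((T - a) w) + b\<^sup>2 B w w = 0\<close>. Hence \<open>w\<close> is null, \<open>T w = 0\<close>, and what is left of the
  equation is \<open>(a\<^sup>2 + b\<^sup>2) w = 0\<close>.\<close>
lemma cancel_nonreal_factor:
  assumes "b \<noteq> 0" "poly_op T ([:a\<^sup>2 + b\<^sup>2, - 2 * a, 1:] * q) = 0"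
  shows "poly_op T q = 0"
proof (rule blinfun_eqI)
  fix f
  define w where "w = poly_op T q f"
  have "poly_op T ([:a\<^sup>2 + b\<^sup>2, - 2 * a, 1:] * q) f = 0" using assms by simp
  then have eq: "(a\<^sup>2 + b\<^sup>2) *\<^sub>R w - (2 * a) *\<^sub>R T w + T (T w) = 0"
    unfolding poly_op_mult by (simp add: poly_op_pCons blinfun.bilinear_simps w_def algebra_simps)
  have "B (T w - a *\<^sub>R w) (T w - a *\<^sub>R w) + b\<^sup>2 * B w w
      = B ((a\<^sup>2 + b\<^sup>2) *\<^sub>R w - (2 * a) *\<^sub>R T w + T (T w)) w"
    using form(2)[of w "T w"] symmetric[of "T w" w]
    by (simp add: B_simps algebra_simps power2_eq_square)
  also have "\<dots> = 0" unfolding eq by (simp add: B_simps)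
  finally have "b\<^sup>2 * B w w \<le> 0" using form(3)[of "T w - a *\<^sub>R w"] by linarith
  then have "B w w = 0" using assms(1) form(3)[of w]
    by (smt (verit) mult_pos_pos zero_less_power2)
  then have "T w = 0" by (rule null)
  then have "(a\<^sup>2 + b\<^sup>2) *\<^sub>R w = 0" using eq by (simp add: blinfun.bilinear_simps)
  moreover have "a\<^sup>2 + b\<^sup>2 \<noteq> 0" using assms(1) by (simp add: sum_power2_eq_zero_iff)
  ultimately have "w = 0" by (simp only: scaleR_eq_0_iff simp_thms)
  then show "poly_op T q f = blinfun_apply 0 f" by (simp add: w_def)
qed

text \<open>Nonzero eigenvalues are semisimple: \<open>y = (T - a) w\<close> with \<open>(T - a) y = 0\<close> satisfies
  \<open>B y y = B w ((T - a) y) = 0\<close>, so \<open>T y = 0\<close> and therefore \<open>a y = 0\<close>.\<close>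
lemma cancel_double_root:
  assumes "a \<noteq> 0" "poly_op T ([:- a, 1:] * ([:- a, 1:] * q)) = 0"
  shows "poly_op T ([:- a, 1:] * q) = 0"
proof (rule blinfun_eqI)
  fix f
  define w where "w = poly_op T q f"
  define y where "y = T w - a *\<^sub>R w"
  have y: "poly_op T ([:- a, 1:] * q) f = y"
    unfolding poly_op_mult by (simp add: poly_op_linear blinfun.bilinear_simps w_def y_def)
  have "poly_op T ([:- a, 1:] * ([:- a, 1:] * q)) f = T y - a *\<^sub>R y"
    unfolding poly_op_mult[of T "[:- a, 1:]" "[:- a, 1:] * q"]
    by (simp add: poly_op_linear blinfun.bilinear_simps y del: mult_pCons_left)
  with assms have eq: "T y = a *\<^sub>R y" by simp
  have "B y y = B w (T y - a *\<^sub>R y)"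
    by (subst y_def, simp add: B_simps symmetric)
  also have "\<dots> = 0" by (simp add: eq B_simps)
  finally have "T y = 0" by (rule null)
  then show "poly_op T ([:- a, 1:] * q) f = blinfun_apply 0 f" using eq assms(1) y by simp
qed

text \<open>At the eigenvalue \<open>0\<close> a null vector need not vanish, so only nilpotency of order two can be
  reached: \<open>T\<^sup>3 w = 0\<close> makes first \<open>T\<^sup>2 w\<close> and then \<open>T w\<close> null, whence \<open>T (T w) = 0\<close>.\<close>
lemma cancel_triple_zero:
  assumes "poly_op T ([:0, 1:] * ([:0, 1:] ^ 2 * q)) = 0"
  shows "poly_op T ([:0, 1:] ^ 2 * q) = 0"
proof (rule blinfun_eqI)
  fix f
  define w where "w = poly_op T q f"
  have y: "poly_op T ([:0, 1:] ^ 2 * q) f = T (T w)"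
    unfolding poly_op_mult power2_eq_square by (simp add: poly_op_linear w_def)
  have "poly_op T ([:0, 1:] * ([:0, 1:] ^ 2 * q)) f = T (T (T w))"
    unfolding poly_op_mult power2_eq_square by (simp add: poly_op_linear w_def)
  with assms have eq: "T (T (T w)) = 0" by simp
  have "B (T (T w)) (T (T w)) = B (T w) (T (T (T w)))" by (rule symmetric)
  also have "\<dots> = 0" by (simp add: eq B_simps)
  finally have "B w (T (T w)) = 0" by (rule form_null_orthogonal)
  then have "B (T w) (T w) = 0" by (simp add: symmetric)
  then have "T (T w) = 0" by (rule null)
  then show "poly_op T ([:0, 1:] ^ 2 * q) f = blinfun_apply 0 f" using y by simp
qed

text \<open>The roots of an annihilating polynomial \<open>p\<close> are moved one at a time into the accumulated factor
  \<open>X\<^sup>2 \<Prod>\<^sub>t\<^sub>\<in>\<^sub>F (X - t)\<close>, and every root that the cancellation lemmas show to be superfluous is dropped.\<close>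
lemma real_split_annihilator_step:
  assumes "p \<noteq> 0" "finite F" "0 \<notin> F"
    and "poly_op T (p * ([:0, 1:] ^ 2 * (\<Prod>t\<in>F. [:- t, 1:]))) = 0"
  shows "\<exists>F. finite F \<and> 0 \<notin> F \<and> poly_op T ([:0, 1:] ^ 2 * (\<Prod>t\<in>F. [:- t, 1:])) = 0"
  using assms
proof (induction "degree p" arbitrary: p F rule: less_induct)
  case less
  define m where "m F = [:0, 1:] ^ 2 * (\<Prod>t\<in>F. [:- t, 1:] :: real poly)" for F
  have pm: "poly_op T (p * m F) = 0" using less.prems by (simp add: m_def)
  show ?case
  proof (cases "degree p = 0")
    case True
    then obtain c where c: "p = [:c:]" by (metis degree_eq_zeroE)
    have "c \<noteq> 0" using less.prems(1) c by simp
    moreover have "p * m F = smult c (m F)" unfolding c by simp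
    then have "c *\<^sub>R poly_op T (m F) = 0" using pm by (simp only: poly_op_smult)
    ultimately have "poly_op T (m F) = 0" by simp
    then show ?thesis using less.prems by (auto simp: m_def)
  next
    case False
    then obtain z where z: "complex_eval z p = 0" using complex_root_exists by blast
    show ?thesis
    proof (cases "Im z = 0")
      case False
      let ?d = "[:(Re z)\<^sup>2 + (Im z)\<^sup>2, - 2 * Re z, 1:]"
      obtain q where q: "p = ?d * q" using nonreal_root_dvd[OF z False] by (rule dvdE)
      have q0: "q \<noteq> 0" using q less.prems(1) by auto
      have "?d \<noteq> 0" "degree ?d = 2" by simp_all
      then have "degree p = 2 + degree q" using q q0 degree_mult_eq[of ?d q] by simp
      then have deg: "degree q < degree p" by simp
      have "poly_op T (q * m F) = 0"
      proof (rule cancel_nonreal_factor[OF False])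
        have "p * m F = ?d * (q * m F)" unfolding q by (rule mult.assoc)
        then show "poly_op T (?d * (q * m F)) = 0" using pm by (rule subst)
      qed
      then show ?thesis using less.hyps[OF deg q0 less.prems(2,3)] by (simp add: m_def)
    next
      case True
      define t where "t = Re z"
      obtain q where q: "p = [:- t, 1:] * q"
        using real_root_dvd[OF z True] unfolding t_def by (rule dvdE)
      have q0: "q \<noteq> 0" using q less.prems(1) by auto
      have "[:- t, 1:] \<noteq> 0" "degree [:- t, 1:] = 1" by simp_all
      then have "degree p = 1 + degree q" using q q0 degree_mult_eq[of "[:- t, 1:]" q] by simp
      then have deg: "degree q < degree p" by simp
      consider "t = 0" | "t \<noteq> 0" "t \<in> F" | "t \<noteq> 0" "t \<notin> F" by blast
      then show ?thesis
      proof cases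
        case 1
        have "p * m F = [:0, 1:] * ([:0, 1:] ^ 2 * (q * (\<Prod>t\<in>F. [:- t, 1:])))"
          by (simp only: q 1 m_def mult_ac minus_zero)
        from pm[unfolded this] have "poly_op T ([:0, 1:] ^ 2 * (q * (\<Prod>t\<in>F. [:- t, 1:]))) = 0"
          by (rule cancel_triple_zero)
        then have "poly_op T (q * m F) = 0"
          by (simp only: m_def mult_ac)
        then show ?thesis using less.hyps[OF deg q0 less.prems(2,3)] by (simp add: m_def)
      next
        case 2
        let ?r = "q * ([:0, 1:] ^ 2 * (\<Prod>t\<in>F - {t}. [:- t, 1:]))"
        have mF: "m F = [:0, 1:] ^ 2 * ([:- t, 1:] * (\<Prod>t\<in>F - {t}. [:- t, 1:]))"
          unfolding m_def using less.prems 2 by (subst prod.remove[of F t]) auto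
        have "p * m F = [:- t, 1:] * ([:- t, 1:] * ?r)"
          unfolding q mF by (simp only: mult_ac)
        from pm[unfolded this] have "poly_op T ([:- t, 1:] * ?r) = 0"
          by (rule cancel_double_root[OF 2(1)])
        then have "poly_op T (q * m F) = 0"
          unfolding mF by (simp only: mult_ac)
        then show ?thesis using less.hyps[OF deg q0 less.prems(2,3)] by (simp add: m_def)
      next
        case 3
        have "m (insert t F) = [:- t, 1:] * m F"
          unfolding m_def prod.insert[OF less.prems(2) 3(2)] by (simp only: mult_ac)
        then have "poly_op T (q * m (insert t F)) = 0"
          using pm unfolding q by (simp only: mult_ac)
        then show ?thesis using less.hyps[OF deg q0, of "insert t F"] less.prems 3
          by (simp add: m_def)
      qed
    qed
  qed
qed

lemma real_split_annihilator:
  "\<exists>F. finite F \<and> 0 \<notin> F \<and> poly_op T ([:0, 1:] ^ 2 * (\<Prod>t\<in>F. [:- t, 1:])) = 0"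
proof -
  obtain S where "finite S" "range (blinfun_apply T) \<subseteq> span S" using finite_rank by blast
  then obtain p where p: "p \<noteq> 0" "poly_op T p = 0" using annihilating_polynomial by blast
  then have "poly_op T (p * ([:0, 1:] ^ 2 * (\<Prod>t\<in>{}. [:- t, 1:]))) = 0"
    by (intro poly_op_dvd_eq_0[OF p(2)] dvd_triv_left)
  then show ?thesis by (intro real_split_annihilator_step[of p "{}"] p) auto
qed

text \<open>Since \<open>T\<^sup>2 \<Prod>\<^sub>t\<^sub>\<in>\<^sub>F (T - t) = 0\<close>, the projections for nonzero \<open>t\<close> are the Lagrange polynomials of the
  nodes \<open>F\<close> with a double zero at \<open>0\<close>, evaluated at \<open>T\<close>. The projection for \<open>0\<close> is the complement. All
  identities are divisibilities by the annihilating polynomial, and the projections are symmetric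
  because they are polynomials in \<open>T\<close>.\<close>
theorem spectral_decomposition:
  obtains F :: "real set" and E :: "real \<Rightarrow> 'a \<Rightarrow>\<^sub>L 'a" where
    "finite F" "\<And>t. t \<in> F \<Longrightarrow> E t \<noteq> 0" "(\<Sum>t\<in>F. E t) = id_blinfun"
    "\<And>s t. s \<in> F \<Longrightarrow> t \<in> F \<Longrightarrow> E s o\<^sub>L E t = (if s = t then E t else 0)"
    "\<And>t. T o\<^sub>L E t = E t o\<^sub>L T"
    "\<And>t. t \<in> F \<Longrightarrow> t \<noteq> 0 \<Longrightarrow> T o\<^sub>L E t = t *\<^sub>R E t"
    "T o\<^sub>L (T o\<^sub>L E 0) = 0"
    "0 \<notin> F \<Longrightarrow> E 0 = 0"
    "\<And>t f g. B (E t f) g = B f (E t g)"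
proof -
  obtain F where F: "finite F" "0 \<notin> F" and
    ann: "poly_op T ([:0, 1:] ^ 2 * (\<Prod>t\<in>F. [:- t, 1:])) = 0"
    using real_split_annihilator by blast
  define x where "x = [:0, 1::real:]"
  define R where "R A = (\<Prod>t\<in>A. [:- t, 1:] :: real poly)" for A
  define m where "m = x ^ 2 * R F"
  have m0: "poly_op T q = 0" if "m dvd q" for q
    using ann that poly_op_dvd_eq_0 by (auto simp: m_def R_def x_def)
  define c where "c t = 1 / (t ^ 2 * (\<Prod>s\<in>F - {t}. t - s))" for t
  define e1 where "e1 t = smult (c t) (x ^ 2 * R (F - {t}))" for t
  define e where "e t = (if t = 0 then 1 - sum e1 F else e1 t)" for t
  have e_t: "e t = e1 t" if "t \<in> F" for t using that F by (auto simp: e_def)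
  have split: "R F = [:- t, 1:] * R (F - {t})" if "t \<in> F" for t
    unfolding R_def using F(1) that by (rule prod.remove)
  have x2: "x ^ 2 dvd e t" if "t \<in> F" for t
    by (simp only: e_t[OF that] e1_def dvd_smult dvd_triv_left)
  have Rx: "m dvd [:- t, 1:] * e t" if "t \<in> F" for t
    unfolding e_t[OF that] m_def split[OF that] e1_def
    by (simp only: mult_smult_right) (simp only: dvd_smult mult_ac dvd_refl)
  have val: "poly (e1 t) s = (if s = t then 1 else 0)" if "s \<in> F" "t \<in> F" for s t
    using that F by (auto simp: e1_def c_def R_def x_def poly_prod prod_zero_iff)
  have e0: "R F dvd e 0"
    unfolding R_def
  proof (rule root_product_dvd[OF F(1)])
    fix t assume "t \<in> F"
    then show "poly (e 0) t = 0" using F by (simp add: e_def poly_sum val sum.delta)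
  qed
  have prod_e: "m dvd e s * e t" if "s \<in> insert 0 F" "t \<in> insert 0 F" "s \<noteq> t" for s t
  proof -
    have *: "m dvd e s * e 0" if "s \<in> F" for s
      unfolding m_def by (intro mult_dvd_mono x2 e0 that)
    have "m dvd e s * e t" if "s \<in> F" "t \<in> F" "s \<noteq> t" for s t
    proof -
      have "[:- s, 1:] dvd e t"
        unfolding e_t[OF that(2)] e1_def R_def
        by (intro dvd_smult dvd_mult dvd_prodI) (use F that in auto)
      then obtain q where "e t = [:- s, 1:] * q" by (rule dvdE)
      then have "e s * e t = ([:- s, 1:] * e s) * q" by (simp only: mult_ac)
      then show ?thesis using Rx[OF that(1)] by (metis dvd_mult2)
    qed
    with * that show ?thesis by (metis insert_iff mult.commute)
  qed
  define E where "E t = poly_op T (e t)" for t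
  have orth: "E s o\<^sub>L E t = 0" if "s \<in> insert 0 F" "t \<in> insert 0 F" "s \<noteq> t" for s t
    using m0[OF prod_e[OF that]] by (simp add: E_def poly_op_mult)
  have sum1: "(\<Sum>t\<in>insert 0 F. e t) = 1"
    using F by (simp add: e_t cong: sum.cong) (simp add: e_def)
  have sumE: "(\<Sum>t\<in>insert 0 F. E t) = id_blinfun"
    unfolding E_def poly_op_sum[symmetric] sum1 by simp
  have idem: "E t o\<^sub>L E t = E t" if t: "t \<in> insert 0 F" for t
  proof -
    have "E t = E t o\<^sub>L (\<Sum>s\<in>insert 0 F. E s)" unfolding sumE by (rule blinfun_eqI) simp
    also have "\<dots> = (\<Sum>s\<in>insert 0 F. E t o\<^sub>L E s)"
      by (rule blinfun_eqI) (simp add: blinfun.sum_left blinfun.sum_right del: sum.insert)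
    also have "\<dots> = (\<Sum>s\<in>insert 0 F. if s = t then E t o\<^sub>L E t else 0)"
      using t orth by (intro sum.cong) auto
    also have "\<dots> = E t o\<^sub>L E t" using F t by (subst sum.delta) auto
    finally show ?thesis by simp
  qed
  \<comment> \<open>Some of the candidates may vanish; only the others belong to the spectrum.\<close>
  define F' where "F' = {t \<in> insert 0 F. E t \<noteq> 0}"
  show ?thesis
  proof (rule that[of F' E])
    show "finite F'" using F by (simp add: F'_def)
    show "E t \<noteq> 0" if "t \<in> F'" for t using that by (simp add: F'_def)
    have "(\<Sum>t\<in>F'. E t) = (\<Sum>t\<in>insert 0 F. E t)"
      using F by (intro sum.mono_neutral_left) (auto simp: F'_def)
    then show "(\<Sum>t\<in>F'. E t) = id_blinfun" using sumE by simp
    show "E s o\<^sub>L E t = (if s = t then E t else 0)" if "s \<in> F'" "t \<in> F'" for s t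
      using that orth idem by (auto simp: F'_def)
    show "T o\<^sub>L E t = E t o\<^sub>L T" for t
      using poly_op_mult[of T x "e t"] poly_op_mult[of T "e t" x]
      by (simp add: E_def x_def poly_op_X mult.commute)
    show "T o\<^sub>L E t = t *\<^sub>R E t" if "t \<in> F'" "t \<noteq> 0" for t
    proof -
      have "poly_op T ([:- t, 1:] * e t) = 0" using that by (intro m0 Rx) (auto simp: F'_def)
      then have "(poly_op T [:- t, 1:] o\<^sub>L E t) f = 0" for f
        unfolding poly_op_mult E_def[symmetric] by simp
      then show ?thesis
        by (intro blinfun_eqI) (simp add: poly_op_linear blinfun.bilinear_simps)
    qed
    have "m dvd x * (x * e 0)"
      unfolding m_def power2_eq_square mult.assoc by (intro mult_dvd_mono dvd_refl e0)
    then have "poly_op T (x * (x * e 0)) = 0" by (rule m0)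
    then show "T o\<^sub>L (T o\<^sub>L E 0) = 0" by (simp only: E_def poly_op_mult x_def poly_op_X)
    show "E 0 = 0" if "0 \<notin> F'" using that unfolding F'_def by blast
    show "B (E t f) g = B f (E t g)" for t f g unfolding E_def by (rule poly_op_symmetric)
  qed
qed

end

section \<open>A closed curve around prescribed real points\<close>

text \<open>Let \<open>p\<close> be a real polynomial that vanishes on \<open>G\<close> and is at least \<open>2 b\<close> on \<open>F - G\<close>. The shear
  \<open>(x, y) \<mapsto> (x, y + p x)\<close> is a homeomorphism of the plane that fixes the points of \<open>G\<close> and lifts
  those of \<open>F - G\<close> above the circle of radius \<open>b\<close>. The preimage of this circle is therefore a smooth
  Jordan curve around exactly the points of \<open>G\<close>. A vertical ray joins each point of \<open>F - G\<close> to
  infinity; the component of a point of \<open>G\<close> is trapped in the preimage of the disc. If the curve has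
  the wrong orientation, it is reversed.\<close>
lemma enclosing_curve:
  fixes F :: "real set"
  assumes "finite F" "G \<subseteq> F"
  obtains \<gamma> where "valid_path \<gamma>" "simple_path \<gamma>" "pathfinish \<gamma> = pathstart \<gamma>"
    "\<forall>z\<in>inside (path_image \<gamma>). winding_number \<gamma> z = 1"
    "path_image \<gamma> \<inter> complex_of_real ` F = {}"
    "inside (path_image \<gamma>) \<inter> complex_of_real ` F = complex_of_real ` G"
proof -
  obtain b where b: "b > 0" "\<And>s. s \<in> F \<Longrightarrow> \<bar>s\<bar> < b"
  proof -
    have "finite (abs ` F)" using assms by simp
    then have "bdd_above (abs ` F)" by simp
    then obtain b where b: "\<And>s. s \<in> F \<Longrightarrow> \<bar>s\<bar> \<le> b" by (auto simp: bdd_above_def)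
    have "\<bar>s\<bar> < \<bar>b\<bar> + 1" if "s \<in> F" for s using b[OF that] by linarith
    then show ?thesis by (intro that[of "\<bar>b\<bar> + 1"]) auto
  qed
  define p0 where "p0 = (\<lambda>x::real. \<Prod>r\<in>G. (x - r)\<^sup>2)"
  have finG: "finite G" using assms finite_subset by auto
  have p0_pos: "p0 s > 0" if "s \<in> F - G" for s
    unfolding p0_def using that by (intro prod_pos) auto
  have "bdd_above ((\<lambda>s. 2 * b / p0 s) ` (F - G))" using assms by simp
  then obtain C where C: "\<And>s. s \<in> F - G \<Longrightarrow> 2 * b / p0 s \<le> C" by (auto simp: bdd_above_def)
  define p where "p x = C * p0 x" for x
  have pG: "p s = 0" if "s \<in> G" for s using that finG by (auto simp: p_def p0_def prod_zero_iff)
  have pF: "p s \<ge> 2 * b" if "s \<in> F - G" for s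
    using C[OF that] p0_pos[OF that] by (simp add: p_def field_simps)
  define Q where "Q = smult C (\<Prod>r\<in>G. [:- r, 1:] ^ 2)"
  have pQ: "p x = poly Q x" for x
    by (simp add: p_def p0_def Q_def poly_prod)
  have p_deriv: "(p has_real_derivative poly (pderiv Q) x) (at x)" for x
    unfolding pQ[abs_def] by (rule poly_DERIV)
  have p_cont: "continuous_on A p" for A
    by (meson DERIV_isCont continuous_at_imp_continuous_on p_deriv)
  define S where "S z = Complex (Re z) (Im z + p (Re z))" for z
  define S' where "S' z = Complex (Re z) (Im z - p (Re z))" for z
  have SS: "S (S' z) = z" "S' (S z) = z" for z by (auto simp: S_def S'_def)
  have S_cont: "continuous_on A S" for A
    unfolding S_def Complex_eq
    by (intro continuous_intros continuous_on_compose2[OF p_cont[of UNIV]]) auto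
  have S'_cont: "continuous_on A S'" for A
    unfolding S'_def Complex_eq
    by (intro continuous_intros continuous_on_compose2[OF p_cont[of UNIV]]) auto
  define g where "g = S' \<circ> circlepath 0 b"
  have img: "path_image g = S' ` sphere 0 b"
    using b by (simp add: g_def path_image_compose)
  have mem: "z \<in> path_image g \<longleftrightarrow> norm (S z) = b" for z
  proof
    assume "norm (S z) = b"
    then have "S' (S z) \<in> S' ` sphere 0 b" by (intro imageI) simp
    then show "z \<in> path_image g" by (simp only: SS img)
  qed (auto simp: img SS)
  have simple: "simple_path g"
    unfolding g_def using b SS
    by (intro simple_path_continuous_image S'_cont inj_on_inverseI[where g = S])
       (simp_all add: simple_path_circlepath)
  have closed: "pathfinish g = pathstart g"
    by (simp add: g_def pathfinish_compose pathstart_compose)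
  have valid: "valid_path g"
  proof -
    have g_eq: "g = (\<lambda>t. Complex (b * cos (2 * pi * t)) (b * sin (2 * pi * t) - p (b * cos (2 * pi * t))))"
      by (auto simp: g_def fun_eq_iff circlepath S'_def complex_eq_iff Re_exp Im_exp)
    define D where "D t = Complex (- b * sin (2 * pi * t) * (2 * pi))
      (b * cos (2 * pi * t) * (2 * pi) - poly (pderiv Q) (b * cos (2 * pi * t)) * (- b * sin (2 * pi * t) * (2 * pi)))" for t
    have "(g has_vector_derivative D t) (at t)" for t
    proof -
      have "((\<lambda>t. b * cos (2 * pi * t)) has_real_derivative (- b * sin (2 * pi * t) * (2 * pi))) (at t)" for t
        by (auto intro!: derivative_eq_intros)
      moreover have "((\<lambda>t. b * sin (2 * pi * t) - p (b * cos (2 * pi * t))) has_real_derivative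
        (b * cos (2 * pi * t) * (2 * pi) - poly (pderiv Q) (b * cos (2 * pi * t)) * (- b * sin (2 * pi * t) * (2 * pi)))) (at t)" for t
        by (auto intro!: derivative_eq_intros DERIV_chain2[OF p_deriv])
      ultimately show ?thesis
        unfolding g_eq D_def has_vector_derivative_complex_iff by (simp add: has_real_derivative_iff_has_vector_derivative)
    qed
    moreover have "continuous_on {0..1} D"
      unfolding D_def Complex_eq by (intro continuous_intros)
    ultimately have "g C1_differentiable_on {0..1}"
      unfolding C1_differentiable_on_def by blast
    then show ?thesis by (simp add: valid_path_def C1_differentiable_imp_piecewise)
  qed
  have disj: "path_image g \<inter> complex_of_real ` F = {}"
  proof -
    have "norm (S (of_real s)) \<noteq> b" if "s \<in> F" for s
    proof (cases "s \<in> G")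
      case True
      then show ?thesis using b that by (auto simp: S_def pG Complex_eq)
    next
      case False
      then show ?thesis using pF[of s] b that abs_Im_le_cmod[of "S (of_real s)"] by (auto simp: S_def)
    qed
    then show ?thesis by (auto simp: mem)
  qed
  have in_G: "of_real s \<in> inside (path_image g)" if "s \<in> G" for s
  proof -
    let ?K = "connected_component_set (- path_image g) (of_real s)"
    have "S ` ?K \<subseteq> ball 0 b"
    proof (rule ccontr)
      assume "\<not> S ` ?K \<subseteq> ball 0 b"
      moreover have "S (of_real s) \<in> ball 0 b" using b that assms by (auto simp: S_def pG Complex_eq)
      moreover have "of_real s \<in> ?K" using disj that assms by auto
      moreover have "connected (S ` ?K)" by (intro connected_continuous_image S_cont) auto
      ultimately have "S ` ?K \<inter> frontier (ball 0 b) \<noteq> {}"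
        by (intro connected_Int_frontier) blast+
      then obtain w where w: "w \<in> S ` ?K" "w \<in> frontier (ball 0 b)" by blast
      obtain z where z: "z \<in> ?K" "w = S z" using w(1) by (rule imageE) 
      have "norm (S z) = b" using w(2) b z(2) by simp
      then have "z \<in> path_image g" by (simp only: mem)
      moreover have "z \<in> - path_image g" using z(1) connected_component_subset by (rule rev_subsetD)
      ultimately show False by simp
    qed
    then have "S' ` S ` ?K \<subseteq> S' ` cball 0 b" by (intro image_mono) auto
    then have "?K \<subseteq> S' ` cball 0 b" by (simp add: image_image SS)
    moreover have "bounded (S' ` cball 0 b)"
      by (intro compact_imp_bounded compact_continuous_image S'_cont) auto
    ultimately have "bounded ?K" using bounded_subset by blast
    then show ?thesis using disj that assms by (auto simp: inside_def)
  qed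
  have out_F: "of_real s \<notin> inside (path_image g)" if "s \<in> F - G" for s
  proof
    assume ins: "of_real s \<in> inside (path_image g)"
    let ?L = "(\<lambda>t. Complex s t) ` {0..}"
    have "?L \<subseteq> connected_component_set (- path_image g) (of_real s)"
    proof (rule connected_component_maximal)
      show "of_real s \<in> ?L" by (auto simp: image_iff complex_eq_iff)
      show "connected ?L" unfolding Complex_eq by (intro connected_continuous_image continuous_intros) auto
      have "norm (S (Complex s t)) > b" if "t \<ge> 0" for t
        using abs_Im_le_cmod[of "S (Complex s t)"] pF[of s] \<open>s \<in> F - G\<close> that b by (auto simp: S_def)
      then show "?L \<subseteq> - path_image g" using mem by fastforce
    qed
    then have "bounded ?L" using ins bounded_subset by (auto simp: inside_def)
    then obtain M where M: "\<And>t. t \<ge> 0 \<Longrightarrow> norm (Complex s t) \<le> M" by (auto simp: bounded_iff)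
    from M[of "\<bar>M\<bar> + 1"] abs_Im_le_cmod[of "Complex s (\<bar>M\<bar> + 1)"] show False by auto
  qed
  have ins: "inside (path_image g) \<inter> complex_of_real ` F = complex_of_real ` G"
    using in_G out_F assms(2) by blast
  consider "\<forall>z\<in>inside (path_image g). winding_number g z = 1"
    | "\<forall>z\<in>inside (path_image g). winding_number g z = - 1"
    by (metis simple_closed_path_winding_number_inside[OF simple])
  then show ?thesis
  proof cases
    case 1 then show ?thesis using that valid simple closed disj ins by blast
  next
    case 2
    have "winding_number (reversepath g) z = 1" if "z \<in> inside (path_image g)" for z
    proof -
      have "z \<notin> path_image g" using that inside_no_overlap by blast
      then have "winding_number (reversepath g) z = - winding_number g z"
        by (intro winding_number_reversepath valid_path_imp_path valid)
      then show ?thesis using 2 that by simp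
    qed
    then have rev: "\<forall>z\<in>inside (path_image (reversepath g)). winding_number (reversepath g) z = 1"
      by simp
    show ?thesis
    proof (rule that[of "reversepath g"])
      show "\<forall>z\<in>inside (path_image (reversepath g)). winding_number (reversepath g) z = 1"
        by (rule rev)
    qed (use valid simple closed disj ins in \<open>auto simp: valid_path_imp_reverse simple_path_reversepath\<close>)
  qed
qed

section \<open>The complexification and multiplication by complex scalars\<close>

lemma bm_Re_complexify [simp]: "bm_Re (complexify S f) = S (bm_Re f)"
  by (rule bm_eqI) (simp add: bm_Re_apply complexify_apply)

lemma bm_Im_complexify [simp]: "bm_Im (complexify S f) = S (bm_Im f)"
  by (rule bm_eqI) (simp add: bm_Im_apply complexify_apply)

lemma complexify_compose: "complexify (A o\<^sub>L B) = complexify A o\<^sub>L complexify B"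
  by (intro blinfun_eqI bm_eqI) (simp add: complexify_apply)

lemma complexify_id: "complexify id_blinfun = id_blinfun"
  by (intro blinfun_eqI bm_eqI) (simp add: complexify_apply bm_Re_apply bm_Im_apply)

lemma complexify_add: "complexify (A + B) = complexify A + complexify B"
  by (intro blinfun_eqI bm_eqI) (simp add: complexify_apply blinfun.bilinear_simps complex_eq_iff)

lemma complexify_diff: "complexify (A - B) = complexify A - complexify B"
  by (intro blinfun_eqI bm_eqI) (simp add: complexify_apply blinfun.bilinear_simps complex_eq_iff)

lemma complexify_0: "complexify 0 = 0"
  by (intro blinfun_eqI bm_eqI) (simp add: complexify_apply blinfun.bilinear_simps complex_eq_iff)

lemma complexify_sum: "complexify (sum A I) = (\<Sum>i\<in>I. complexify (A i))"
  by (induction I rule: infinite_finite_induct) (auto simp: complexify_0 complexify_add)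

lemma complexify_scaleR: "complexify (c *\<^sub>R A) = cmult (of_real c) o\<^sub>L complexify A"
  by (intro blinfun_eqI bm_eqI)
    (simp add: complexify_apply cmult_apply blinfun.bilinear_simps complex_eq_iff)

lemma complexify_of_real: "complexify S (bm_of_real f) = bm_of_real (S f)"
proof -
  have "bm_Re (bm_of_real f) = f" "bm_Im (bm_of_real f) = 0"
    by (auto intro!: bm_eqI simp: bm_Re_apply bm_Im_apply bm_of_real_apply)
  then show ?thesis
    by (intro bm_eqI) (simp add: complexify_apply bm_of_real_apply blinfun.bilinear_simps complex_eq_iff)
qed

lemma complexify_eq_0D:
  fixes S :: "('x::topological_space) bop"
  assumes "complexify S = 0"
  shows "S = 0"
proof (intro blinfun_eqI bm_eqI)
  fix f :: "('x, real) bmfun" and x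
  have "bm_of_real (S f) x = 0" using complexify_of_real[of S f] assms by simp
  then show "bm_apply (S f) x = bm_apply (blinfun_apply 0 f) x" by (simp add: bm_of_real_apply)
qed

lemma norm_bm_of_real_le: "norm (bm_of_real f) \<le> norm f"
  by (intro norm_bmfun_le) (use norm_bm_apply_le[of f] in \<open>simp add: bm_of_real_apply\<close>)

lemma cmult_simps:
  "cmult 0 = 0" "cmult 1 = id_blinfun" "cmult (c + d) = cmult c + cmult d"
  "cmult (c - d) = cmult c - cmult d" "cmult (- c) = - cmult c" "cmult c o\<^sub>L cmult d = cmult (c * d)"
  by (intro blinfun_eqI bm_eqI; simp add: cmult_apply blinfun.bilinear_simps algebra_simps)+

lemma cmult_complexify_commute:
  fixes A :: "('x::topological_space) bop"
  shows "cmult c o\<^sub>L complexify A = complexify A o\<^sub>L cmult c"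
proof (intro blinfun_eqI bm_eqI)
  fix f :: "('x, complex) bmfun" and x
  have "bm_Re (cmult c f) = Re c *\<^sub>R bm_Re f - Im c *\<^sub>R bm_Im f"
    "bm_Im (cmult c f) = Re c *\<^sub>R bm_Im f + Im c *\<^sub>R bm_Re f"
    by (auto intro!: bm_eqI simp: bm_Re_apply bm_Im_apply cmult_apply)
  then show "(cmult c o\<^sub>L complexify A) f x = (complexify A o\<^sub>L cmult c) f x"
    by (simp add: complexify_apply cmult_apply blinfun.bilinear_simps complex_eq_iff)
qed

lemma bounded_linear_cmult_compose:
  fixes A :: "('x::topological_space) cbop"
  shows "bounded_linear (\<lambda>c. cmult c o\<^sub>L A)"
proof (rule bounded_linear_intro[of _ "norm A"])
  show "cmult (r *\<^sub>R c) o\<^sub>L A = r *\<^sub>R (cmult c o\<^sub>L A)" for r c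
    by (intro blinfun_eqI bm_eqI) (simp add: cmult_apply blinfun.bilinear_simps)
  show "cmult (c + d) o\<^sub>L A = (cmult c o\<^sub>L A) + (cmult d o\<^sub>L A)" for c d
    by (intro blinfun_eqI bm_eqI) (simp add: cmult_apply blinfun.bilinear_simps algebra_simps)
  show "norm (cmult c o\<^sub>L A) \<le> norm c * norm A" for c
  proof -
    have "norm (cmult c :: 'x cbop) \<le> norm c"
    proof (rule norm_blinfun_bound)
      fix f :: "('x, complex) bmfun"
      show "norm (cmult c f) \<le> norm c * norm f"
        by (intro norm_bmfun_le) (simp add: cmult_apply norm_mult mult_left_mono norm_bm_apply_le)
    qed simp
    then show ?thesis using norm_blinfun_compose[of "cmult c" A]
      by (meson mult_right_mono norm_ge_zero order_trans)
  qed
qed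

lemma cmult_complexify: "complexify A (cmult c f) = cmult c (complexify A f)"
  using arg_cong[OF cmult_complexify_commute[of c A], of "\<lambda>L. blinfun_apply L f"] by simp

lemma cmult_cmult: "cmult c (cmult d f) = cmult (c * d) f"
  by (simp flip: cmult_simps)

section \<open>The resolvent and its contour integrals\<close>

text \<open>The algebraic part of \<open>spectral_decomposition\<close>: a resolution of the identity by real projections
  commuting with \<open>T\<close>, on whose ranges \<open>T\<close> is the scalar \<open>t\<close>, except that at \<open>0\<close> it is nilpotent of order
  two. In the operator \<open>I - T\<close> this part sits at the point \<open>1\<close>.\<close>
locale nilpotent_at_0_resolution =
  fixes T :: "('x::topological_space) bop" and F :: "real set" and E :: "real \<Rightarrow> 'x bop"
  assumes finite: "finite F"
    and nonzero: "\<And>t. t \<in> F \<Longrightarrow> E t \<noteq> 0"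
    and sum_id: "(\<Sum>t\<in>F. E t) = id_blinfun"
    and orth: "\<And>s t. s \<in> F \<Longrightarrow> t \<in> F \<Longrightarrow> E s o\<^sub>L E t = (if s = t then E t else 0)"
    and commute: "\<And>t. T o\<^sub>L E t = E t o\<^sub>L T"
    and eigen: "\<And>t. t \<in> F \<Longrightarrow> t \<noteq> 0 \<Longrightarrow> T o\<^sub>L E t = t *\<^sub>R E t"
    and nil: "T o\<^sub>L (T o\<^sub>L E 0) = 0"
    and absent: "0 \<notin> F \<Longrightarrow> E 0 = 0"
begin

text \<open>The partial fraction expansion of \<open>(I - T - z)\<^sup>-\<^sup>1\<close>: a simple pole at each \<open>1 - t\<close> and a double pole at
  \<open>1\<close> whose coefficient is the nilpotent part.\<close>
definition resolvent_formula :: "complex \<Rightarrow> 'x cbop"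
  where "resolvent_formula z = (\<Sum>t\<in>F. cmult (1 / (of_real (1 - t) - z)) o\<^sub>L complexify (E t))
    + (cmult (1 / (1 - z)\<^sup>2) o\<^sub>L complexify (T o\<^sub>L E 0))"

lemma resolvent_formula_apply: "resolvent_formula z f =
   (\<Sum>t\<in>F. cmult (1 / (of_real (1 - t) - z)) (complexify (E t) f))
    + cmult (1 / (1 - z)\<^sup>2) (complexify T (complexify (E 0) f))"
  by (simp add: resolvent_formula_def blinfun.sum_left blinfun.add_left complexify_compose)

lemma complexify_T_E:
  assumes "t \<in> F"
  shows "complexify T (complexify (E t) f) = cmult (of_real t) (complexify (E t) f)
    + (if t = 0 then complexify T (complexify (E 0) f) else 0)"
proof (cases "t = 0")
  case True
  then show ?thesis by (simp add: cmult_simps)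
next
  case False
  have "complexify T (complexify (E t) f) = complexify (T o\<^sub>L E t) f"
    by (simp add: complexify_compose)
  also have "\<dots> = cmult (of_real t) (complexify (E t) f)"
    by (simp only: eigen[OF assms False] complexify_scaleR) simp
  finally show ?thesis using False by simp
qed

lemma complexify_sum_id: "(\<Sum>t\<in>F. complexify (E t) f) = f"
proof -
  have "(\<Sum>t\<in>F. complexify (E t) f) = complexify (\<Sum>t\<in>F. E t) f"
    by (simp add: complexify_sum blinfun.sum_left)
  then show ?thesis by (simp add: sum_id complexify_id)
qed

lemma complexify_nil: "complexify T (complexify T (complexify (E 0) f)) = 0"
  using arg_cong[OF nil, of "\<lambda>L. complexify L f"] by (simp add: complexify_compose complexify_0)

text \<open>On the range of \<open>E t\<close> the operator \<open>A = I - T - z\<close> is the scalar \<open>1 - t - z\<close>, which cancels the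
  denominator. At \<open>t = 0\<close> there is the error term \<open>N / (1 - z)\<close>; the double pole produces the same term
  with the opposite sign. The other order of composition follows since everything commutes.\<close>
lemma is_resolvent_formula:
  assumes z: "\<And>t. t \<in> F \<Longrightarrow> z \<noteq> of_real (1 - t)"
  shows "is_resolvent (id_blinfun - T) z (resolvent_formula z)"
proof -
  define A where "A = complexify (id_blinfun - T) - cmult z"
  have A_apply: "A f = cmult (1 - z) f - complexify T f" for f
    by (simp add: A_def blinfun.diff_left complexify_diff complexify_id cmult_simps)
  define N where "N f = complexify T (complexify (E 0) f)" for f
  have AR: "A (resolvent_formula z f) = f" for f
  proof -
    have "A (resolvent_formula z f) = (\<Sum>t\<in>F. cmult (1 / (of_real (1 - t) - z)) (A (complexify (E t) f)))
        + cmult (1 / (1 - z)\<^sup>2) (A (N f))"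
      unfolding resolvent_formula_apply A_apply N_def
      by (simp add: blinfun.add_right blinfun.sum_right blinfun.diff_right cmult_complexify
         cmult_cmult mult.commute sum_subtractf)
    also have "A (N f) = cmult (1 - z) (N f)"
      by (simp add: A_apply N_def complexify_nil)
    also have "(\<Sum>t\<in>F. cmult (1 / (of_real (1 - t) - z)) (A (complexify (E t) f)))
       = (\<Sum>t\<in>F. complexify (E t) f - (if t = 0 then cmult (1 / (1 - z)) (N f) else 0))"
    proof (intro sum.cong refl)
      fix t assume t: "t \<in> F"
      then have "of_real (1 - t) - z \<noteq> 0" using z[OF t] by simp
      then have inv: "1 / (of_real (1 - t) - z) * (of_real (1 - t) - z) = 1" by simp
      have "A (complexify (E t) f) = cmult (of_real (1 - t) - z) (complexify (E t) f)
          - (if t = 0 then N f else 0)"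
        unfolding A_apply complexify_T_E[OF t]
        by (simp add: cmult_simps N_def blinfun.bilinear_simps)
      then show "cmult (1 / (of_real (1 - t) - z)) (A (complexify (E t) f))
         = complexify (E t) f - (if t = 0 then cmult (1 / (1 - z)) (N f) else 0)"
        by (simp only: blinfun.diff_right cmult_cmult inv) (simp add: cmult_simps blinfun.bilinear_simps)
    qed
    also have "\<dots> = f - (if 0 \<in> F then cmult (1 / (1 - z)) (N f) else 0)"
      using finite by (simp add: sum_subtractf complexify_sum_id)
    also have "(if 0 \<in> F then cmult (1 / (1 - z)) (N f) else 0) = cmult (1 / (1 - z)) (N f)"
      using absent by (auto simp: N_def complexify_0 blinfun.bilinear_simps)
    also have "cmult (1 / (1 - z)\<^sup>2) (cmult (1 - z) (N f)) = cmult (1 / (1 - z)) (N f)"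
      by (simp add: cmult_cmult power2_eq_square)
    finally show ?thesis by simp
  qed
  have TE: "complexify (E t) (complexify T f) = complexify T (complexify (E t) f)" for t f
    using arg_cong[OF commute[of t], of "\<lambda>L. complexify L f"] by (simp add: complexify_compose)
  have "resolvent_formula z (A f) = A (resolvent_formula z f)" for f
    unfolding resolvent_formula_apply A_apply
    by (simp add: blinfun.add_right blinfun.sum_right blinfun.diff_right cmult_complexify
         cmult_cmult mult.commute sum_subtractf TE)
  then show ?thesis
    unfolding is_resolvent_def A_def[symmetric] by (auto intro!: blinfun_eqI simp: AR)
qed

text \<open>At \<open>z = 1 - t\<close> a nonzero projection is killed by \<open>I - T - z\<close>, or by its square when \<open>t = 0\<close>, which
  contradicts the existence of a resolvent.\<close>
lemma spectrum_eq: "spectrum (id_blinfun - T) = (\<lambda>t. complex_of_real (1 - t)) ` F"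
proof (intro equalityI subsetI)
  fix z assume "z \<in> spectrum (id_blinfun - T)"
  then show "z \<in> (\<lambda>t. complex_of_real (1 - t)) ` F"
    using is_resolvent_formula[of z] by (auto simp: spectrum_def image_iff)
next
  fix z assume "z \<in> (\<lambda>t. complex_of_real (1 - t)) ` F"
  then obtain t where t: "t \<in> F" "z = of_real (1 - t)" by auto
  have "\<not> is_resolvent (id_blinfun - T) z R" for R
  proof
    assume R: "is_resolvent (id_blinfun - T) z R"
    define A where "A = complexify (id_blinfun - T) - cmult z"
    have RA: "R (A f) = f" for f
    proof -
      have "R o\<^sub>L A = id_blinfun" using R unfolding is_resolvent_def A_def[symmetric] by simp
      then have "(R o\<^sub>L A) f = id_blinfun f" by simp
      then show ?thesis by simp
    qed
    have A_apply: "A f = cmult (of_real t) f - complexify T f" for f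
      by (simp add: A_def blinfun.diff_left complexify_diff complexify_id cmult_simps t)
    have "complexify (E t) f = 0" for f
    proof (cases "t = 0")
      case True
      have "A (A (complexify (E 0) f)) = 0"
        by (simp add: A_apply True cmult_simps blinfun.bilinear_simps complexify_nil)
      then show ?thesis using RA True by (metis blinfun.zero_right)
    next
      case False
      have "A (complexify (E t) f) = 0"
        using complexify_T_E[OF t(1), of f] False by (simp add: A_apply)
      then show ?thesis using RA by (metis blinfun.zero_right)
    qed
    then have "complexify (E t) = 0" by (intro blinfun_eqI) simp
    then show False using nonzero[OF t(1)] complexify_eq_0D by blast
  qed
  then show "z \<in> spectrum (id_blinfun - T)" by (auto simp: spectrum_def)
qed

text \<open>Simple poles contribute winding numbers. The double pole has the primitive \<open>1 / (1 - z)\<close> along the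
  curve and contributes nothing. If \<open>0\<close> is not in \<open>F\<close>, the curve may pass through the point \<open>1\<close>, but then
  the nilpotent part is zero.\<close>
lemma contour_integral_resolvent:
  assumes \<gamma>: "valid_path \<gamma>" "pathfinish \<gamma> = pathstart \<gamma>"
    and avoid: "path_image \<gamma> \<inter> spectrum (id_blinfun - T) = {}"
  shows "((\<lambda>t. cmult (vector_derivative \<gamma> (at t within {0..1})) o\<^sub>L resolvent (id_blinfun - T) (\<gamma> t))
    has_integral (\<Sum>s\<in>F. cmult (- (2 * of_real pi * \<i> * winding_number \<gamma> (of_real (1 - s)))) o\<^sub>L complexify (E s))) {0..1}"
proof -
  let ?d = "\<lambda>t. vector_derivative \<gamma> (at t within {0..1})"
  have nin: "of_real (1 - s) \<notin> path_image \<gamma>" if "s \<in> F" for s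
    using avoid that by (auto simp: spectrum_eq)
  have res: "resolvent (id_blinfun - T) (\<gamma> t) = resolvent_formula (\<gamma> t)" if "t \<in> {0..1}" for t
    using that nin by (intro resolvent_eqI is_resolvent_formula) (metis imageI path_image_def)
  have 1: "((\<lambda>t. cmult (1 / (of_real (1 - s) - \<gamma> t) * ?d t) o\<^sub>L complexify (E s)) has_integral
      (cmult (- (2 * of_real pi * \<i> * winding_number \<gamma> (of_real (1 - s)))) o\<^sub>L complexify (E s))) {0..1}"
    if s: "s \<in> F" for s
  proof -
    have "((\<lambda>w. - (1 / (w - of_real (1 - s)))) has_contour_integral
        - (2 * pi * \<i> * winding_number \<gamma> (of_real (1 - s)))) \<gamma>"
      by (intro has_contour_integral_neg has_contour_integral_winding_number \<gamma> nin s)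
    also have "(\<lambda>w. - (1 / (w - of_real (1 - s)))) = (\<lambda>w. 1 / (complex_of_real (1 - s) - w))"
      by (metis minus_diff_eq minus_divide_right)
    finally have "((\<lambda>t. 1 / (of_real (1 - s) - \<gamma> t) * ?d t) has_integral
        - (2 * pi * \<i> * winding_number \<gamma> (of_real (1 - s)))) {0..1}"
      by (simp only: has_contour_integral_def)
    from has_integral_linear[OF this bounded_linear_cmult_compose[of "complexify (E s)"]]
    show ?thesis by (simp add: o_def)
  qed
  have 2: "((\<lambda>t. cmult (1 / (1 - \<gamma> t)\<^sup>2 * ?d t) o\<^sub>L complexify (T o\<^sub>L E 0)) has_integral 0) {0..1}"
  proof (cases "0 \<in> F")
    case False
    then have "complexify (T o\<^sub>L E 0) = 0"
      by (simp add: absent complexify_compose complexify_0)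
    then show ?thesis by simp
  next
    case True
    have "((\<lambda>z. 1 / (1 - z)) has_field_derivative 1 / (1 - z)\<^sup>2) (at z within path_image \<gamma>)"
      if "z \<in> path_image \<gamma>" for z
    proof -
      have "1 - z \<noteq> 0" using that nin[OF True] by auto
      then show ?thesis by (auto intro!: derivative_eq_intros simp: power2_eq_square)
    qed
    then have "((\<lambda>z. 1 / (1 - z)\<^sup>2) has_contour_integral 0) \<gamma>"
      using contour_integral_primitive[of "path_image \<gamma>" "\<lambda>z. 1 / (1 - z)" "\<lambda>z. 1 / (1 - z)\<^sup>2" \<gamma>] \<gamma> by simp
    then have "((\<lambda>t. 1 / (1 - \<gamma> t)\<^sup>2 * ?d t) has_integral 0) {0..1}"
      by (simp only: has_contour_integral_def)
    from has_integral_linear[OF this bounded_linear_cmult_compose[of "complexify (T o\<^sub>L E 0)"]]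
    show ?thesis by (simp add: o_def cmult_simps)
  qed
  have "((\<lambda>t. (\<Sum>s\<in>F. cmult (1 / (of_real (1 - s) - \<gamma> t) * ?d t) o\<^sub>L complexify (E s))
       + (cmult (1 / (1 - \<gamma> t)\<^sup>2 * ?d t) o\<^sub>L complexify (T o\<^sub>L E 0))) has_integral
     (\<Sum>s\<in>F. cmult (- (2 * of_real pi * \<i> * winding_number \<gamma> (of_real (1 - s)))) o\<^sub>L complexify (E s)) + 0) {0..1}"
    by (intro has_integral_add has_integral_sum finite 1 2)
  then show ?thesis
  proof (subst has_integral_cong)
    fix t :: real assume "t \<in> {0..1}"
    show "(cmult (?d t) o\<^sub>L resolvent (id_blinfun - T) (\<gamma> t)) =
      (\<Sum>s\<in>F. cmult (1 / (of_real (1 - s) - \<gamma> t) * ?d t) o\<^sub>L complexify (E s))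
       + (cmult (1 / (1 - \<gamma> t)\<^sup>2 * ?d t) o\<^sub>L complexify (T o\<^sub>L E 0))"
      unfolding res[OF \<open>t \<in> {0..1}\<close>]
      by (intro blinfun_eqI) (simp add: resolvent_formula_def blinfun.bilinear_simps blinfun.sum_left
        blinfun.sum_right cmult_cmult mult.commute)
  qed simp
qed

definition projection :: "complex set \<Rightarrow> 'x bop"
  where "projection W = (\<Sum>t\<in>{t\<in>F. of_real (1 - t) \<in> W}. E t)"

text \<open>Around any admissible curve the winding number of \<open>1 - t\<close> is \<open>1\<close> or \<open>0\<close> according to whether
  \<open>1 - t\<close> lies in \<open>W\<close>, so the contour integral does not depend on the curve; \<open>enclosing_curve\<close> provides
  one.\<close>
lemma is_spectral_projection_iff:
  "is_spectral_projection (id_blinfun - T) W Q \<longleftrightarrow> Q = complexify (projection W)"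
proof -
  let ?U = "id_blinfun - T"
  have key: "cmult (- 1 / (2 * of_real pi * \<i>)) o\<^sub>L J = complexify (projection W)"
    if \<gamma>: "valid_path \<gamma>" "pathfinish \<gamma> = pathstart \<gamma>"
      and wind: "\<forall>z\<in>inside (path_image \<gamma>). winding_number \<gamma> z = 1"
      and avoid: "path_image \<gamma> \<inter> spectrum ?U = {}"
      and ins: "inside (path_image \<gamma>) \<inter> spectrum ?U = W \<inter> spectrum ?U"
      and J: "((\<lambda>t. cmult (vector_derivative \<gamma> (at t within {0..1})) o\<^sub>L resolvent ?U (\<gamma> t)) has_integral J) {0..1}"
    for \<gamma> J
  proof -
    let ?w = "\<lambda>s. winding_number \<gamma> (of_real (1 - s))"
    have w: "?w s = (if of_real (1 - s) \<in> W then 1 else 0)" if "s \<in> F" for s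
    proof -
      have sp: "complex_of_real (1 - s) \<in> spectrum ?U" using that by (auto simp: spectrum_eq)
      then have in_iff: "of_real (1 - s) \<in> inside (path_image \<gamma>) \<longleftrightarrow> of_real (1 - s) \<in> W"
        using ins by blast
      show ?thesis
      proof (cases "complex_of_real (1 - s) \<in> W")
        case True then show ?thesis using wind in_iff by simp
      next
        case False
        then have "of_real (1 - s) \<in> outside (path_image \<gamma>)"
          using in_iff sp avoid inside_Un_outside[of "path_image \<gamma>"] by blast
        then have "?w s = 0" by (intro winding_number_zero_in_outside valid_path_imp_path \<gamma>)
        then show ?thesis using False by simp
      qed
    qed
    have J_eq: "J = (\<Sum>s\<in>F. cmult (- (2 * of_real pi * \<i> * ?w s)) o\<^sub>L complexify (E s))"
      by (rule has_integral_unique[OF J contour_integral_resolvent[OF \<gamma> avoid]])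
    have "(cmult (- 1 / (2 * of_real pi * \<i>)) o\<^sub>L J) f
       = (\<Sum>s\<in>F. if of_real (1 - s) \<in> W then complexify (E s) f else 0)" for f
      unfolding J_eq blinfun_apply_blinfun_compose blinfun.sum_left blinfun.sum_right cmult_cmult
      by (intro sum.cong refl) (simp add: w[simplified] cmult_simps cmult_cmult)
    then show ?thesis
      by (intro blinfun_eqI)
        (auto simp: projection_def complexify_sum blinfun.sum_left sum.inter_filter[OF finite]
          complexify_0 intro!: sum.cong)
  qed
  show ?thesis
  proof
    assume "is_spectral_projection ?U W Q"
    then show "Q = complexify (projection W)" unfolding is_spectral_projection_def using key by blast
  next
    assume Q: "Q = complexify (projection W)"
    let ?S = "(\<lambda>t. 1 - t) ` F" and ?G = "(\<lambda>t. 1 - t) ` {t\<in>F. complex_of_real (1 - t) \<in> W}"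
    have "?G \<subseteq> ?S" by blast
    then obtain \<gamma> where \<gamma>: "valid_path \<gamma>" "simple_path \<gamma>" "pathfinish \<gamma> = pathstart \<gamma>"
      "\<forall>z\<in>inside (path_image \<gamma>). winding_number \<gamma> z = 1"
      "path_image \<gamma> \<inter> complex_of_real ` ?S = {}"
      "inside (path_image \<gamma>) \<inter> complex_of_real ` ?S = complex_of_real ` ?G"
      using enclosing_curve[of ?S ?G] finite by blast
    have sp: "complex_of_real ` ?S = spectrum ?U" by (simp add: spectrum_eq image_image)
    have spW: "complex_of_real ` ?G = W \<inter> spectrum ?U"
      unfolding sp[symmetric] by blast
    note \<gamma>' = \<gamma>[unfolded sp spW]
    obtain J where J: "((\<lambda>t. cmult (vector_derivative \<gamma> (at t within {0..1})) o\<^sub>L resolvent ?U (\<gamma> t)) has_integral J) {0..1}"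
      using contour_integral_resolvent[OF \<gamma>'(1,3,5)] by blast
    from key[OF \<gamma>'(1,3-6) J] Q have "Q = cmult (- 1 / (2 * of_real pi * \<i>)) o\<^sub>L J" by simp
    then show "is_spectral_projection ?U W Q"
      unfolding is_spectral_projection_def using \<gamma>' J by blast
  qed
qed

lemma ex1_spectral_projection: "\<exists>!Q. is_spectral_projection (id_blinfun - T) W Q"
  by (simp add: is_spectral_projection_iff)

lemma spectral_projection_eq: "spectral_projection (id_blinfun - T) W = complexify (projection W)"
  unfolding spectral_projection_def is_spectral_projection_iff by simp

end

section \<open>Perturbation of an eigenvector under a sampled kernel\<close>

text \<open>An integral operator with symmetric bounded kernel against the empirical measure of the points
  \<open>\<xi> 1, \<dots>, \<xi> n\<close>.\<close>
locale sampled_kernel =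
  fixes T :: "('x::topological_space) bop" and h :: "'x \<Rightarrow> 'x \<Rightarrow> real" and \<xi> :: "nat \<Rightarrow> 'x"
    and n :: nat and b :: real
  assumes n: "1 \<le> n"
    and T_apply: "\<And>f x. T f x = (\<Sum>i=1..n. h x (\<xi> i) * f (\<xi> i)) / n"
    and h_sym: "\<And>x y. h x y = h y x"
    and h_bound: "\<And>x y. \<bar>h x y\<bar> \<le> b"
    and h_meas: "\<And>y. (\<lambda>x. h x y) \<in> borel_measurable borel"
begin

definition ip :: "('x, real) bmfun \<Rightarrow> ('x, real) bmfun \<Rightarrow> real"
  where "ip f g = (\<Sum>i=1..n. f (\<xi> i) * g (\<xi> i)) / n"

lemma b_nonneg: "0 \<le> b"
  using h_bound[of undefined undefined] by linarith

lemma ip_bilinear: "bilinear ip"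
  by (simp add: bilinear_def ip_def linear_iff sum_distrib_left sum.distrib algebra_simps
      add_divide_distrib flip: sum_divide_distrib)

lemma ip_le_norm: "ip f f \<le> (norm f)\<^sup>2"
proof -
  have "(\<Sum>i=1..n. f (\<xi> i) * f (\<xi> i)) \<le> (\<Sum>i=1..n. (norm f)\<^sup>2)"
  proof (rule sum_mono)
    fix i
    have "\<bar>f (\<xi> i)\<bar> ^ 2 \<le> norm f ^ 2"
      using norm_bm_apply_le[of f "\<xi> i"] by (intro power_mono) auto
    then show "f (\<xi> i) * f (\<xi> i) \<le> (norm f)\<^sup>2" by (simp add: power2_eq_square)
  qed
  then show ?thesis using n by (simp add: ip_def field_simps)
qed

text \<open>The smoothing property: the seminorm, which only sees the sample, controls the supremum norm of
  the image.\<close>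
lemma T_norm_le: "norm (T f) \<le> b * sqrt (ip f f)"
proof (rule norm_bmfun_le)
  fix x
  have "(\<Sum>i=1..n. h x (\<xi> i) * f (\<xi> i))\<^sup>2
      \<le> (\<Sum>i=1..n. (h x (\<xi> i))\<^sup>2) * (\<Sum>i=1..n. (f (\<xi> i))\<^sup>2)"
    by (rule Cauchy_Schwarz_ineq_sum)
  also have "\<dots> \<le> (\<Sum>i=1..n. b\<^sup>2) * (\<Sum>i=1..n. (f (\<xi> i))\<^sup>2)"
  proof (intro mult_right_mono sum_mono sum_nonneg)
    fix i show "(h x (\<xi> i))\<^sup>2 \<le> b\<^sup>2"
      using power_mono[OF h_bound[of x "\<xi> i"], of 2] by simp
  qed auto
  finally have "(\<Sum>i=1..n. h x (\<xi> i) * f (\<xi> i))\<^sup>2 \<le> real n * b\<^sup>2 * (\<Sum>i=1..n. (f (\<xi> i))\<^sup>2)"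
    by simp
  then have "(T f x)\<^sup>2 \<le> b\<^sup>2 * ip f f"
    using n by (simp add: T_apply ip_def power2_eq_square field_simps)
  then have "sqrt ((T f x)\<^sup>2) \<le> sqrt (b\<^sup>2 * ip f f)" by (rule real_sqrt_le_mono)
  then show "norm (T f x) \<le> b * sqrt (ip f f)"
    using b_nonneg by (simp add: real_sqrt_mult)
qed

sublocale finite_rank_symmetric T ip
proof
  show "bilinear ip" by (rule ip_bilinear)
  show "ip f g = ip g f" for f g by (simp add: ip_def mult.commute)
  show nn: "0 \<le> ip f f" for f by (simp add: ip_def sum_nonneg)
  show "ip (T f) g = ip f (T g)" for f g
  proof -
    have "(\<Sum>i=1..n. (\<Sum>j=1..n. h (\<xi> i) (\<xi> j) * f (\<xi> j)) / n * g (\<xi> i))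
        = (\<Sum>i=1..n. \<Sum>j=1..n. h (\<xi> i) (\<xi> j) * f (\<xi> j) * g (\<xi> i) / n)"
      by (simp add: sum_distrib_right sum_divide_distrib)
    also have "\<dots> = (\<Sum>j=1..n. \<Sum>i=1..n. h (\<xi> i) (\<xi> j) * f (\<xi> j) * g (\<xi> i) / n)"
      by (rule sum.swap)
    also have "\<dots> = (\<Sum>j=1..n. f (\<xi> j) * ((\<Sum>i=1..n. h (\<xi> j) (\<xi> i) * g (\<xi> i)) / n))"
      by (simp add: sum_distrib_left sum_divide_distrib h_sym mult_ac)
    finally show ?thesis by (simp add: ip_def T_apply)
  qed
  show "T f = 0" if "ip f f = 0" for f
    using T_norm_le[of f] that by simp
  define e where "e i = Bmfun (\<lambda>x. h x (\<xi> i))" for i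
  have e: "e i x = h x (\<xi> i)" for i x
    unfolding e_def using Bmfun_apply[OF h_meas, of "\<xi> i" b] h_bound by auto
  have "T f \<in> span (e ` {1..n})" for f
  proof -
    have "T f = (\<Sum>i=1..n. (f (\<xi> i) / n) *\<^sub>R e i)"
    proof (rule bm_eqI)
      fix x
      have "bm_apply (\<Sum>i\<in>A. (f (\<xi> i) / n) *\<^sub>R e i) x = (\<Sum>i\<in>A. f (\<xi> i) / n * h x (\<xi> i))" for A
        by (induction A rule: infinite_finite_induct) (auto simp: e)
      then show "T f x = bm_apply (\<Sum>i=1..n. (f (\<xi> i) / n) *\<^sub>R e i) x"
        by (simp add: T_apply sum_divide_distrib mult.commute)
    qed
    also have "\<dots> \<in> span (e ` {1..n})"
      by (intro span_sum span_scale span_base) auto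
    finally show ?thesis .
  qed
  then show "\<exists>S. finite S \<and> range (blinfun_apply T) \<subseteq> span S"
    by (intro exI[of _ "e ` {1..n}"]) auto
qed

lemma ip_sum_orthogonal:
  assumes "finite A" "\<And>s t. s \<in> A \<Longrightarrow> t \<in> A \<Longrightarrow> s \<noteq> t \<Longrightarrow> ip (f s) (f t) = 0"
  shows "ip (\<Sum>t\<in>A. f t) (\<Sum>t\<in>A. f t) = (\<Sum>t\<in>A. ip (f t) (f t))"
proof -
  have "ip (\<Sum>t\<in>A. f t) (\<Sum>t\<in>A. f t) = (\<Sum>(s, t)\<in>A \<times> A. ip (f s) (f t))"
    by (rule bilinear_sum[OF ip_bilinear])
  also have "\<dots> = (\<Sum>s\<in>A. \<Sum>t\<in>A. ip (f s) (f t))"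
    by (simp add: sum.cartesian_product)
  also have "\<dots> = (\<Sum>s\<in>A. \<Sum>t\<in>A. if t = s then ip (f s) (f s) else 0)"
    using assms(2) by (intro sum.cong) auto
  finally show ?thesis using assms(1) by simp
qed

text \<open>Let \<open>w\<close> be the part of \<open>u\<close> that the projection misses and \<open>g = T u - \<tau> u\<close>. Orthogonality of the
  eigenprojections and the gap \<open>\<bar>t - \<tau>\<bar> \<ge> r\<close> for the eigenvalues outside \<open>V\<close> bound the seminorm of \<open>w\<close>
  by \<open>\<epsilon> / r\<close>. To pass to the supremum norm there are two cases. If \<open>V\<close> contains a disc around \<open>1\<close>, then
  \<open>w\<close> involves only eigenvalues of modulus at least \<open>c\<close> and is itself in the range of \<open>T\<close>. If \<open>V\<close> avoids a
  disc around \<open>1\<close>, this holds for the projection of \<open>g\<close>, and the equation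
  \<open>\<tau> w = T w - g + Pr g\<close> bounds \<open>w\<close>.\<close>
lemma projection_error:
  fixes u :: "('x, real) bmfun" and \<tau> r c :: real and V :: "complex set"
  assumes \<tau>: "\<tau> \<noteq> 0" and r: "0 < r" "ball (of_real (1 - \<tau>)) r \<subseteq> V"
    and c: "0 < c" "ball 1 c \<subseteq> V \<or> ball 1 c \<inter> V = {}"
    and \<epsilon>: "norm (T u - \<tau> *\<^sub>R u) \<le> \<epsilon>"
  shows "\<exists>!Q. is_spectral_projection (id_blinfun - T) V Q"
    and "norm (bm_of_real u - spectral_projection (id_blinfun - T) V (bm_of_real u))
      \<le> ((b / r + 1 + b / c) / \<bar>\<tau>\<bar> + b / (r * c)) * \<epsilon>"
proof -
  obtain F E where FE:
    "finite F" "\<And>t. t \<in> F \<Longrightarrow> E t \<noteq> 0" "(\<Sum>t\<in>F. E t) = id_blinfun"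
    "\<And>s t. s \<in> F \<Longrightarrow> t \<in> F \<Longrightarrow> E s o\<^sub>L E t = (if s = t then E t else 0)"
    "\<And>t. T o\<^sub>L E t = E t o\<^sub>L T"
    "\<And>t. t \<in> F \<Longrightarrow> t \<noteq> 0 \<Longrightarrow> T o\<^sub>L E t = t *\<^sub>R E t"
    "T o\<^sub>L (T o\<^sub>L E 0) = 0" "0 \<notin> F \<Longrightarrow> E 0 = 0"
    and E_sym: "\<And>t f g. ip (E t f) g = ip f (E t g)"
    by (rule spectral_decomposition) (rule that; assumption)
  interpret nilpotent_at_0_resolution T F E
    by standard (fact FE)+
  show "\<exists>!Q. is_spectral_projection (id_blinfun - T) V Q" by (rule ex1_spectral_projection)
  define G where "G = {t\<in>F. complex_of_real (1 - t) \<in> V}"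
  define g where "g = T u - \<tau> *\<^sub>R u"
  define w where "w = (\<Sum>t\<in>F - G. E t u)"
  have GF: "G \<subseteq> F" by (auto simp: G_def)
  have sum_E: "(\<Sum>t\<in>F. E t f) = f" for f
    using arg_cong[OF sum_id, of "\<lambda>L. blinfun_apply L f"] by (simp add: blinfun.sum_left)
  have EE: "E s (E t f) = (if s = t then E t f else 0)" if "s \<in> F" "t \<in> F" for s t f
    using arg_cong[OF orth[OF that], of "\<lambda>L. blinfun_apply L f"] by (simp split: if_splits)
  have TE: "T (E t f) = E t (T f)" for t f
    using arg_cong[OF commute[of t], of "\<lambda>L. blinfun_apply L f"] by simp
  have TE_eigen: "T (E t f) = t *\<^sub>R E t f" if "t \<in> F" "t \<noteq> 0" for t f
    using arg_cong[OF eigen[OF that], of "\<lambda>L. blinfun_apply L f"] by (simp add: blinfun.scaleR_left)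
  have pyth: "ip (\<Sum>t\<in>A. E t (f t)) (\<Sum>t\<in>A. E t (f t)) = (\<Sum>t\<in>A. ip (E t (f t)) (E t (f t)))"
    if "A \<subseteq> F" for A f
  proof (rule ip_sum_orthogonal)
    show "finite A" using that FE(1) finite_subset by blast
    show "ip (E s (f s)) (E t (f t)) = 0" if "s \<in> A" "t \<in> A" "s \<noteq> t" for s t
      using that \<open>A \<subseteq> F\<close> by (subst E_sym, subst EE) (auto simp: B_simps)
  qed
  have bessel: "(\<Sum>t\<in>A. ip (E t f) (E t f)) \<le> ip f f" if "A \<subseteq> F" for A f
  proof -
    have "(\<Sum>t\<in>A. ip (E t f) (E t f)) \<le> (\<Sum>t\<in>F. ip (E t f) (E t f))"
      using that FE(1) form(3) by (intro sum_mono2) auto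
    also have "\<dots> = ip f f" using pyth[of F "\<lambda>_. f"] by (simp add: sum_E)
    finally show ?thesis .
  qed
  \<comment> \<open>A vector built from eigenvalues of modulus at least \<open>c\<close> is the image under \<open>T\<close> of a vector with
    seminorm at most \<open>1 / c\<close> times its own.\<close>
  have smooth: "norm (\<Sum>t\<in>A. E t f) \<le> b * (sqrt (\<Sum>t\<in>A. ip (E t f) (E t f)) / c)"
    if A: "A \<subseteq> F" "\<And>t. t \<in> A \<Longrightarrow> c \<le> \<bar>t\<bar>" for A f
  proof -
    let ?v = "\<Sum>t\<in>A. E t ((1 / t) *\<^sub>R f)"
    have nz: "t \<noteq> 0" if "t \<in> A" for t using A(2)[OF that] c by auto
    have "T ?v = (\<Sum>t\<in>A. E t f)"
      unfolding blinfun.sum_right using A nz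
      by (intro sum.cong refl) (auto simp: blinfun.scaleR_right TE_eigen)
    moreover have "ip ?v ?v \<le> (\<Sum>t\<in>A. ip (E t f) (E t f)) / c\<^sup>2"
      unfolding pyth[OF A(1)] sum_divide_distrib
    proof (rule sum_mono)
      fix t assume t: "t \<in> A"
      have "c\<^sup>2 \<le> t\<^sup>2" using power_mono[OF A(2)[OF t], of 2] c by simp
      then have "ip (E t f) (E t f) / t\<^sup>2 \<le> ip (E t f) (E t f) / c\<^sup>2"
        using c form(3) nz[OF t] by (intro divide_left_mono) auto
      then show "ip (E t ((1 / t) *\<^sub>R f)) (E t ((1 / t) *\<^sub>R f)) \<le> ip (E t f) (E t f) / c\<^sup>2"
        by (simp add: blinfun.scaleR_right B_simps power2_eq_square)
    qed
    then have "sqrt (ip ?v ?v) \<le> sqrt ((\<Sum>t\<in>A. ip (E t f) (E t f)) / c\<^sup>2)"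
      by (rule real_sqrt_le_mono)
    then have "sqrt (ip ?v ?v) \<le> sqrt (\<Sum>t\<in>A. ip (E t f) (E t f)) / c"
      using c by (simp add: real_sqrt_divide)
    then have "b * sqrt (ip ?v ?v) \<le> b * (sqrt (\<Sum>t\<in>A. ip (E t f) (E t f)) / c)"
      by (rule mult_left_mono) (rule b_nonneg)
    ultimately show ?thesis
      using T_norm_le[of ?v] by simp
  qed
  have \<epsilon>0: "0 \<le> \<epsilon>" using \<epsilon> norm_ge_zero order_trans by blast
  have ip_g: "ip g g \<le> \<epsilon>\<^sup>2"
    using ip_le_norm[of g] power_mono[OF \<epsilon>[folded g_def], of 2] by simp
  \<comment> \<open>The gap, eigenvalue by eigenvalue. At \<open>t = 0\<close> the nilpotent part \<open>T (E 0 u)\<close> is a null vector of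
    the form, so it does not disturb the comparison.\<close>
  have low: "r\<^sup>2 * ip (E t u) (E t u) \<le> ip (E t g) (E t g)" if t: "t \<in> F - G" for t
  proof -
    have "complex_of_real (1 - t) \<notin> V" using t by (simp add: G_def)
    then have "of_real (1 - t) \<notin> ball (complex_of_real (1 - \<tau>)) r" using r(2) by blast
    then have "r \<le> norm (complex_of_real ((1 - \<tau>) - (1 - t)))"
      by (simp only: mem_ball dist_norm of_real_diff not_less)
    then have "r \<le> \<bar>t - \<tau>\<bar>" unfolding norm_of_real by simp
    then have rt: "r\<^sup>2 \<le> (t - \<tau>)\<^sup>2" using power_mono[of r "\<bar>t - \<tau>\<bar>" 2] r by simp
    have "ip (E t g) (E t g) = (t - \<tau>)\<^sup>2 * ip (E t u) (E t u)"
    proof (cases "t = 0")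
      case False
      have "E t g = (t - \<tau>) *\<^sub>R E t u"
        using TE_eigen[of t u] t False by (simp add: g_def blinfun.bilinear_simps TE[symmetric] algebra_simps)
      then show ?thesis by (simp add: B_simps power2_eq_square)
    next
      case True
      define y where "y = T (E 0 u)"
      have "T y = 0" using arg_cong[OF nil, of "\<lambda>L. blinfun_apply L u"] by (simp add: y_def)
      then have "ip y y = 0" using symmetric[of "E 0 u" y] by (simp add: y_def B_simps)
      then have y0: "ip z y = 0" "ip y z = 0" for z using form_null_orthogonal form(2) by metis+
      have "E t g = y - \<tau> *\<^sub>R E 0 u"
        by (simp add: g_def True blinfun.bilinear_simps TE[symmetric] y_def)
      then show ?thesis using True by (simp add: B_simps y0 power2_eq_square)
    qed
    then show ?thesis using rt form(3)[of "E t u"] by (simp add: mult_right_mono)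
  qed
  have sum_w: "(\<Sum>t\<in>F - G. ip (E t u) (E t u)) \<le> (\<epsilon> / r)\<^sup>2"
  proof -
    have "r\<^sup>2 * (\<Sum>t\<in>F - G. ip (E t u) (E t u)) \<le> (\<Sum>t\<in>F - G. ip (E t g) (E t g))"
      unfolding sum_distrib_left by (intro sum_mono low)
    also have "\<dots> \<le> \<epsilon>\<^sup>2" using bessel[of "F - G" g] ip_g by simp
    finally show ?thesis using r by (simp add: field_simps)
  qed
  then have sqrt_w: "sqrt (\<Sum>t\<in>F - G. ip (E t u) (E t u)) \<le> \<epsilon> / r"
    using \<epsilon>0 r by (intro real_le_lsqrt) (auto intro: sum_nonneg form(3))
  have w_eq: "w = u - (\<Sum>t\<in>G. E t u)"
    unfolding w_def using sum_E[of u] GF FE(1) by (simp add: sum_diff)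
  have "norm w \<le> ((b / r + 1 + b / c) / \<bar>\<tau>\<bar> + b / (r * c)) * \<epsilon>"
    using c(2)
  proof
    assume cV: "ball 1 c \<subseteq> V"
    have "c \<le> \<bar>t\<bar>" if "t \<in> F - G" for t
    proof -
      have "complex_of_real (1 - t) \<notin> V" using that by (simp add: G_def)
      then have "of_real (1 - t) \<notin> ball (1::complex) c" using cV by blast
      then have "c \<le> norm (complex_of_real (1 - (1 - t)))"
        by (simp only: mem_ball dist_norm of_real_diff not_less of_real_1)
      then show ?thesis unfolding norm_of_real by simp
    qed
    then have "norm w \<le> b * (sqrt (\<Sum>t\<in>F - G. ip (E t u) (E t u)) / c)"
      unfolding w_def by (intro smooth) auto
    also have "\<dots> \<le> b * (\<epsilon> / r / c)"
      using sqrt_w b_nonneg c by (intro mult_left_mono divide_right_mono) auto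
    also have "\<dots> \<le> (b / r + 1 + b / c) / \<bar>\<tau>\<bar> * \<epsilon> + b / (r * c) * \<epsilon>"
      using b_nonneg r c \<epsilon>0 by simp
    finally show ?thesis by (simp add: algebra_simps)
  next
    assume cV: "ball 1 c \<inter> V = {}"
    have cG: "c \<le> \<bar>t\<bar>" if "t \<in> G" for t
    proof -
      have "complex_of_real (1 - t) \<in> V" using that by (simp add: G_def)
      then have "of_real (1 - t) \<notin> ball (1::complex) c" using cV by blast
      then have "c \<le> norm (complex_of_real (1 - (1 - t)))"
        by (simp only: mem_ball dist_norm of_real_diff not_less of_real_1)
      then show ?thesis unfolding norm_of_real by simp
    qed
    let ?Pg = "\<Sum>t\<in>G. E t g"
    have "norm ?Pg \<le> b * (sqrt (\<Sum>t\<in>G. ip (E t g) (E t g)) / c)"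
      by (intro smooth GF cG)
    also have "sqrt (\<Sum>t\<in>G. ip (E t g) (E t g)) \<le> \<epsilon>"
      using bessel[OF GF, of g] ip_g \<epsilon>0 by (intro real_le_lsqrt) (auto intro: sum_nonneg form(3))
    finally have Pg: "norm ?Pg \<le> b * (\<epsilon> / c)"
      using b_nonneg c by (auto simp: divide_right_mono mult_left_mono)
    have "sqrt (ip w w) \<le> \<epsilon> / r"
      using sqrt_w pyth[of "F - G" "\<lambda>_. u"] by (simp add: w_def)
    then have Tw: "norm (T w) \<le> b * (\<epsilon> / r)"
      using T_norm_le[of w] b_nonneg by (meson mult_left_mono order_trans)
    have "T w - \<tau> *\<^sub>R w = g - ?Pg"
    proof -
      have "T w - \<tau> *\<^sub>R w = g - ((\<Sum>t\<in>G. E t (T u)) - \<tau> *\<^sub>R (\<Sum>t\<in>G. E t u))"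
        unfolding w_eq by (simp add: g_def blinfun.bilinear_simps blinfun.sum_right TE algebra_simps)
      also have "(\<Sum>t\<in>G. E t (T u)) - \<tau> *\<^sub>R (\<Sum>t\<in>G. E t u) = ?Pg"
        by (simp add: g_def blinfun.bilinear_simps scaleR_sum_right sum_subtractf)
      finally show ?thesis .
    qed
    then have "\<tau> *\<^sub>R w = T w - g + ?Pg" by (simp add: algebra_simps)
    then have "norm (\<tau> *\<^sub>R w) \<le> norm (T w) + norm g + norm ?Pg"
      using norm_triangle_ineq[of "T w - g" ?Pg] norm_triangle_ineq4[of "T w" g] by simp
    then have "\<bar>\<tau>\<bar> * norm w \<le> b * (\<epsilon> / r) + \<epsilon> + b * (\<epsilon> / c)"
      using Tw Pg \<epsilon> by (simp add: g_def)
    then have "norm w \<le> (b * (\<epsilon> / r) + \<epsilon> + b * (\<epsilon> / c)) / \<bar>\<tau>\<bar>"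
      using \<tau> by (simp add: field_simps)
    also have "\<dots> = (b / r + 1 + b / c) / \<bar>\<tau>\<bar> * \<epsilon>" by (simp add: algebra_simps add_divide_distrib)
    also have "\<dots> \<le> (b / r + 1 + b / c) / \<bar>\<tau>\<bar> * \<epsilon> + b / (r * c) * \<epsilon>"
      using b_nonneg r c \<epsilon>0 by simp
    finally show ?thesis by (simp add: algebra_simps)
  qed
  moreover have "bm_of_real u - spectral_projection (id_blinfun - T) V (bm_of_real u) = bm_of_real w"
    by (simp add: spectral_projection_eq complexify_of_real projection_def w_eq G_def
        blinfun.diff_right blinfun.sum_left)
  ultimately show "norm (bm_of_real u - spectral_projection (id_blinfun - T) V (bm_of_real u))
      \<le> ((b / r + 1 + b / c) / \<bar>\<tau>\<bar> + b / (r * c)) * \<epsilon>"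
    using norm_bm_of_real_le[of w] by simp
qed

end

section \<open>Concentration of sample means, uniformly over a compact space\<close>

text \<open>The modulus of a kernel is a supremum over uncountably many points and need not be Borel
  measurable. A Borel majorant with the same integral and the same upper bound can be sampled in its
  place. It has to dominate everywhere, since the sample points may hit an exceptional null set; there
  it takes the value \<open>c\<close>.\<close>
lemma borel_majorant_of_completion_integrable:
  fixes f :: "'a \<Rightarrow> real"
  assumes f: "integrable (completion \<mu>) f" "\<And>z. f z \<le> c"
  obtains g where "g \<in> borel_measurable \<mu>" "\<And>z. f z \<le> g z" "\<And>z. g z \<le> c"
    "(\<integral>z. g z \<partial>\<mu>) = (\<integral>z. f z \<partial>completion \<mu>)"
proof -
  obtain g0 where g0: "g0 \<in> borel_measurable \<mu>" "AE z in \<mu>. f z = g0 z"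
    using completion_ex_borel_measurable_real[OF borel_measurable_integrable[OF f(1)]] by blast
  obtain N where N: "{z\<in>space \<mu>. f z \<noteq> g0 z} \<subseteq> N" "N \<in> null_sets \<mu>"
    by (rule AE_E[OF g0(2)]) (rule that, simp_all add: null_sets_def)
  define g where "g z = (if z \<in> N \<or> z \<notin> space \<mu> then c else min (g0 z) c)" for z
  have fg: "f z = min (g0 z) c" if "z \<in> space \<mu>" "z \<notin> N" for z
    using N(1) that f(2)[of z] by (auto simp: min_def)
  have [measurable]: "N \<in> sets \<mu>" using N(2) by auto
  note g0(1)[measurable]
  have "g \<in> borel_measurable \<mu> \<longleftrightarrow> (\<lambda>z. if z \<in> N then c else min (g0 z) c) \<in> borel_measurable \<mu>"
    by (rule measurable_cong) (simp add: g_def)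
  then have g_meas: "g \<in> borel_measurable \<mu>" by simp
  show ?thesis
  proof (rule that[OF g_meas])
    show "f z \<le> g z" for z using fg[of z] f(2)[of z] by (auto simp: g_def)
    show "g z \<le> c" for z by (simp add: g_def)
    have "AE z in completion \<mu>. z \<notin> N"
      using N(2) by (intro AE_not_in) (simp add: null_sets_completionI)
    then have "(\<integral>z. f z \<partial>completion \<mu>) = (\<integral>z. g z \<partial>completion \<mu>)"
      using f(1) g_meas
      by (intro integral_cong_AE) (auto simp: g_def fg measurable_completion elim!: AE_mp)
    also have "\<dots> = (\<integral>z. g z \<partial>\<mu>)" by (rule integral_completion[OF g_meas])
    finally show "(\<integral>z. g z \<partial>\<mu>) = (\<integral>z. f z \<partial>completion \<mu>)" by simp
  qed
qed

lemma covering_number_witness: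
  assumes "compact (UNIV :: 'x::metric_space set)" "0 < \<delta>"
  obtains A :: "'x::metric_space set"
  where "finite A" "card A = covering_number TYPE('x::metric_space) \<delta>" "(\<Union>x\<in>A. ball x \<delta>) = UNIV"
proof -
  have "\<forall>B\<in>range (\<lambda>x::'x. ball x \<delta>). open B" by auto
  moreover have "UNIV \<subseteq> (\<Union>x::'x. ball x \<delta>)" using assms(2) centre_in_ball by blast
  ultimately obtain A :: "'x set" where "finite A" "UNIV \<subseteq> (\<Union>x\<in>A. ball x \<delta>)"
    using compactE_image[OF assms(1), of UNIV "\<lambda>x. ball x \<delta>"] by auto
  then have "\<exists>n. \<exists>A::'x set. finite A \<and> card A = n \<and> (\<Union>x\<in>A. ball x \<delta>) = UNIV" by blast
  then have "\<exists>A::'x set. finite A \<and> card A = covering_number TYPE('x) \<delta> \<and> (\<Union>x\<in>A. ball x \<delta>) = UNIV"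
    unfolding covering_number_def by (rule LeastI_ex)
  then show ?thesis using that by blast
qed

definition sample_mean :: "(nat \<Rightarrow> 'w \<Rightarrow> 'x) \<Rightarrow> nat \<Rightarrow> 'w \<Rightarrow> ('x \<Rightarrow> real) \<Rightarrow> real"
  where "sample_mean X n w f = (\<Sum>i=1..n. f (X i w)) / n"

lemma sample_mean_mono:
  assumes "\<And>z. f z \<le> g z"
  shows "sample_mean X n w f \<le> sample_mean X n w g"
  unfolding sample_mean_def using assms by (intro divide_right_mono sum_mono) auto

lemma sample_mean_diff: "sample_mean X n w (\<lambda>z. f z - g z) = sample_mean X n w f - sample_mean X n w g"
  by (simp add: sample_mean_def sum_subtractf diff_divide_distrib)

lemma sample_mean_add: "sample_mean X n w (\<lambda>z. f z + g z) = sample_mean X n w f + sample_mean X n w g"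
  by (simp add: sample_mean_def sum.distrib add_divide_distrib)

lemma sample_mean_cmult: "sample_mean X n w (\<lambda>z. c * f z) = c * sample_mean X n w f"
  by (simp add: sample_mean_def sum_distrib_left)

lemma sample_mean_const: "1 \<le> n \<Longrightarrow> sample_mean X n w (\<lambda>z. c) = c"
  by (simp add: sample_mean_def)

lemma sample_mean_abs_le:
  assumes "\<And>z. \<bar>f z\<bar> \<le> g z"
  shows "\<bar>sample_mean X n w f\<bar> \<le> sample_mean X n w g"
proof -
  have "f z \<le> g z" "- 1 * f z \<le> g z" for z using assms[of z] by auto
  from sample_mean_mono[of f g X n w, OF this(1)] sample_mean_mono[of "\<lambda>z. - 1 * f z" g X n w, OF this(2)]
  show ?thesis unfolding sample_mean_cmult by linarith
qed

locale iid_sample = prob_space P for P :: "'w measure" +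
  fixes \<mu> :: "'x::metric_space measure" and X :: "nat \<Rightarrow> 'w \<Rightarrow> 'x"
  assumes \<mu>: "prob_space \<mu>" "sets \<mu> = sets borel"
    and X_indep: "indep_vars (\<lambda>_. borel) X {1..}"
    and X_law: "\<And>i. 1 \<le> i \<Longrightarrow> distr P borel (X i) = \<mu>"
begin

lemma X_measurable: "1 \<le> i \<Longrightarrow> X i \<in> borel_measurable P"
  using X_indep by (auto simp: indep_vars_def)

lemma deviation_event_measurable:
  assumes [measurable]: "f \<in> borel_measurable borel"
  shows "{w\<in>space P. \<epsilon> \<le> \<bar>sample_mean X n w f - c\<bar>} \<in> sets P"
proof -
  have "(\<lambda>w. \<Sum>i=1..n. f (X i w)) \<in> borel_measurable P"
    by (intro borel_measurable_sum measurable_compose[OF X_measurable assms]) auto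
  then have [measurable]: "(\<lambda>w. sample_mean X n w f) \<in> borel_measurable P"
    unfolding sample_mean_def by simp
  show ?thesis by measurable
qed

lemma hoeffding_sample_mean:
  assumes f[measurable]: "f \<in> borel_measurable borel" and R: "\<And>z. \<bar>f z\<bar> \<le> R" "0 < R"
    and "0 \<le> \<epsilon>" "1 \<le> n"
  shows "prob {w\<in>space P. \<epsilon> \<le> \<bar>sample_mean X n w f - (\<integral>z. f z \<partial>\<mu>)\<bar>} \<le> 2 * exp (- (n * \<epsilon>\<^sup>2 / (2 * R\<^sup>2)))"
proof -
  have fX: "distr P borel (\<lambda>w. f (X i w)) = distr \<mu> borel f" if "1 \<le> i" for i
    using distr_distr[OF f X_measurable[OF that]] X_law[OF that] by (simp add: o_def)
  interpret H: Hoeffding_ineq_iid P "{1..n}" "\<lambda>i w. f (X i w)" "\<lambda>w. f (X 1 w)" "- R" R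
      "expectation (\<lambda>w. f (X 1 w))"
  proof unfold_locales
    show "indep_vars (\<lambda>_. borel) (\<lambda>i w. f (X i w)) {1..n}"
      using indep_vars_subset[OF X_indep, of "{1..n}"] by (intro indep_vars_compose2[where Y = "\<lambda>_. f"]) auto
    show "distr P borel (\<lambda>w. f (X i w)) = distr P borel (\<lambda>w. f (X 1 w))" if "i \<in> {1..n}" for i
      using that fX by simp
    show "random_variable borel (\<lambda>w. f (X 1 w))"
      using measurable_compose[OF X_measurable f] by simp
    show "AE w in P. f (X 1 w) \<in> {- R..R}" using R(1) by (auto simp: abs_le_iff minus_le_iff)
  qed auto
  have E: "expectation (\<lambda>w. f (X 1 w)) = (\<integral>z. f z \<partial>\<mu>)"
    using integral_distr[OF X_measurable[of 1] f] X_law[of 1] by simp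
  have lt: "- R < R" and ne: "{1..n} \<noteq> {}" using R(2) \<open>1 \<le> n\<close> by auto
  have card: "real (card {1..n}) = real n" by simp
  have "prob {w\<in>space P. \<epsilon> \<le> \<bar>sample_mean X n w f - (\<integral>z. f z \<partial>\<mu>)\<bar>}
      \<le> 2 * exp (- 2 * real n * \<epsilon>\<^sup>2 / (R - - R)\<^sup>2)"
    using H.Hoeffding_ineq_abs_ge'[OF \<open>0 \<le> \<epsilon>\<close> lt ne] unfolding card E sample_mean_def .
  also have "- 2 * real n * \<epsilon>\<^sup>2 / (R - - R)\<^sup>2 = - (n * \<epsilon>\<^sup>2 / (2 * R\<^sup>2))"
    using R(2) by (simp add: power2_eq_square field_simps)
  finally show ?thesis .
qed

end

locale kernel_sample = iid_sample P \<mu> X for P :: "'w measure" and \<mu> :: "'x::metric_space measure"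
    and X :: "nat \<Rightarrow> 'w \<Rightarrow> 'x" +
  fixes k :: "'x \<Rightarrow> 'x \<Rightarrow> real" and a M :: real
  assumes compact: "compact (UNIV :: 'x set)"
    and k_nonneg: "\<And>x y. 0 \<le> k x y"
    and k_le: "\<And>x y. k x y \<le> M"
    and k_sym: "\<And>x y. k x y = k y x"
    and k_meas: "(\<lambda>(x, y). k x y) \<in> borel_measurable (borel \<Otimes>\<^sub>M borel)"
    and a: "0 < a" "\<And>x. a \<le> degree_fun k \<mu> x"
    and M: "1 \<le> M"
begin

sublocale \<mu>: prob_space \<mu> by (rule \<mu>)

lemma k_meas2 [measurable]: "k x \<in> borel_measurable borel"
  using measurable_compose[OF measurable_Pair1'[of x borel borel] k_meas] by simp

lemma meas_\<mu>: "f \<in> borel_measurable borel \<Longrightarrow> f \<in> borel_measurable \<mu>"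
  using \<mu>(2) measurable_cong_sets by blast

lemma integrable_bounded:
  fixes f :: "'x \<Rightarrow> real"
  assumes "f \<in> borel_measurable borel" "\<And>z. \<bar>f z\<bar> \<le> c"
  shows "integrable \<mu> f"
  using assms by (intro \<mu>.integrable_const_bound[of _ c] meas_\<mu>) auto

lemma modulus_bound:
  assumes "0 < \<delta>"
  shows "modulus k \<delta> x z \<le> M" and "y \<in> ball x \<delta> \<Longrightarrow> \<bar>k x z - k y z\<bar> \<le> modulus k \<delta> x z"
proof -
  have b: "\<bar>k x z - k y z\<bar> \<le> M" for y
    using k_nonneg[of x z] k_nonneg[of y z] k_le[of x z] k_le[of y z] by linarith
  show "modulus k \<delta> x z \<le> M"
    unfolding modulus_def using assms b by (intro cSUP_least) auto
  show "\<bar>k x z - k y z\<bar> \<le> modulus k \<delta> x z" if "y \<in> ball x \<delta>"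
    unfolding modulus_def using that b by (intro cSUP_upper) (auto intro!: bdd_aboveI[of _ M])
qed

text \<open>The deviation is tested at the centres \<open>x\<close> of a covering by balls of radius \<open>\<delta>\<close>, both for \<open>k x \<cdot> v\<close>
  and for a Borel majorant \<open>g x\<close> of the modulus at \<open>x\<close>. Moving from a centre to a point \<open>y\<close> of its ball
  changes the integral by at most \<open>b \<eta>\<close>. It changes the sample mean by at most \<open>b\<close> times that of \<open>g x\<close>,
  hence by at most \<open>b (\<eta> + \<epsilon>)\<close>. Each centre needs \<open>card Vs + 1\<close> two-sided tests.\<close>
lemma uniform_deviation:
  assumes n: "1 \<le> n" and \<delta>: "0 < \<delta>"
    and \<eta>: "\<And>x. integrable (completion \<mu>) (modulus k \<delta> x)" "\<And>x. (\<integral>z. modulus k \<delta> x z \<partial>completion \<mu>) \<le> \<eta>"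
    and Vs: "finite Vs" "\<And>v. v \<in> Vs \<Longrightarrow> v \<in> borel_measurable borel" "\<And>v z. v \<in> Vs \<Longrightarrow> \<bar>v z\<bar> \<le> b"
    and b: "1 \<le> b" and \<epsilon>: "0 \<le> \<epsilon>"
  obtains S where "S \<in> sets P"
    "prob S \<le> 2 * (real (card Vs) + 1) * covering_number TYPE('x) \<delta> * exp (- (n * \<epsilon>\<^sup>2 / (2 * (M * b)\<^sup>2)))"
    "\<And>w v y. w \<in> space P - S \<Longrightarrow> v \<in> Vs \<Longrightarrow>
       \<bar>sample_mean X n w (\<lambda>z. k y z * v z) - (\<integral>z. k y z * v z \<partial>\<mu>)\<bar> \<le> \<epsilon> + b * (2 * \<eta> + \<epsilon>)"
proof -
  obtain A :: "'x set" where A: "finite A" "card A = covering_number TYPE('x) \<delta>" "(\<Union>x\<in>A. ball x \<delta>) = UNIV"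
    by (rule covering_number_witness[OF compact \<delta>])
  have "\<exists>g. g \<in> borel_measurable \<mu> \<and> (\<forall>z. modulus k \<delta> x z \<le> g z) \<and> (\<forall>z. g z \<le> M)
      \<and> (\<integral>z. g z \<partial>\<mu>) = (\<integral>z. modulus k \<delta> x z \<partial>completion \<mu>)" for x
    using borel_majorant_of_completion_integrable[OF \<eta>(1) modulus_bound(1)[OF \<delta>], of x] by metis
  then obtain g where g: "\<And>x. g x \<in> borel_measurable \<mu>" "\<And>x z. modulus k \<delta> x z \<le> g x z" "\<And>x z. g x z \<le> M"
      "\<And>x. (\<integral>z. g x z \<partial>\<mu>) = (\<integral>z. modulus k \<delta> x z \<partial>completion \<mu>)"
    by metis
  have g_meas[measurable]: "g x \<in> borel_measurable borel" for x
    using g(1) \<mu>(2) measurable_cong_sets by blast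
  have g_int: "(\<integral>z. g x z \<partial>\<mu>) \<le> \<eta>" for x using g(4) \<eta>(2) by simp
  have g_diff: "\<bar>k x z - k y z\<bar> \<le> g x z" if "y \<in> ball x \<delta>" for x y z
    using modulus_bound(2)[OF \<delta> that, of z] g(2)[of x z] by simp
  have g_nn: "0 \<le> g x z" for x z using g_diff[of x x z] \<delta> by simp
  define tests where "tests = (\<lambda>(x, v) z. k x z * v z) ` (A \<times> Vs) \<union> g ` A"
  define dev where "dev f = {w\<in>space P. \<epsilon> \<le> \<bar>sample_mean X n w f - (\<integral>z. f z \<partial>\<mu>)\<bar>}" for f
  define S where "S = (\<Union>f\<in>tests. dev f)"
  have Mb: "M \<le> M * b" using M b by simp
  have kv: "\<bar>k x z * v z\<bar> \<le> M * b" if "v \<in> Vs" for x z v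
    unfolding abs_mult using k_nonneg[of x z] k_le[of x z] Vs(3)[OF that, of z] M
    by (intro mult_mono) auto
  have tests: "f \<in> borel_measurable borel" "\<bar>f z\<bar> \<le> M * b" if "f \<in> tests" for f z
    using that Vs(2) kv g_nn[of _ z] order_trans[OF g(3)[of _ z] Mb] by (auto simp: tests_def)
  have fin: "finite tests" using A Vs by (simp add: tests_def)
  have dev_meas: "dev f \<in> sets P" if "f \<in> tests" for f
    unfolding dev_def by (rule deviation_event_measurable) (rule tests(1)[OF that])
  have S: "S \<in> sets P" unfolding S_def using fin dev_meas by blast
  let ?e = "exp (- (n * \<epsilon>\<^sup>2 / (2 * (M * b)\<^sup>2)))"
  have "prob S \<le> (\<Sum>f\<in>tests. prob (dev f))"
    unfolding S_def by (rule measure_UNION_le[OF fin dev_meas])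
  also have "\<dots> \<le> (\<Sum>f\<in>tests. 2 * ?e)"
    unfolding dev_def using M b n \<epsilon> tests by (intro sum_mono hoeffding_sample_mean) auto
  also have "\<dots> = card tests * (2 * ?e)" by simp
  also have "\<dots> \<le> real (card A * card Vs + card A) * (2 * ?e)"
  proof (intro mult_right_mono)
    have "card tests \<le> card (A \<times> Vs) + card A"
      unfolding tests_def using A(1) Vs(1)
      by (intro order_trans[OF card_Un_le] add_mono card_image_le finite_cartesian_product)
    then show "real (card tests) \<le> real (card A * card Vs + card A)"
      by (simp only: card_cartesian_product of_nat_le_iff)
  qed auto
  finally have prob: "prob S \<le> 2 * (real (card Vs) + 1) * covering_number TYPE('x) \<delta> * ?e"
    by (simp add: A(2) algebra_simps)
  show ?thesis
  proof (rule that[OF S prob])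
    fix w v y assume w: "w \<in> space P - S" and v: "v \<in> Vs"
    obtain x where x: "x \<in> A" "y \<in> ball x \<delta>" using A(3) by blast
    have ndev: "\<bar>sample_mean X n w f - (\<integral>z. f z \<partial>\<mu>)\<bar> \<le> \<epsilon>" if "f \<in> tests" for f
      using w that by (auto simp: S_def dev_def)
    have diff: "\<bar>k x z * v z - k y z * v z\<bar> \<le> b * g x z" for z
    proof -
      have "\<bar>k x z * v z - k y z * v z\<bar> = \<bar>v z\<bar> * \<bar>k x z - k y z\<bar>"
        by (simp flip: abs_mult add: algebra_simps)
      also have "\<dots> \<le> b * g x z"
        using Vs(3)[OF v] g_diff[OF x(2)] b by (intro mult_mono) auto
      finally show ?thesis .
    qed
    have int_kv: "integrable \<mu> (\<lambda>z. k x z * v z)" for x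
      using Vs(2)[OF v] kv[OF v] by (intro integrable_bounded[of _ "M * b"]) auto
    have int_g: "integrable \<mu> (g x)"
      using g_nn g(3) by (intro integrable_bounded[of _ M]) auto
    have 1: "\<bar>sample_mean X n w (\<lambda>z. k x z * v z) - (\<integral>z. k x z * v z \<partial>\<mu>)\<bar> \<le> \<epsilon>"
      using x v by (intro ndev) (auto simp: tests_def)
    have "sample_mean X n w (g x) \<le> \<eta> + \<epsilon>"
      using ndev[of "g x"] x g_int[of x] by (auto simp: tests_def)
    then have "b * sample_mean X n w (g x) \<le> b * (\<eta> + \<epsilon>)" using b by simp
    then have 2: "\<bar>sample_mean X n w (\<lambda>z. k x z * v z) - sample_mean X n w (\<lambda>z. k y z * v z)\<bar> \<le> b * (\<eta> + \<epsilon>)"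
      using sample_mean_abs_le[of "\<lambda>z. k x z * v z - k y z * v z" "\<lambda>z. b * g x z" X n w, OF diff]
      unfolding sample_mean_diff sample_mean_cmult by linarith
    have "\<bar>\<integral>z. k x z * v z - k y z * v z \<partial>\<mu>\<bar> \<le> (\<integral>z. b * g x z \<partial>\<mu>)"
      using diff int_kv int_g
      by (intro order_trans[OF integral_abs_bound] integral_mono) auto
    also have "\<dots> \<le> b * \<eta>" using g_int[of x] b by simp
    finally have 3: "\<bar>(\<integral>z. k x z * v z \<partial>\<mu>) - (\<integral>z. k y z * v z \<partial>\<mu>)\<bar> \<le> b * \<eta>"
      using int_kv by simp
    have "b * (2 * \<eta> + \<epsilon>) = b * (\<eta> + \<epsilon>) + b * \<eta>" by (simp add: algebra_simps)
    then show "\<bar>sample_mean X n w (\<lambda>z. k y z * v z) - (\<integral>z. k y z * v z \<partial>\<mu>)\<bar> \<le> \<epsilon> + b * (2 * \<eta> + \<epsilon>)"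
      using 1 2 3 by linarith
  qed
qed

end

section \<open>The empirical operator\<close>

lemma sample_mean_integral_empirical:
  fixes X :: "nat \<Rightarrow> 'w \<Rightarrow> 'x::topological_space"
  assumes "f \<in> borel_measurable borel"
  shows "(\<integral>y. f y \<partial>empirical X w n) = sample_mean X n w f"
  using integral_empirical[OF assms] by (simp add: sample_mean_def)

lemma prob_space_empirical:
  assumes "1 \<le> n"
  shows "prob_space (empirical X w n)"
  unfolding empirical_def using assms
  by (intro prob_space.prob_space_distr prob_space_uniform_count_measure)
    (auto simp: measurable_def space_uniform_count_measure sets_uniform_count_measure)

context kernel_sample
begin

lemma degree_empirical: "degree_fun k (empirical X w n) x = sample_mean X n w (k x)"
  unfolding degree_fun_def by (rule sample_mean_integral_empirical) simp

lemma degree_measurable: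
  assumes "prob_space \<nu>" "sets \<nu> = sets borel"
  shows "degree_fun k \<nu> \<in> borel_measurable borel"
proof -
  interpret \<nu>: prob_space \<nu> by fact
  note assms(2)[measurable_cong] k_meas[measurable]
  show ?thesis unfolding degree_fun_def[abs_def] by measurable
qed

lemma normalized_kernel_measurable:
  assumes "prob_space \<nu>" "sets \<nu> = sets borel"
  shows "(\<lambda>x. normalized_kernel k \<nu> x y) \<in> borel_measurable borel"
    and "normalized_kernel k \<nu> x \<in> borel_measurable borel"
proof -
  note degree_measurable[OF assms, measurable]
  have "(\<lambda>y. normalized_kernel k \<nu> x y) \<in> borel_measurable borel" for x
    unfolding normalized_kernel_def by measurable
  then show m: "normalized_kernel k \<nu> x \<in> borel_measurable borel" for x by simp
  have "normalized_kernel k \<nu> x y = normalized_kernel k \<nu> y x" for x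
    by (simp add: normalized_kernel_def k_sym[of x y] add.commute)
  then have "(\<lambda>x. normalized_kernel k \<nu> x y) = normalized_kernel k \<nu> y" by (rule ext)
  then show "(\<lambda>x. normalized_kernel k \<nu> x y) \<in> borel_measurable borel" using m by simp
qed

lemma normalized_kernel_bound:
  assumes "0 < c" "\<And>x. c \<le> degree_fun k \<nu> x"
  shows "\<bar>normalized_kernel k \<nu> x y\<bar> \<le> M / c"
proof -
  have pos: "0 < degree_fun k \<nu> x" for x using assms less_le_trans by blast
  have inv: "1 / degree_fun k \<nu> x \<le> 1 / c" for x using assms pos by (intro divide_left_mono) auto
  have "\<bar>normalized_kernel k \<nu> x y\<bar> = 1 / 2 * k x y * (1 / degree_fun k \<nu> x + 1 / degree_fun k \<nu> y)"
    unfolding normalized_kernel_def abs_mult using pos[of x] pos[of y] k_nonneg[of x y]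
    by (simp add: less_imp_le)
  also have "\<dots> \<le> 1 / 2 * M * (1 / c + 1 / c)"
    using k_nonneg[of x y] k_le[of x y] inv[of x] inv[of y] pos[of x] pos[of y] M
    by (intro mult_mono add_mono) (auto simp: less_imp_le)
  finally show ?thesis by simp
qed

lemma T_op_apply':
  assumes "prob_space \<nu>" "sets \<nu> = sets borel" "0 < c" "\<And>x. c \<le> degree_fun k \<nu> x"
  shows "T_op k \<nu> f x = (\<integral>y. normalized_kernel k \<nu> x y * f y \<partial>\<nu>)"
proof (rule T_op_apply[OF assms(1,2) k_meas _ assms(3,4)])
  show "\<bar>k x y\<bar> \<le> M" for x y using k_nonneg k_le by simp
qed

lemma T_op_empirical:
  assumes "1 \<le> n" "0 < c" "\<And>x. c \<le> degree_fun k (empirical X w n) x"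
  shows "T_op k (empirical X w n) f x =
    sample_mean X n w (\<lambda>y. normalized_kernel k (empirical X w n) x y * f y)"
proof -
  have s: "sets (empirical X w n) = sets borel" by (simp add: empirical_def)
  note p = prob_space_empirical[OF assms(1)]
  show ?thesis
    unfolding T_op_apply'[OF p s assms(2,3)]
    by (intro sample_mean_integral_empirical borel_measurable_times normalized_kernel_measurable p s) simp
qed

lemma empirical_sampled_kernel:
  assumes "1 \<le> n" "\<And>x. a / 2 \<le> degree_fun k (empirical X w n) x"
  shows "sampled_kernel (T_op k (empirical X w n)) (normalized_kernel k (empirical X w n))
    (\<lambda>i. X i w) n (2 * M / a)"
proof
  have a2: "0 < a / 2" using a by simp
  show "1 \<le> n" by fact
  show "T_op k (empirical X w n) f x =
      (\<Sum>i=1..n. normalized_kernel k (empirical X w n) x (X i w) * f (X i w)) / n" for f x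
    unfolding T_op_empirical[OF assms(1) a2 assms(2)] sample_mean_def ..
  show "normalized_kernel k (empirical X w n) x y = normalized_kernel k (empirical X w n) y x" for x y
    by (simp add: normalized_kernel_def k_sym[of x y] add.commute)
  show "\<bar>normalized_kernel k (empirical X w n) x y\<bar> \<le> 2 * M / a" for x y
    using normalized_kernel_bound[OF a2 assms(2), of x y] by (simp add: mult.commute)
  show "(\<lambda>x. normalized_kernel k (empirical X w n) x y) \<in> borel_measurable borel" for y
    by (intro normalized_kernel_measurable prob_space_empirical assms) (simp add: empirical_def)
qed

text \<open>The normalised kernel splits as \<open>(k x y / d x + k x y / d y) / 2\<close>. In each half the empirical
  degree is first exchanged for \<open>d\<^sub>\<mu>\<close>, at the cost \<open>\<bar>1/d\<^sub>n - 1/d\<^sub>\<mu>\<bar> \<le> 2 e / a\<^sup>2\<close>, and then the sample mean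
  for the integral.\<close>
lemma T_op_difference:
  fixes u :: "('x, real) bmfun"
  assumes n: "1 \<le> n" and dn: "\<And>x. a / 2 \<le> degree_fun k (empirical X w n) x"
    and e1: "\<And>y. \<bar>sample_mean X n w (k y) - (\<integral>z. k y z \<partial>\<mu>)\<bar> \<le> e"
    and eu: "\<And>y. \<bar>sample_mean X n w (\<lambda>z. k y z * u z) - (\<integral>z. k y z * u z \<partial>\<mu>)\<bar> \<le> e"
    and eud: "\<And>y. \<bar>sample_mean X n w (\<lambda>z. k y z * (u z / degree_fun k \<mu> z))
        - (\<integral>z. k y z * (u z / degree_fun k \<mu> z) \<partial>\<mu>)\<bar> \<le> e"
  shows "norm (T_op k (empirical X w n) u - T_op k \<mu> u) \<le> (2 * M * norm u / a\<^sup>2 + 1 / a + 1) * e"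
proof (rule norm_bmfun_le)
  fix x
  define d where "d = degree_fun k \<mu>"
  define d' where "d' = degree_fun k (empirical X w n)"
  define m where "m = sample_mean X n w"
  have e0: "0 \<le> e" using e1[of x] by linarith
  have dp2: "a \<le> d z" for z unfolding d_def by (rule a)
  have d'p2: "a / 2 \<le> d' z" for z unfolding d'_def by (rule dn)
  have dp: "0 < d z" "a \<le> d z" for z using dp2[of z] a(1) by linarith+
  have d'p: "0 < d' z" "a / 2 \<le> d' z" for z using d'p2[of z] a(1) by linarith+
  have ku: "\<bar>k x z * u z\<bar> \<le> M * norm u" for z
    unfolding abs_mult using k_nonneg[of x z] k_le[of x z] M norm_bm_apply_le[of u z]
    by (intro mult_mono) auto
  have inv: "\<bar>1 / d' z - 1 / d z\<bar> \<le> 2 * e / a\<^sup>2" for z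
  proof -
    have "\<bar>d z - d' z\<bar> \<le> e"
      unfolding d_def d'_def degree_empirical unfolding degree_fun_def
      using e1[of z] by (simp add: abs_minus_commute)
    moreover have "a * (a / 2) \<le> d z * d' z" using dp[of z] d'p[of z] a by (intro mult_mono) auto
    moreover have "\<bar>1 / d' z - 1 / d z\<bar> = \<bar>d z - d' z\<bar> / (d z * d' z)"
      using dp[of z] d'p[of z] by (simp add: field_simps abs_mult)
    ultimately have "\<bar>1 / d' z - 1 / d z\<bar> \<le> e / (a * (a / 2))"
      using frac_le[of e "\<bar>d z - d' z\<bar>" "a * (a / 2)" "d z * d' z"] e0 a(1) by simp
    then show ?thesis by (simp add: power2_eq_square mult.commute)
  qed
  define s1 where "s1 = m (\<lambda>z. k x z * u z)"
  define i1 where "i1 = (\<integral>z. k x z * u z \<partial>\<mu>)"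
  define s2 where "s2 = m (\<lambda>z. k x z * (u z / d' z))"
  define s3 where "s3 = m (\<lambda>z. k x z * (u z / d z))"
  define i3 where "i3 = (\<integral>z. k x z * (u z / d z) \<partial>\<mu>)"
  have emp: "T_op k (empirical X w n) u x = 1 / 2 * (1 / d' x) * s1 + 1 / 2 * s2"
  proof -
    have "normalized_kernel k (empirical X w n) x z * u z
        = 1 / 2 * (1 / d' x) * (k x z * u z) + 1 / 2 * (k x z * (u z / d' z))" for z
      by (simp add: normalized_kernel_def d'_def algebra_simps)
    then show ?thesis
      using T_op_empirical[OF n _ dn, of u x] a
      by (simp only: sample_mean_add sample_mean_cmult m_def s1_def s2_def)
  qed
  have meas[measurable]: "d \<in> borel_measurable borel"
    unfolding d_def by (intro degree_measurable \<mu>)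
  have int1: "integrable \<mu> (\<lambda>z. k x z * u z)"
    using ku by (intro integrable_bounded[of _ "M * norm u"]) auto
  have int3: "integrable \<mu> (\<lambda>z. k x z * (u z / d z))"
  proof (rule integrable_bounded[of _ "M * norm u / a"])
    fix z
    have "\<bar>k x z * (u z / d z)\<bar> = \<bar>k x z * u z\<bar> / d z" using dp[of z] by (simp add: abs_mult)
    also have "\<dots> \<le> M * norm u / a" using ku[of z] dp[of z] a M by (intro frac_le) auto
    finally show "\<bar>k x z * (u z / d z)\<bar> \<le> M * norm u / a" .
  qed simp
  have mu: "T_op k \<mu> u x = 1 / 2 * (1 / d x) * i1 + 1 / 2 * i3"
  proof -
    have "normalized_kernel k \<mu> x z * u z
        = 1 / 2 * (1 / d x) * (k x z * u z) + 1 / 2 * (k x z * (u z / d z))" for z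
      by (simp add: normalized_kernel_def d_def algebra_simps)
    then have "T_op k \<mu> u x = (\<integral>z. 1 / 2 * (1 / d x) * (k x z * u z) + 1 / 2 * (k x z * (u z / d z)) \<partial>\<mu>)"
      using T_op_apply'[OF \<mu> a, of u x] by simp
    also have "\<dots> = 1 / 2 * (1 / d x) * i1 + 1 / 2 * i3"
      unfolding i1_def i3_def
      by (subst Bochner_Integration.integral_add)
        (intro integrable_mult_right int1 int3, intro integrable_mult_right int1 int3,
          simp only: integral_mult_right_zero)
    finally show ?thesis .
  qed
  have s1_bd: "\<bar>s1\<bar> \<le> M * norm u"
    using sample_mean_abs_le[of "\<lambda>z. k x z * u z" "\<lambda>_. M * norm u" X n w, OF ku] n
    by (simp add: s1_def m_def sample_mean_const)
  have A: "\<bar>1 / d' x * s1 - 1 / d x * i1\<bar> \<le> 2 * e / a\<^sup>2 * (M * norm u) + 1 / a * e"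
  proof -
    have "p * s1 - q * i1 = (p - q) * s1 + q * (s1 - i1)" for p q :: real
      by (simp add: algebra_simps)
    then have "1 / d' x * s1 - 1 / d x * i1 = (1 / d' x - 1 / d x) * s1 + 1 / d x * (s1 - i1)" .
    moreover have "\<bar>(1 / d' x - 1 / d x) * s1\<bar> \<le> 2 * e / a\<^sup>2 * (M * norm u)"
      unfolding abs_mult using inv[of x] s1_bd e0 by (intro mult_mono) auto
    moreover have "\<bar>1 / d x * (s1 - i1)\<bar> \<le> 1 / a * e"
      unfolding abs_mult using eu[of x] dp[of x] a
      by (intro mult_mono) (auto simp: s1_def i1_def m_def intro!: divide_left_mono)
    ultimately show ?thesis by linarith
  qed
  have B: "\<bar>s2 - s3\<bar> \<le> 2 * e / a\<^sup>2 * (M * norm u)"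
  proof -
    have "\<bar>k x z * (u z / d' z) - k x z * (u z / d z)\<bar> \<le> 2 * e / a\<^sup>2 * (M * norm u)" for z
    proof -
      have "k x z * (u z / d' z) - k x z * (u z / d z) = (1 / d' z - 1 / d z) * (k x z * u z)"
        by (simp add: algebra_simps)
      moreover have "\<bar>(1 / d' z - 1 / d z) * (k x z * u z)\<bar> \<le> 2 * e / a\<^sup>2 * (M * norm u)"
        unfolding abs_mult[of "1 / d' z - 1 / d z"]
        by (rule mult_mono[OF inv ku]) (use e0 in auto)
      ultimately show ?thesis by (simp only:)
    qed
    from sample_mean_abs_le[of _ "\<lambda>_. 2 * e / a\<^sup>2 * (M * norm u)" X n w, OF this] n show ?thesis
      by (simp add: s2_def s3_def m_def sample_mean_const sample_mean_diff)
  qed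
  have C: "\<bar>s3 - i3\<bar> \<le> e" using eud[of x] by (simp add: s3_def i3_def m_def d_def)
  have "bm_apply (T_op k (empirical X w n) u - T_op k \<mu> u) x
      = ((1 / d' x * s1 - 1 / d x * i1) + ((s2 - s3) + (s3 - i3))) / 2"
  proof -
    have "1 / 2 * p' * s1 + 1 / 2 * s2 - (1 / 2 * p * i1 + 1 / 2 * i3)
        = ((p' * s1 - p * i1) + ((s2 - s3) + (s3 - i3))) / 2" for p p' :: real
      by (simp add: field_simps)
    then show ?thesis by (simp only: emp mu minus_bmfun.rep_eq)
  qed
  moreover have "\<bar>(1 / d' x * s1 - 1 / d x * i1) + ((s2 - s3) + (s3 - i3))\<bar>
      \<le> (2 * e / a\<^sup>2 * (M * norm u) + 1 / a * e) + (2 * e / a\<^sup>2 * (M * norm u) + e)"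
    by (intro order_trans[OF abs_triangle_ineq] add_mono A B C)
  ultimately have "norm (bm_apply (T_op k (empirical X w n) u - T_op k \<mu> u) x)
      \<le> ((2 * e / a\<^sup>2 * (M * norm u) + 1 / a * e) + (2 * e / a\<^sup>2 * (M * norm u) + e)) / 2"
    by (simp only: real_norm_def abs_divide abs_numeral divide_right_mono zero_le_numeral)
  also have "\<dots> = 2 * M * norm u / a\<^sup>2 * e + (1 / a * e + e) / 2"
    by (simp add: field_simps)
  also have "\<dots> \<le> 2 * M * norm u / a\<^sup>2 * e + (1 / a * e + e)"
  proof -
    have "0 \<le> 1 / a * e + e" using a(1) e0 by simp
    moreover have "z / 2 \<le> z" if "0 \<le> z" for z :: real using that by simp
    ultimately show ?thesis by (intro add_left_mono) blast
  qed
  finally show "norm (bm_apply (T_op k (empirical X w n) u - T_op k \<mu> u) x)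
      \<le> (2 * M * norm u / a\<^sup>2 + 1 / a + 1) * e"
    by (simp add: algebra_simps)
qed

end

section \<open>Tail sums\<close>

text \<open>The telescoping majorant \<open>1 / (n (n - 1))\<close> of \<open>1 / n\<^sup>2\<close>.\<close>
lemma inverse_square_tail_sums:
  assumes "2 \<le> (N::nat)"
  shows "(\<lambda>i. 1 / (real (N + i) - 1) - 1 / real (N + i)) sums (1 / (real N - 1))"
proof -
  have "(\<lambda>i. 1 / (real (N + i) - 1)) \<longlonglongrightarrow> 0" by real_asymp
  from telescope_sums'[OF this] show ?thesis by (simp add: algebra_simps)
qed

lemma geometric_tail_bound:
  assumes "0 < (c::real)"
  shows "(\<lambda>i. exp (- (real (N + i) * c))) sums (exp (- real N * c) / (1 - exp (- c)))"
    and "exp (- real N * c) / (1 - exp (- c)) \<le> exp (- (real N - 1) * c) / c"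
proof -
  have "exp (- (real (N + i) * c)) = exp (- real N * c) * exp (- c) ^ i" for i
    by (simp add: exp_of_nat_mult[symmetric] exp_add[symmetric] algebra_simps)
  moreover have "(\<lambda>i. exp (- c) ^ i) sums (1 / (1 - exp (- c)))"
    using assms by (intro geometric_sums) simp
  then have "(\<lambda>i. exp (- real N * c) * exp (- c) ^ i) sums (exp (- real N * c) * (1 / (1 - exp (- c))))"
    by (rule sums_mult)
  ultimately show "(\<lambda>i. exp (- (real (N + i) * c))) sums (exp (- real N * c) / (1 - exp (- c)))"
    by simp
  have "exp (- (real N - 1) * c) = exp (- real N * c) * exp c"
    by (simp add: exp_add[symmetric] algebra_simps)
  moreover have "1 / (1 - exp (- c)) \<le> exp c / c"
  proof -
    have "c \<le> exp c - 1" using exp_ge_add_one_self[of c] by linarith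
    then have "c \<le> exp c * (1 - exp (- c))" by (simp add: algebra_simps exp_minus)
    then show ?thesis using assms by (simp add: field_simps)
  qed
  ultimately show "exp (- real N * c) / (1 - exp (- c)) \<le> exp (- (real N - 1) * c) / c"
    using mult_left_mono[of "1 / (1 - exp (- c))" "exp c / c" "exp (- real N * c)"] by simp
qed

text \<open>All exponents and the factor \<open>\<alpha> powr (2 * \<rho>) * r\<close> are at most quadratic in \<open>\<alpha>\<close> on the
  logarithmic scale: \<open>\<rho> / 2 + q + 2 \<le> 4 \<alpha>\<^sup>2\<close>, and \<open>\<alpha> powr (2 * \<alpha> + 1) \<le> exp (3 * \<alpha>\<^sup>2)\<close>, which costs another
  \<open>5 \<alpha>\<^sup>2\<close> in the exponent of \<open>n\<close> because \<open>ln n \<ge> 3 / 5\<close>. This is where the number \<open>9\<close> comes from.\<close>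
lemma power_tail_bound:
  fixes \<alpha> \<rho> q r :: real and n :: nat
  assumes "1 \<le> \<alpha>" "0 < \<rho>" "\<rho> \<le> \<alpha>" "q \<le> \<alpha>" "0 < r" "r \<le> \<alpha>" "2 \<le> n"
  shows "real n powr (\<rho> / 2 - 9 * \<alpha>\<^sup>2) \<le> \<alpha> powr (- (2 * \<rho>)) * (1 / r) * (real n powr (- q) / (real n)\<^sup>2)"
proof -
  have a2: "\<alpha> \<le> \<alpha>\<^sup>2" "1 \<le> \<alpha>\<^sup>2" using assms(1) by (auto simp: power2_eq_square mult_le_cancel_left1 mult_ge1_I)
  have ln2: "3 / 5 \<le> ln (2::real)" using ln2_ge_two_thirds by simp
  moreover have "ln 2 \<le> ln (real n)" using assms(7) by simp
  ultimately have lnn: "3 / 5 \<le> ln (real n)" by linarith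
  have "real n powr (\<rho> / 2 + q + 2 - 9 * \<alpha>\<^sup>2) \<le> real n powr (- (5 * \<alpha>\<^sup>2))"
    using assms a2 by (intro powr_mono) auto
  also have "\<dots> = exp (- (5 * \<alpha>\<^sup>2) * ln (real n))" using assms(7) by (simp add: powr_def)
  also have "\<dots> \<le> exp (- (3 * \<alpha>\<^sup>2))"
  proof -
    have "5 * \<alpha>\<^sup>2 * (3 / 5) \<le> 5 * \<alpha>\<^sup>2 * ln (real n)" using lnn by (intro mult_left_mono) auto
    then show ?thesis by simp
  qed
  also have "\<dots> \<le> 1 / (\<alpha> powr (2 * \<rho>) * r)"
  proof -
    have "\<alpha> powr (2 * \<rho>) * r \<le> \<alpha> powr (2 * \<alpha>) * \<alpha>"
      using assms by (intro mult_mono powr_mono) auto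
    also have "\<dots> = \<alpha> powr (2 * \<alpha> + 1)" using assms(1) by (simp add: powr_add)
    also have "\<dots> = exp ((2 * \<alpha> + 1) * ln \<alpha>)" using assms(1) by (simp add: powr_def)
    also have "\<dots> \<le> exp (3 * \<alpha>\<^sup>2)"
    proof -
      have "(2 * \<alpha> + 1) * ln \<alpha> \<le> (2 * \<alpha> + 1) * \<alpha>"
        using assms(1) ln_le_minus_one[of \<alpha>] by (intro mult_left_mono) auto
      also have "\<dots> \<le> 3 * \<alpha>\<^sup>2" using a2 by (simp add: power2_eq_square algebra_simps)
      finally show ?thesis by simp
    qed
    finally have "\<alpha> powr (2 * \<rho>) * r \<le> exp (3 * \<alpha>\<^sup>2)" .
    then have "1 / exp (3 * \<alpha>\<^sup>2) \<le> 1 / (\<alpha> powr (2 * \<rho>) * r)"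
      using assms by (intro divide_left_mono) auto
    then show ?thesis by (simp add: exp_minus inverse_eq_divide)
  qed
  finally have *: "real n powr (\<rho> / 2 + q + 2 - 9 * \<alpha>\<^sup>2) \<le> 1 / (\<alpha> powr (2 * \<rho>) * r)" .
  have "real n powr (\<rho> / 2 - 9 * \<alpha>\<^sup>2) = real n powr (\<rho> / 2 + q + 2 - 9 * \<alpha>\<^sup>2) * real n powr (- q - 2)"
    by (simp add: powr_add[symmetric])
  also have "\<dots> \<le> 1 / (\<alpha> powr (2 * \<rho>) * r) * real n powr (- q - 2)"
    using * by (intro mult_right_mono) auto
  also have "real n powr (- q - 2) = real n powr (- q) / (real n)\<^sup>2"
    using assms(7) by (simp add: powr_diff powr_numeral)
  finally show ?thesis by (simp add: powr_minus field_simps)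
qed

text \<open>The failure probability at \<open>n\<close> for the deviation \<open>\<epsilon> = c\<^sub>0 \<alpha> (ln n / n)\<^sup>1\<^sup>/\<^sup>2\<close>: the size of the net grows
  at most like a power of \<open>C\<^sub>\<omega> / \<epsilon> \<le> 2 C\<^sub>\<omega> n\<^sup>1\<^sup>/\<^sup>2\<close>, while the exponential is at most \<open>n powr (- 9 * \<alpha>\<^sup>2)\<close>. The
  last factor telescopes in \<open>n\<close>.\<close>
lemma net_tail_bound:
  fixes \<alpha> \<rho> q r C\<^sub>L C\<^sub>\<omega> D c\<^sub>0 \<kappa> \<epsilon> :: real and n N :: nat
  assumes \<alpha>: "1 \<le> \<alpha>" and \<rho>: "0 < \<rho>" "\<rho> \<le> \<alpha>" and q: "0 \<le> q" "q \<le> \<alpha>" and r: "0 < r" "r \<le> \<alpha>"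
    and C: "0 < C\<^sub>L" "0 < C\<^sub>\<omega>" and D: "2 \<le> D"
    and c\<^sub>0: "1 \<le> c\<^sub>0" "9 \<le> \<kappa> * c\<^sub>0\<^sup>2" and N: "2 \<le> N" "N \<le> n"
  defines "\<epsilon> \<equiv> c\<^sub>0 * \<alpha> * sqrt (ln n / n)"
  shows "8 * (C\<^sub>L * (C\<^sub>\<omega> / \<epsilon>) powr \<rho>) * exp (- (real n * \<epsilon>\<^sup>2 * \<kappa>))
    \<le> 16 * (C\<^sub>L * (D * C\<^sub>\<omega>) powr \<rho>) / \<alpha> powr (2 * \<rho>) * (1 / r) * (1 / (real N - 1) powr q)
        * (1 / (real n - 1) - 1 / real n)"
proof -
  have n: "2 \<le> n" "0 < real n" "1 < real n" using N by auto
  have ln_n: "1 / 4 \<le> ln (real n)"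
  proof -
    have "ln 2 \<le> ln (real n)" using n by simp
    then show ?thesis using ln2_ge_two_thirds by linarith
  qed
  have eps2: "real n * \<epsilon>\<^sup>2 = c\<^sub>0\<^sup>2 * \<alpha>\<^sup>2 * ln n"
    using n ln_n by (simp add: \<epsilon>_def power_mult_distrib)
  have eps_ge: "1 / (2 * sqrt n) \<le> \<epsilon>"
  proof -
    have "1 / (2 * sqrt n) = sqrt (1 / 4 / n)" by (simp add: real_sqrt_divide real_sqrt_mult)
    also have "\<dots> \<le> sqrt (ln n / n)" using ln_n n by (intro real_sqrt_le_mono divide_right_mono) auto
    also have "\<dots> \<le> c\<^sub>0 * \<alpha> * sqrt (ln n / n)"
    proof -
      have "1 * 1 \<le> c\<^sub>0 * \<alpha>" using \<alpha> c\<^sub>0 by (intro mult_mono) auto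
      then show ?thesis using mult_right_mono[of 1 "c\<^sub>0 * \<alpha>" "sqrt (ln n / n)"] ln_n n by simp
    qed
    finally show ?thesis by (simp add: \<epsilon>_def)
  qed
  have pos: "0 < 1 / (2 * sqrt n)" using n by simp
  then have eps_pos: "0 < \<epsilon>" using eps_ge by linarith
  have A: "(C\<^sub>\<omega> / \<epsilon>) powr \<rho> \<le> (D * C\<^sub>\<omega>) powr \<rho> * real n powr (\<rho> / 2)"
  proof -
    have "C\<^sub>\<omega> / \<epsilon> \<le> C\<^sub>\<omega> / (1 / (2 * sqrt n))"
      using eps_ge pos eps_pos C by (intro divide_left_mono mult_pos_pos) auto
    also have "\<dots> = 2 * C\<^sub>\<omega> * sqrt n" by simp
    also have "\<dots> \<le> D * C\<^sub>\<omega> * sqrt n" using D C by (intro mult_right_mono) auto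
    finally have "(C\<^sub>\<omega> / \<epsilon>) powr \<rho> \<le> (D * C\<^sub>\<omega> * sqrt n) powr \<rho>"
      using C eps_pos \<rho> by (intro powr_mono2) auto
    also have "\<dots> = (D * C\<^sub>\<omega>) powr \<rho> * real n powr (\<rho> / 2)"
      using C D n by (simp add: powr_mult powr_half_sqrt[symmetric] powr_powr)
    finally show ?thesis .
  qed
  have B: "exp (- (real n * \<epsilon>\<^sup>2 * \<kappa>)) \<le> real n powr (- (9 * \<alpha>\<^sup>2))"
  proof -
    have "9 * (\<alpha>\<^sup>2 * ln n) \<le> \<kappa> * c\<^sub>0\<^sup>2 * (\<alpha>\<^sup>2 * ln n)"
      using c\<^sub>0 ln_n by (intro mult_right_mono) auto
    then show ?thesis unfolding eps2 using n by (simp add: powr_def mult_ac)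
  qed
  have "(C\<^sub>\<omega> / \<epsilon>) powr \<rho> * exp (- (real n * \<epsilon>\<^sup>2 * \<kappa>))
      \<le> ((D * C\<^sub>\<omega>) powr \<rho> * real n powr (\<rho> / 2)) * real n powr (- (9 * \<alpha>\<^sup>2))"
    using A B by (intro mult_mono) auto
  also have "\<dots> = (D * C\<^sub>\<omega>) powr \<rho> * real n powr (\<rho> / 2 - 9 * \<alpha>\<^sup>2)"
    by (simp add: powr_add[symmetric])
  also have "\<dots> \<le> (D * C\<^sub>\<omega>) powr \<rho> * (\<alpha> powr (- (2 * \<rho>)) * (1 / r) * (real n powr (- q) / (real n)\<^sup>2))"
    using assms n by (intro mult_left_mono power_tail_bound) auto
  also have "\<dots> \<le> (D * C\<^sub>\<omega>) powr \<rho> * (\<alpha> powr (- (2 * \<rho>)) * (1 / r) *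
      (1 / (real N - 1) powr q * (1 / (real n - 1) - 1 / real n)))"
  proof -
    have "real n powr (- q) \<le> 1 / (real N - 1) powr q"
    proof -
      have "(real N - 1) powr q \<le> real n powr q" using N q by (intro powr_mono2) auto
      then show ?thesis using N by (auto simp: powr_minus inverse_eq_divide intro!: divide_left_mono)
    qed
    moreover have "1 / (real n)\<^sup>2 \<le> 1 / (real n - 1) - 1 / real n"
      using n by (simp add: field_simps power2_eq_square)
    ultimately have "real n powr (- q) * (1 / (real n)\<^sup>2)
        \<le> 1 / (real N - 1) powr q * (1 / (real n - 1) - 1 / real n)"
      by (intro mult_mono) auto
    then show ?thesis using r by (intro mult_left_mono) auto
  qed
  finally have "C\<^sub>L * ((C\<^sub>\<omega> / \<epsilon>) powr \<rho> * exp (- (real n * \<epsilon>\<^sup>2 * \<kappa>))) \<le> C\<^sub>L * ((D * C\<^sub>\<omega>) powr \<rho> * (\<alpha> powr (- (2 * \<rho>)) * (1 / r) *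
      (1 / (real N - 1) powr q * (1 / (real n - 1) - 1 / real n))))"
    using C by (intro mult_left_mono) auto
  then have "8 * (C\<^sub>L * ((C\<^sub>\<omega> / \<epsilon>) powr \<rho> * exp (- (real n * \<epsilon>\<^sup>2 * \<kappa>)))) \<le> 16 * (C\<^sub>L * ((D * C\<^sub>\<omega>) powr \<rho> * (\<alpha> powr (- (2 * \<rho>)) * (1 / r) *
      (1 / (real N - 1) powr q * (1 / (real n - 1) - 1 / real n)))))"
  proof -
    assume le: "C\<^sub>L * ((C\<^sub>\<omega> / \<epsilon>) powr \<rho> * exp (- (real n * \<epsilon>\<^sup>2 * \<kappa>))) \<le> C\<^sub>L * ((D * C\<^sub>\<omega>) powr \<rho> * (\<alpha> powr (- (2 * \<rho>)) * (1 / r) *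
      (1 / (real N - 1) powr q * (1 / (real n - 1) - 1 / real n))))"
    have double: "8 * x \<le> 16 * y" if "x \<le> y" "0 \<le> x" for x y :: real using that by linarith
    show ?thesis by (rule double[OF le]) (use C in simp)
  qed
  then show ?thesis by (simp add: powr_minus inverse_eq_divide mult_ac)
qed

section \<open>The event of large probability\<close>

lemma (in prob_space) prob_Union_le_suminf:
  fixes S :: "nat \<Rightarrow> 'a set"
  assumes "\<And>i. S i \<in> events" "\<And>i. prob (S i) \<le> f i" "f sums s"
  shows "prob (\<Union>i. S i) \<le> s"
proof -
  have sm: "summable (\<lambda>i. prob (S i))"
    by (rule summable_comparison_test'[OF sums_summable[OF assms(3)], of 0]) (simp add: assms(2))
  have "prob (\<Union>i. S i) \<le> (\<Sum>i. prob (S i))"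
    using assms(1) by (intro finite_measure_subadditive_countably sm) auto
  also have "\<dots> \<le> (\<Sum>i. f i)" by (rule suminf_le[OF assms(2) sm sums_summable[OF assms(3)]])
  finally show ?thesis using sums_unique[OF assms(3)] by simp
qed

context kernel_sample
begin

text \<open>The covering numbers and the modulus of continuity enter only through the size of a net at which
  the modulus is at most \<open>\<epsilon>\<close>. For \<open>L\<^sub>\<delta> \<le> C\<^sub>L / \<delta>\<^sup>m\<close> and \<open>\<omega> \<delta> \<le> C\<^sub>\<omega> \<delta>\<^sup>m\<^sup>'\<close> the choice \<open>C\<^sub>\<omega> \<delta>\<^sup>m\<^sup>' = \<epsilon>\<close> gives the
  exponent \<open>\<rho> = m / m'\<close>.\<close>
definition net_bound :: "real \<Rightarrow> real \<Rightarrow> real \<Rightarrow> bool"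
  where "net_bound C\<^sub>L C\<^sub>\<omega> \<rho> \<longleftrightarrow> (\<forall>\<epsilon>>0. \<epsilon> \<le> a / 16 \<longrightarrow> (\<exists>\<delta>>0.
    real (covering_number TYPE('x) \<delta>) \<le> C\<^sub>L * (C\<^sub>\<omega> / \<epsilon>) powr \<rho> \<and>
    (\<forall>x. integrable (completion \<mu>) (modulus k \<delta> x) \<and> (\<integral>z. modulus k \<delta> x z \<partial>completion \<mu>) \<le> \<epsilon>)))"

text \<open>A net with modulus at most \<open>a / 16\<close> and deviations below \<open>a / 8\<close> keep the empirical degrees within
  \<open>3 a / 8\<close> of \<open>d\<^sub>\<mu> \<ge> a\<close>. The exponent that Hoeffding's inequality gives is larger than the stated one,
  which has the form of Bernstein's inequality.\<close>
lemma degree_event: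
  assumes net: "net_bound C\<^sub>L C\<^sub>\<omega> \<rho>" and n: "1 \<le> n"
  obtains S where "S \<in> events"
    "prob S \<le> 4 * (C\<^sub>L * (16 * C\<^sub>\<omega> / a) powr \<rho>) * exp (- (real n * ((a / 2)\<^sup>2 / (32 * M\<^sup>2 + 8 / 3 * M * (a / 2)))))"
    "\<And>w x. w \<in> space P - S \<Longrightarrow> a / 2 \<le> degree_fun k (empirical X w n) x"
proof -
  obtain \<delta> where \<delta>: "0 < \<delta>" "real (covering_number TYPE('x) \<delta>) \<le> C\<^sub>L * (C\<^sub>\<omega> / (a / 16)) powr \<rho>"
    "\<And>x. integrable (completion \<mu>) (modulus k \<delta> x)"
    "\<And>x. (\<integral>z. modulus k \<delta> x z \<partial>completion \<mu>) \<le> a / 16"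
    using net a unfolding net_bound_def by (meson divide_pos_pos order_refl zero_less_numeral)
  obtain S where S: "S \<in> events"
    "prob S \<le> 2 * (real (card {\<lambda>_::'x. 1::real}) + 1) * covering_number TYPE('x) \<delta> * exp (- (real n * (a / 8)\<^sup>2 / (2 * (M * 1)\<^sup>2)))"
    "\<And>w v y. w \<in> space P - S \<Longrightarrow> v \<in> {\<lambda>_. 1} \<Longrightarrow>
       \<bar>sample_mean X n w (\<lambda>z. k y z * v z) - (\<integral>z. k y z * v z \<partial>\<mu>)\<bar> \<le> a / 8 + 1 * (2 * (a / 16) + a / 8)"
    by (rule uniform_deviation[OF n \<delta>(1,3,4), of "{\<lambda>_. 1}" 1 "a / 8"]) (use a in auto)
  show ?thesis
  proof (rule that[OF S(1)])
    let ?Ce = "(a / 2)\<^sup>2 / (32 * M\<^sup>2 + 8 / 3 * M * (a / 2))"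
    have "(a / 2)\<^sup>2 / (32 * M\<^sup>2 + 8 / 3 * M * (a / 2)) \<le> (a / 2)\<^sup>2 / (32 * M\<^sup>2)"
      using a M by (intro divide_left_mono mult_pos_pos add_pos_pos) auto
    also have "\<dots> = (a / 8)\<^sup>2 / (2 * (M * 1)\<^sup>2)" by (simp add: power2_eq_square)
    finally have "real n * ?Ce \<le> real n * ((a / 8)\<^sup>2 / (2 * (M * 1)\<^sup>2))" by (rule mult_left_mono) simp
    then have "exp (- (real n * (a / 8)\<^sup>2 / (2 * (M * 1)\<^sup>2))) \<le> exp (- (real n * ?Ce))" by simp
    moreover have "C\<^sub>\<omega> / (a / 16) = 16 * C\<^sub>\<omega> / a" by simp
    ultimately have "covering_number TYPE('x) \<delta> * exp (- (real n * (a / 8)\<^sup>2 / (2 * (M * 1)\<^sup>2)))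
       \<le> C\<^sub>L * (16 * C\<^sub>\<omega> / a) powr \<rho> * exp (- (real n * ?Ce))"
    proof -
      assume e: "exp (- (real n * (a / 8)\<^sup>2 / (2 * (M * 1)\<^sup>2))) \<le> exp (- (real n * ?Ce))"
        and c: "C\<^sub>\<omega> / (a / 16) = 16 * C\<^sub>\<omega> / a"
      show ?thesis
        using \<delta>(2) unfolding c by (rule mult_mono[OF _ e]) (use \<delta>(2)[unfolded c] order_trans[OF of_nat_0_le_iff] in auto)
    qed
    then show "prob S \<le> 4 * (C\<^sub>L * (16 * C\<^sub>\<omega> / a) powr \<rho>) * exp (- (real n * ?Ce))"
      using S(2) by simp
  next
    fix w x assume w: "w \<in> space P - S"
    have "\<bar>sample_mean X n w (k x) - (\<integral>z. k x z \<partial>\<mu>)\<bar> \<le> 3 * a / 8"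
      using S(3)[OF w, of "\<lambda>_. 1" x] by simp
    moreover have "a \<le> (\<integral>z. k x z \<partial>\<mu>)" using a(2)[of x] unfolding degree_fun_def .
    ultimately show "a / 2 \<le> degree_fun k (empirical X w n) x"
      unfolding degree_empirical using a(1) by linarith
  qed
qed

lemma T_op_norm_le:
  fixes u :: "('x, real) bmfun"
  shows "norm (T_op k \<mu> u) \<le> M / a * norm u"
proof (rule norm_bmfun_le)
  fix x
  have bd: "\<bar>normalized_kernel k \<mu> x z * u z\<bar> \<le> M / a * norm u" for z
    unfolding abs_mult using normalized_kernel_bound[OF a, of x z] norm_bm_apply_le[of u z] M a(1)
    by (intro mult_mono) auto
  have m: "(\<lambda>z. normalized_kernel k \<mu> x z * u z) \<in> borel_measurable borel"
    by (intro borel_measurable_times normalized_kernel_measurable \<mu>) simp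
  have "\<bar>\<integral>z. normalized_kernel k \<mu> x z * u z \<partial>\<mu>\<bar> \<le> (\<integral>z. M / a * norm u \<partial>\<mu>)"
    by (rule order_trans[OF integral_abs_bound])
      (intro integral_mono integrable_abs integrable_bounded[OF m bd] bd \<mu>.integrable_const)
  then show "norm (T_op k \<mu> u x) \<le> M / a * norm u"
    using T_op_apply'[OF \<mu> a, of u x] by (simp add: \<mu>.prob_space)
qed

text \<open>For \<open>\<epsilon> \<le> a / 16\<close> the net is chosen at the scale \<open>\<epsilon>\<close> of the deviations, and \<open>\<epsilon> + 3 b \<epsilon> \<le> 4 b \<epsilon>\<close>. For
  larger \<open>\<epsilon>\<close> no event has to be excluded: both operators are bounded, which is absorbed in the
  summand with the factor \<open>16 / a\<close>.\<close>
lemma operator_event: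
  fixes u :: "('x, real) bmfun" and b \<epsilon> :: real and n :: nat
  assumes net: "net_bound C\<^sub>L C\<^sub>\<omega> \<rho>" and C\<^sub>L: "0 \<le> C\<^sub>L" and n: "1 \<le> n" and \<epsilon>: "0 < \<epsilon>" and a1: "a \<le> 1"
  defines "b \<equiv> 1 + norm u / a"
  obtains S where "S \<in> events"
    "prob S \<le> 8 * (C\<^sub>L * (C\<^sub>\<omega> / \<epsilon>) powr \<rho>) * exp (- (real n * \<epsilon>\<^sup>2 * (1 / (2 * (M * b)\<^sup>2))))"
    "\<And>w. w \<in> space P - S \<Longrightarrow> (\<And>x. a / 2 \<le> degree_fun k (empirical X w n) x) \<Longrightarrow>
      norm (T_op k (empirical X w n) u - T_op k \<mu> u)
        \<le> ((2 * M * norm u / a\<^sup>2 + 1 / a + 1) * (4 * b) + 3 * M / a * norm u * (16 / a)) * \<epsilon>"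
proof (cases "\<epsilon> \<le> a / 16")
  case True
  have b1: "1 \<le> b" using a by (simp add: b_def)
  obtain \<delta> where \<delta>: "0 < \<delta>" "real (covering_number TYPE('x) \<delta>) \<le> C\<^sub>L * (C\<^sub>\<omega> / \<epsilon>) powr \<rho>"
    "\<And>x. integrable (completion \<mu>) (modulus k \<delta> x)"
    "\<And>x. (\<integral>z. modulus k \<delta> x z \<partial>completion \<mu>) \<le> \<epsilon>"
    using net True \<epsilon> unfolding net_bound_def by meson
  define Vs where "Vs = {\<lambda>_. 1, bm_apply u, \<lambda>z. u z / degree_fun k \<mu> z}"
  have Vs_meas: "v \<in> borel_measurable borel" if "v \<in> Vs" for v
    using that degree_measurable[OF \<mu>] by (auto simp: Vs_def)
  have Vs_bd: "\<bar>v z\<bar> \<le> b" if "v \<in> Vs" for v z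
  proof -
    have u1: "\<bar>u z\<bar> \<le> norm u" using norm_bm_apply_le[of u z] by simp
    have "norm u * a \<le> norm u * 1" using a1 by (intro mult_left_mono) auto
    then have "norm u \<le> norm u / a" using a(1) by (simp add: pos_le_divide_eq)
    then have u2: "\<bar>u z\<bar> \<le> b" using u1 by (simp add: b_def)
    have "\<bar>u z\<bar> / degree_fun k \<mu> z \<le> norm u / a" using u1 a(1) by (intro frac_le a(2)) auto
    moreover have "0 < degree_fun k \<mu> z" using a(1) a(2)[of z] by linarith
    ultimately have "\<bar>u z / degree_fun k \<mu> z\<bar> \<le> b" by (simp add: b_def)
    then show ?thesis using that u2 b1 by (auto simp: Vs_def)
  qed
  have fin: "finite Vs" and card: "card Vs \<le> 3" by (auto simp: Vs_def card_insert_if)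
  obtain S where S: "S \<in> events"
    "prob S \<le> 2 * (real (card Vs) + 1) * covering_number TYPE('x) \<delta> * exp (- (real n * \<epsilon>\<^sup>2 / (2 * (M * b)\<^sup>2)))"
    "\<And>w v y. w \<in> space P - S \<Longrightarrow> v \<in> Vs \<Longrightarrow>
       \<bar>sample_mean X n w (\<lambda>z. k y z * v z) - (\<integral>z. k y z * v z \<partial>\<mu>)\<bar> \<le> \<epsilon> + b * (2 * \<epsilon> + \<epsilon>)"
    by (rule uniform_deviation[where Vs = Vs and b = b and \<epsilon> = \<epsilon> and \<eta> = \<epsilon> and \<delta> = \<delta> and n = n,
      OF n \<delta>(1,3,4) fin]) (erule Vs_meas, erule Vs_bd, rule b1, rule less_imp_le[OF \<epsilon>], rule that)
  show ?thesis
  proof (rule that[OF S(1)])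
    have "2 * (real (card Vs) + 1) * covering_number TYPE('x) \<delta> \<le> 8 * (C\<^sub>L * (C\<^sub>\<omega> / \<epsilon>) powr \<rho>)"
      using card \<delta>(2) by (intro mult_mono) auto
    then have "2 * (real (card Vs) + 1) * covering_number TYPE('x) \<delta> * exp (- (real n * \<epsilon>\<^sup>2 / (2 * (M * b)\<^sup>2)))
      \<le> 8 * (C\<^sub>L * (C\<^sub>\<omega> / \<epsilon>) powr \<rho>) * exp (- (real n * \<epsilon>\<^sup>2 / (2 * (M * b)\<^sup>2)))"
      by (rule mult_right_mono) simp
    from order_trans[OF S(2) this]
    show "prob S \<le> 8 * (C\<^sub>L * (C\<^sub>\<omega> / \<epsilon>) powr \<rho>) * exp (- (real n * \<epsilon>\<^sup>2 * (1 / (2 * (M * b)\<^sup>2))))"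
      by (simp only: times_divide_eq_right mult_1_right)
  next
    fix w assume w: "w \<in> space P - S" and dn: "\<And>x. a / 2 \<le> degree_fun k (empirical X w n) x"
    let ?e = "\<epsilon> + b * (2 * \<epsilon> + \<epsilon>)"
    have "norm (T_op k (empirical X w n) u - T_op k \<mu> u) \<le> (2 * M * norm u / a\<^sup>2 + 1 / a + 1) * ?e"
    proof (rule T_op_difference[OF n dn])
      show "\<bar>sample_mean X n w (k y) - (\<integral>z. k y z \<partial>\<mu>)\<bar> \<le> ?e" for y
        using S(3)[OF w, of "\<lambda>_. 1" y] by (simp add: Vs_def)
      show "\<bar>sample_mean X n w (\<lambda>z. k y z * u z) - (\<integral>z. k y z * u z \<partial>\<mu>)\<bar> \<le> ?e" for y
        using S(3)[OF w, of "bm_apply u" y] by (simp add: Vs_def)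
      show "\<bar>sample_mean X n w (\<lambda>z. k y z * (u z / degree_fun k \<mu> z))
          - (\<integral>z. k y z * (u z / degree_fun k \<mu> z) \<partial>\<mu>)\<bar> \<le> ?e" for y
        using S(3)[OF w, of "\<lambda>z. u z / degree_fun k \<mu> z" y] by (simp add: Vs_def)
    qed
    also have "\<dots> \<le> (2 * M * norm u / a\<^sup>2 + 1 / a + 1) * (4 * b * \<epsilon>)"
    proof (rule mult_left_mono)
      have "1 * \<epsilon> \<le> b * \<epsilon>" using b1 \<epsilon> by (intro mult_right_mono) auto
      then show "?e \<le> 4 * b * \<epsilon>" by (simp add: algebra_simps)
      show "0 \<le> 2 * M * norm u / a\<^sup>2 + 1 / a + 1" using a(1) M by simp
    qed
    also have "\<dots> \<le> ((2 * M * norm u / a\<^sup>2 + 1 / a + 1) * (4 * b) + 3 * M / a * norm u * (16 / a)) * \<epsilon>"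
    proof -
      have "K * (4 * b * \<epsilon>) \<le> (K * (4 * b) + L) * \<epsilon>" if "0 \<le> L" for K L
        using that \<epsilon> by (simp add: algebra_simps)
      then show ?thesis using a(1) M by simp
    qed
    finally show "norm (T_op k (empirical X w n) u - T_op k \<mu> u)
      \<le> ((2 * M * norm u / a\<^sup>2 + 1 / a + 1) * (4 * b) + 3 * M / a * norm u * (16 / a)) * \<epsilon>" .
  qed
next
  case False
  show ?thesis
  proof (rule that[of "{}"])
    fix w assume dn: "\<And>x. a / 2 \<le> degree_fun k (empirical X w n) x"
    interpret sampled_kernel "T_op k (empirical X w n)" "normalized_kernel k (empirical X w n)"
      "\<lambda>i. X i w" n "2 * M / a" by (rule empirical_sampled_kernel[OF n dn])
    have "sqrt (ip u u) \<le> norm u" using ip_le_norm[of u] by (intro real_le_lsqrt) auto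
    then have "norm (T_op k (empirical X w n) u) \<le> 2 * M / a * norm u"
      using T_norm_le[of u] b_nonneg by (meson mult_left_mono order_trans)
    then have "norm (T_op k (empirical X w n) u - T_op k \<mu> u) \<le> 2 * M / a * norm u + M / a * norm u"
      using T_op_norm_le[of u] norm_triangle_ineq4[of "T_op k (empirical X w n) u" "T_op k \<mu> u"] by linarith
    also have "\<dots> = 3 * M / a * norm u * (16 / a) * (a / 16)" using a(1) by (simp add: field_simps)
    also have "\<dots> \<le> 3 * M / a * norm u * (16 / a) * \<epsilon>"
      using False a(1) M by (intro mult_left_mono) auto
    also have "\<dots> \<le> ((2 * M * norm u / a\<^sup>2 + 1 / a + 1) * (4 * b) + 3 * M / a * norm u * (16 / a)) * \<epsilon>"
    proof -
      have "L * \<epsilon> \<le> (K + L) * \<epsilon>" if "0 \<le> K" for K L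
        using that \<epsilon> by (simp add: algebra_simps)
      then show ?thesis by this (use a(1) M in \<open>simp add: b_def\<close>)
    qed
    finally show "norm (T_op k (empirical X w n) u - T_op k \<mu> u)
      \<le> ((2 * M * norm u / a\<^sup>2 + 1 / a + 1) * (4 * b) + 3 * M / a * norm u * (16 / a)) * \<epsilon>" .
  qed (use C\<^sub>L in auto)
qed

text \<open>Two kinds of bad events are removed for each \<open>n \<ge> N\<close>: small empirical degrees, whose probabilities
  form a geometric series, and a large deviation of the operators at the scale \<open>\<epsilon>\<^sub>n\<close>, whose
  probabilities are summed by telescoping.\<close>
lemma convergence_event:
  fixes u :: "('x, real) bmfun" and C\<^sub>L C\<^sub>\<omega> \<rho> \<alpha> q r D c\<^sub>0 b C\<^sub>e :: real and N :: nat
  assumes net: "net_bound C\<^sub>L C\<^sub>\<omega> \<rho>" and a1: "a \<le> 1"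
    and C: "0 < C\<^sub>L" "0 < C\<^sub>\<omega>" and D: "2 \<le> D"
    and \<alpha>: "1 \<le> \<alpha>" and \<rho>: "0 < \<rho>" "\<rho> \<le> \<alpha>" and q: "0 \<le> q" "q \<le> \<alpha>" and r: "0 < r" "r \<le> \<alpha>"
    and c\<^sub>0: "1 \<le> c\<^sub>0" "9 \<le> 1 / (2 * (M * b)\<^sup>2) * c\<^sub>0\<^sup>2" and N: "2 \<le> N"
    and b_def: "b = 1 + norm u / a"
    and C\<^sub>e_def: "C\<^sub>e = (a / 2)\<^sup>2 / (32 * M\<^sup>2 + 8 / 3 * M * (a / 2))"
  obtains A where "A \<in> events"
    "\<And>w n. w \<in> A \<Longrightarrow> N \<le> n \<Longrightarrow> (\<forall>x. a / 2 \<le> degree_fun k (empirical X w n) x) \<and>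
      norm (T_op k (empirical X w n) u - T_op k \<mu> u)
        \<le> ((2 * M * norm u / a\<^sup>2 + 1 / a + 1) * (4 * b) + 3 * M / a * norm u * (16 / a))
           * (c\<^sub>0 * \<alpha> * sqrt (ln (real n) / real n))"
    "1 - 16 * (C\<^sub>L * (D * C\<^sub>\<omega>) powr \<rho>) / \<alpha> powr (2 * \<rho>) * (1 / r) * (1 / (real N - 1) powr q)
       - 4 * (C\<^sub>L * (16 * C\<^sub>\<omega> / a) powr \<rho> / C\<^sub>e) * exp (- (real N - 1) * C\<^sub>e) \<le> prob A"
proof -
  let ?K = "(2 * M * norm u / a\<^sup>2 + 1 / a + 1) * (4 * b) + 3 * M / a * norm u * (16 / a)"
  let ?\<epsilon> = "\<lambda>n::nat. c\<^sub>0 * \<alpha> * sqrt (ln n / n)"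
  have Ce: "0 < C\<^sub>e"
    unfolding C\<^sub>e_def using a(1) M by (intro divide_pos_pos add_pos_pos mult_pos_pos) auto
  have "\<exists>S. S \<in> events \<and>
    prob S \<le> 4 * (C\<^sub>L * (16 * C\<^sub>\<omega> / a) powr \<rho>) * exp (- (real n * C\<^sub>e)) \<and>
    (\<forall>w\<in>space P - S. \<forall>x. a / 2 \<le> degree_fun k (empirical X w n) x)" if "1 \<le> n" for n
    unfolding C\<^sub>e_def by (rule degree_event[OF net that]) blast
  then obtain S1 where S1: "\<And>n. 1 \<le> n \<Longrightarrow> S1 n \<in> events"
    "\<And>n. 1 \<le> n \<Longrightarrow> prob (S1 n) \<le> 4 * (C\<^sub>L * (16 * C\<^sub>\<omega> / a) powr \<rho>) * exp (- (real n * C\<^sub>e))"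
    "\<And>n w x. 1 \<le> n \<Longrightarrow> w \<in> space P - S1 n \<Longrightarrow> a / 2 \<le> degree_fun k (empirical X w n) x"
    by metis
  have "\<exists>S. S \<in> events \<and>
    prob S \<le> 8 * (C\<^sub>L * (C\<^sub>\<omega> / ?\<epsilon> n) powr \<rho>) * exp (- (real n * (?\<epsilon> n)\<^sup>2 * (1 / (2 * (M * b)\<^sup>2)))) \<and>
    (\<forall>w\<in>space P - S. (\<forall>x. a / 2 \<le> degree_fun k (empirical X w n) x) \<longrightarrow>
      norm (T_op k (empirical X w n) u - T_op k \<mu> u) \<le> ?K * ?\<epsilon> n)" if "2 \<le> n" for n
  proof -
    have "0 < ln (real n)" using that by simp
    then have e: "0 < ?\<epsilon> n" using that \<alpha> c\<^sub>0 by (intro mult_pos_pos real_sqrt_gt_zero divide_pos_pos) auto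
    have n1: "1 \<le> n" using that by simp
    show ?thesis
      unfolding b_def by (rule operator_event[OF net less_imp_le[OF C(1)] n1 e a1, of u]) blast
  qed
  then obtain S2 where S2: "\<And>n. 2 \<le> n \<Longrightarrow> S2 n \<in> events"
    "\<And>n. 2 \<le> n \<Longrightarrow> prob (S2 n) \<le> 8 * (C\<^sub>L * (C\<^sub>\<omega> / ?\<epsilon> n) powr \<rho>) * exp (- (real n * (?\<epsilon> n)\<^sup>2 * (1 / (2 * (M * b)\<^sup>2))))"
    "\<And>n w. 2 \<le> n \<Longrightarrow> w \<in> space P - S2 n \<Longrightarrow> (\<forall>x. a / 2 \<le> degree_fun k (empirical X w n) x) \<Longrightarrow>
      norm (T_op k (empirical X w n) u - T_op k \<mu> u) \<le> ?K * ?\<epsilon> n"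
    by metis
  define B1 where "B1 = (\<Union>i. S1 (N + i))"
  define B2 where "B2 = (\<Union>i. S2 (N + i))"
  let ?H = "16 * (C\<^sub>L * (D * C\<^sub>\<omega>) powr \<rho>) / \<alpha> powr (2 * \<rho>) * (1 / r) * (1 / (real N - 1) powr q)"
  have H: "0 \<le> ?H" using C r by simp
  have B1: "B1 \<in> events" unfolding B1_def using S1(1) N by auto
  have B2: "B2 \<in> events" unfolding B2_def using S2(1) N by auto
  have p1: "prob B1 \<le> 4 * (C\<^sub>L * (16 * C\<^sub>\<omega> / a) powr \<rho> / C\<^sub>e) * exp (- (real N - 1) * C\<^sub>e)"
  proof -
    have "prob B1 \<le> 4 * (C\<^sub>L * (16 * C\<^sub>\<omega> / a) powr \<rho>) * (exp (- real N * C\<^sub>e) / (1 - exp (- C\<^sub>e)))"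
      unfolding B1_def
    proof (rule prob_Union_le_suminf)
      show "S1 (N + i) \<in> events" for i using S1(1) N by simp
      show "prob (S1 (N + i)) \<le> 4 * (C\<^sub>L * (16 * C\<^sub>\<omega> / a) powr \<rho>) * exp (- (real (N + i) * C\<^sub>e))" for i
        using N by (intro S1(2)) simp
    qed (intro sums_mult geometric_tail_bound(1) Ce)
    also have "\<dots> \<le> 4 * (C\<^sub>L * (16 * C\<^sub>\<omega> / a) powr \<rho>) * (exp (- (real N - 1) * C\<^sub>e) / C\<^sub>e)"
      using C by (intro mult_left_mono geometric_tail_bound(2) Ce) auto
    finally show ?thesis by simp
  qed
  have p2: "prob B2 \<le> ?H"
  proof -
    have "prob B2 \<le> ?H * (1 / (real N - 1))"
      unfolding B2_def
    proof (rule prob_Union_le_suminf)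
      show "S2 (N + i) \<in> events" for i using S2(1) N by simp
      show "prob (S2 (N + i)) \<le> ?H * (1 / (real (N + i) - 1) - 1 / real (N + i))" for i
      proof (rule order_trans[OF S2(2)])
        show "2 \<le> N + i" using N by simp
        show "8 * (C\<^sub>L * (C\<^sub>\<omega> / ?\<epsilon> (N + i)) powr \<rho>) * exp (- (real (N + i) * (?\<epsilon> (N + i))\<^sup>2 * (1 / (2 * (M * b)\<^sup>2))))
          \<le> ?H * (1 / (real (N + i) - 1) - 1 / real (N + i))"
          by (rule net_tail_bound[OF \<alpha> \<rho> q r C D c\<^sub>0 N]) simp
      qed
    qed (intro sums_mult inverse_square_tail_sums N)
    also have "\<dots> \<le> ?H * 1" using N by (intro mult_left_mono H) simp
    finally show ?thesis by simp
  qed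
  show ?thesis
  proof (rule that[of "space P - (B1 \<union> B2)"])
    show "space P - (B1 \<union> B2) \<in> events" using B1 B2 by auto
    have "prob (B1 \<union> B2) \<le> prob B1 + prob B2" by (rule measure_Un_le[OF B1 B2])
    moreover have "prob (space P - (B1 \<union> B2)) = 1 - prob (B1 \<union> B2)"
      using B1 B2 by (intro prob_compl) auto
    ultimately show "1 - ?H - 4 * (C\<^sub>L * (16 * C\<^sub>\<omega> / a) powr \<rho> / C\<^sub>e) * exp (- (real N - 1) * C\<^sub>e)
        \<le> prob (space P - (B1 \<union> B2))"
      using p1 p2 by linarith
  next
    fix w n assume w: "w \<in> space P - (B1 \<union> B2)" and n: "N \<le> n"
    then obtain i where i: "n = N + i" using le_Suc_ex by blast
    have w1: "w \<in> space P - S1 n" "w \<in> space P - S2 n" using w by (auto simp: i B1_def B2_def)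
    have n1: "1 \<le> n" "2 \<le> n" using n N by auto
    have deg: "\<forall>x. a / 2 \<le> degree_fun k (empirical X w n) x" using S1(3)[OF n1(1) w1(1)] by blast
    show "(\<forall>x. a / 2 \<le> degree_fun k (empirical X w n) x) \<and>
      norm (T_op k (empirical X w n) u - T_op k \<mu> u) \<le> ?K * ?\<epsilon> n"
      using deg S2(3)[OF n1(2) w1(2) deg] by blast
  qed
qed

end

section \<open>Convergence of the spectral projections\<close>

theorem theorem3:
  fixes P :: "'w measure" and \<mu> :: "'x::metric_space measure"
    and k :: "'x \<Rightarrow> 'x \<Rightarrow> real" and X :: "nat \<Rightarrow> 'w \<Rightarrow> 'x"
    and a M :: real and \<omega> :: "ennreal \<Rightarrow> real"
    and u :: "('x, real) bmfun" and lam :: real and V :: "complex set"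
  assumes P: "prob_space P"
    and compact: "compact (UNIV :: 'x set)"
    and \<mu>: "prob_space \<mu>" "sets \<mu> = sets borel"
    and k_nonneg: "\<And>x y. 0 \<le> k x y"
    and k_sym: "\<And>x y. k x y = k y x"
    and k_meas: "(\<lambda>(x, y). k x y) \<in> borel_measurable (borel \<Otimes>\<^sub>M borel)"
    and X_indep: "prob_space.indep_vars P (\<lambda>_. borel) X {1..}"
    and X_law: "\<And>i. 1 \<le> i \<Longrightarrow> distr P borel (X i) = \<mu>"
    and aM: "0 < a" "a \<le> 1" "1 \<le> M"
    and \<omega>: "continuous_on UNIV \<omega>" "mono \<omega>" "(\<omega> \<longlongrightarrow> 0) (at_right 0)"
    and k_bound: "(SUP x. SUP y. ereal (k x y)) < ereal M"
    and d_bound: "a < (INF x. degree_fun k \<mu> x)"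
    and k_modulus: "\<And>x \<delta>. 0 < \<delta> \<Longrightarrow> integrable (completion \<mu>) (modulus k \<delta> x) \<and>
          (\<integral>z. modulus k \<delta> x z \<partial>completion \<mu>) \<le> \<omega> (ennreal \<delta>)"
    and eigen: "u \<noteq> 0" "U_op k \<mu> u = lam *\<^sub>R u" "lam \<noteq> 1"
    and V: "open V" "V \<inter> spectrum (U_op k \<mu>) = {complex_of_real lam}"
    and V_frontier: "1 \<notin> frontier V"
  shows "\<exists>C>0. \<forall>C\<^sub>L C\<^sub>\<omega> m m' \<alpha>.
    0 < C\<^sub>L \<longrightarrow> 0 < C\<^sub>\<omega> \<longrightarrow> 0 < m \<longrightarrow> 0 < m' \<longrightarrow> 1 \<le> \<alpha> \<longrightarrow>
    (\<forall>\<delta>>0. C\<^sub>\<omega> * \<delta> powr m' \<le> a / 16 \<longrightarrow>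
       real (covering_number TYPE('x) \<delta>) \<le> C\<^sub>L * (1 / \<delta> powr m) \<and>
       \<omega> (ennreal \<delta>) \<le> C\<^sub>\<omega> * \<delta> powr m') \<longrightarrow>
    (let \<gamma> = 32 * M\<^sup>2 / a\<^sup>2 + 8 / 3 * M / a;
         \<gamma>' = M\<^sup>2 * \<gamma> / a;
         C' = C\<^sub>L * (8 * M * C\<^sub>\<omega> / (a * ln 2) * (1 / a + 2 * M / a)) powr (m / m');
         C\<^sub>a = C\<^sub>L * (16 * C\<^sub>\<omega> / a) powr (m / m');
         C\<^sub>e = (a / 2)\<^sup>2 / (32 * M\<^sup>2 + 8 / 3 * M * (a / 2))
     in \<alpha> / \<gamma>' - m / (2 * m') > 1 \<longrightarrow>
        \<alpha> * m' - \<gamma>' * m - \<gamma>' * m' > 0 \<longrightarrow>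
        (\<forall>N\<ge>2. \<exists>A\<in>sets P.
           A \<subseteq> (\<Inter>n\<in>{N..}. {w \<in> space P.
               0 < (INF x. degree_fun k (empirical X w n) x) \<and>
               (\<exists>!Q. is_spectral_projection (U_op k (empirical X w n)) V Q) \<and>
               norm (bm_of_real u - spectral_projection (U_op k (empirical X w n)) V (bm_of_real u))
                 \<le> 4 * C * (\<alpha> / sqrt (real n)) * sqrt (ln (real n))}) \<and>
           measure P A \<ge>
             1 - 16 * C' / \<alpha> powr (2 * m / m')
                   * (\<gamma>' * m' / (\<alpha> * m' - \<gamma>' * m - \<gamma>' * m'))
                   * (1 / (real N - 1) powr (\<alpha> / \<gamma>' - m / (2 * m')))
               - 4 * (C\<^sub>a / C\<^sub>e) * exp (- (real N - 1) * C\<^sub>e)))"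
proof -
  interpret prob_space P by (rule P)
  have k_lt: "k x y < M" for x y
  proof -
    have "ereal (k x y) \<le> (SUP x. SUP y. ereal (k x y))"
      by (intro SUP_upper2[of x] SUP_upper2[of y]) auto
    then show ?thesis using k_bound order_le_less_trans by fastforce
  qed
  have d_ge: "a \<le> degree_fun k \<mu> x" for x
  proof -
    have "bdd_below (range (degree_fun k \<mu>))"
      using k_nonneg by (intro bdd_belowI[of _ 0]) (auto simp: degree_fun_def)
    then have "(INF x. degree_fun k \<mu> x) \<le> degree_fun k \<mu> x" by (intro cINF_lower) auto
    then show ?thesis using d_bound by linarith
  qed
  interpret kernel_sample P \<mu> X k a M
    by (intro kernel_sample.intro iid_sample.intro iid_sample_axioms.intro kernel_sample_axioms.intro)
      (fact P \<mu> X_indep X_law compact k_nonneg k_sym k_meas aM d_ge less_imp_le[OF k_lt])+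
  define \<tau> where "\<tau> = 1 - lam"
  have \<tau>: "\<tau> \<noteq> 0" using eigen(3) by (simp add: \<tau>_def)
  have T_u: "T_op k \<mu> u = \<tau> *\<^sub>R u"
    using eigen(2) by (simp add: U_op_def \<tau>_def blinfun.diff_left algebra_simps)
  have "complex_of_real lam \<in> V" using V(2) by blast
  then obtain r where r: "0 < r" "ball (complex_of_real (1 - \<tau>)) r \<subseteq> V"
    using V(1) openE by (auto simp: \<tau>_def)
  \<comment> \<open>As \<open>1\<close> is not a frontier point, a whole disc around it lies on one side of \<open>V\<close>.\<close>
  obtain c where c: "0 < c" "ball 1 c \<subseteq> V \<or> ball 1 c \<inter> V = {}"
  proof (cases "1 \<in> V")
    case True
    then show ?thesis using V(1) that by (meson openE)
  next
    case False
    then have "1 \<in> - closure V" using V_frontier V(1) by (auto simp: frontier_def interior_open)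
    then obtain c where "0 < c" "ball 1 c \<subseteq> - closure V" by (meson openE open_Compl closed_closure)
    then show ?thesis using that closure_subset by blast
  qed
  define b where "b = 1 + norm u / a"
  \<comment> \<open>The rate \<open>1 / (2 (M b)\<^sup>2)\<close> is that of Hoeffding's inequality for test functions bounded by \<open>M b\<close>;
    \<open>c\<^sub>0\<close> is chosen so that it becomes at least \<open>9\<close>.\<close>
  define c\<^sub>0 where "c\<^sub>0 = 1 + 3 * sqrt (2 * (M * b)\<^sup>2)"
  have Mb: "0 < M * b" using aM by (simp add: b_def add_pos_nonneg)
  have c\<^sub>0: "1 \<le> c\<^sub>0" "9 \<le> 1 / (2 * (M * b)\<^sup>2) * c\<^sub>0\<^sup>2"
  proof -
    show "1 \<le> c\<^sub>0" by (simp add: c\<^sub>0_def)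
    have "(3 * sqrt (2 * (M * b)\<^sup>2))\<^sup>2 \<le> c\<^sub>0\<^sup>2" unfolding c\<^sub>0_def by (intro power_mono) auto
    then have "9 * (2 * (M * b)\<^sup>2) \<le> c\<^sub>0\<^sup>2" by (simp add: power_mult_distrib)
    moreover have "0 < 2 * (M * b)\<^sup>2" using zero_less_power[OF Mb, of 2] by simp
    ultimately show "9 \<le> 1 / (2 * (M * b)\<^sup>2) * c\<^sub>0\<^sup>2" by (simp only: pos_le_divide_eq times_divide_eq_left mult_1_left)
  qed
  define K\<^sub>1 where "K\<^sub>1 = (2 * M * norm u / a\<^sup>2 + 1 / a + 1) * (4 * b) + 3 * M / a * norm u * (16 / a)"
  define K\<^sub>2 where "K\<^sub>2 = (2 * M / a / r + 1 + 2 * M / a / c) / \<bar>\<tau>\<bar> + 2 * M / a / (r * c)"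
  have K\<^sub>1: "0 < K\<^sub>1"
  proof -
    have "0 \<le> 2 * M * norm u / a\<^sup>2 + 1 / a" using aM by simp
    then have "0 < 2 * M * norm u / a\<^sup>2 + 1 / a + 1" by simp
    moreover have "0 < 4 * b" using aM by (simp add: b_def add_pos_nonneg)
    moreover have "0 \<le> 3 * M / a * norm u * (16 / a)" using aM by simp
    ultimately show ?thesis unfolding K\<^sub>1_def by (rule add_pos_nonneg[OF mult_pos_pos])
  qed
  have K\<^sub>2: "0 < K\<^sub>2"
    unfolding K\<^sub>2_def using aM r(1) c(1) \<tau> by (intro add_pos_pos divide_pos_pos) auto
  define C where "C = K\<^sub>2 * K\<^sub>1 * c\<^sub>0"
  have C: "0 < C" unfolding C_def using K\<^sub>1 K\<^sub>2 c\<^sub>0(1) by simp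
  show ?thesis
  proof (intro exI[of _ C] conjI allI impI C)
    fix C\<^sub>L C\<^sub>\<omega> m m' \<alpha> :: real
    assume pos: "0 < C\<^sub>L" "0 < C\<^sub>\<omega>" "0 < m" "0 < m'" "1 \<le> \<alpha>"
      and cover: "\<forall>\<delta>>0. C\<^sub>\<omega> * \<delta> powr m' \<le> a / 16 \<longrightarrow>
       real (covering_number TYPE('x) \<delta>) \<le> C\<^sub>L * (1 / \<delta> powr m) \<and>
       \<omega> (ennreal \<delta>) \<le> C\<^sub>\<omega> * \<delta> powr m'"
    \<comment> \<open>The assumptions on \<open>\<delta>\<close> are used exactly in the range where the modulus is at most \<open>a / 16\<close>.\<close>
    have net: "net_bound C\<^sub>L C\<^sub>\<omega> (m / m')"
      unfolding net_bound_def
    proof (intro allI impI)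
      fix \<epsilon> assume \<epsilon>: "0 < \<epsilon>" "\<epsilon> \<le> a / 16"
      define \<delta> where "\<delta> = (\<epsilon> / C\<^sub>\<omega>) powr (1 / m')"
      have \<delta>: "0 < \<delta>" using \<epsilon> pos by (simp add: \<delta>_def)
      have e: "C\<^sub>\<omega> * \<delta> powr m' = \<epsilon>" using \<epsilon> pos by (simp add: \<delta>_def powr_powr)
      have "\<delta> powr m = (\<epsilon> / C\<^sub>\<omega>) powr (m / m')" by (simp add: \<delta>_def powr_powr)
      then have L: "1 / \<delta> powr m = (C\<^sub>\<omega> / \<epsilon>) powr (m / m')"
        using \<epsilon> pos by (simp add: powr_divide)
      have "C\<^sub>\<omega> * \<delta> powr m' \<le> a / 16" unfolding e by (rule \<epsilon>(2))
      from cover[rule_format, OF \<delta> this]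
      have "real (covering_number TYPE('x) \<delta>) \<le> C\<^sub>L * (C\<^sub>\<omega> / \<epsilon>) powr (m / m')"
        "\<omega> (ennreal \<delta>) \<le> \<epsilon>"
        unfolding e L by simp_all
      then show "\<exists>\<delta>>0. real (covering_number TYPE('x) \<delta>) \<le> C\<^sub>L * (C\<^sub>\<omega> / \<epsilon>) powr (m / m') \<and>
        (\<forall>x. integrable (completion \<mu>) (modulus k \<delta> x) \<and> (\<integral>z. modulus k \<delta> x z \<partial>completion \<mu>) \<le> \<epsilon>)"
        using \<delta> k_modulus[OF \<delta>] by (meson order_trans)
    qed
    define \<gamma> where "\<gamma> = 32 * M\<^sup>2 / a\<^sup>2 + 8 / 3 * M / a"
    define \<gamma>' where "\<gamma>' = M\<^sup>2 * \<gamma> / a"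
    define D where "D = 8 * M / (a * ln 2) * (1 / a + 2 * M / a)"
    define C\<^sub>e where "C\<^sub>e = (a / 2)\<^sup>2 / (32 * M\<^sup>2 + 8 / 3 * M * (a / 2))"
    \<comment> \<open>The reciprocal of \<open>r'\<close> is the middle factor of the bound to be shown.\<close>
    define r' where "r' = \<alpha> / \<gamma>' - m / m' - 1"
    have Ma: "1 \<le> M / a" using aM by simp
    have \<gamma>: "1 \<le> \<gamma>"
    proof -
      have "1 \<le> (M / a)\<^sup>2" using Ma by simp
      then have "1 \<le> M\<^sup>2 / a\<^sup>2" by (simp add: power_divide)
      moreover have "32 * M\<^sup>2 / a\<^sup>2 = 32 * (M\<^sup>2 / a\<^sup>2)" by simp
      moreover have "0 \<le> 8 / 3 * M / a" using aM by simp
      ultimately show ?thesis unfolding \<gamma>_def by linarith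
    qed
    have \<gamma>': "1 \<le> \<gamma>'"
    proof -
      have "1 * 1 * 1 \<le> M / a * M * \<gamma>" using Ma aM \<gamma> by (intro mult_mono) auto
      then show ?thesis by (simp add: \<gamma>'_def power2_eq_square mult_ac)
    qed
    have D: "2 \<le> D"
    proof -
      have l: "0 < ln (2::real)" "ln (2::real) \<le> 1" using ln2_le_25_over_36 by auto
      have "a * ln 2 \<le> 1" using aM l by (intro mult_le_one) auto
      then have "1 \<le> 1 / (a * ln 2)" using aM l by simp
      then have "1 * 1 \<le> M * (1 / (a * ln 2))" using aM by (intro mult_mono) auto
      moreover have "1 \<le> 1 / a + 2 * M / a"
      proof -
        have "1 \<le> 1 / a" "0 \<le> 2 * M / a" using aM by simp_all
        then show ?thesis by linarith
      qed
      ultimately have "8 * (1 * 1) \<le> 8 * (M * (1 / (a * ln 2)) * (1 / a + 2 * M / a))"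
        by (intro mult_left_mono mult_mono) auto
      then show ?thesis by (simp add: D_def)
    qed
    have \<alpha>\<gamma>: "\<alpha> / \<gamma>' \<le> \<alpha>" using pos \<gamma>' by (simp add: divide_le_eq mult_le_cancel_left1)
    have "\<alpha> / \<gamma>' - m / (2 * m') > 1 \<longrightarrow>
        \<alpha> * m' - \<gamma>' * m - \<gamma>' * m' > 0 \<longrightarrow>
        (\<forall>N\<ge>2. \<exists>A\<in>sets P.
           A \<subseteq> (\<Inter>n\<in>{N..}. {w \<in> space P.
               0 < (INF x. degree_fun k (empirical X w n) x) \<and>
               (\<exists>!Q. is_spectral_projection (U_op k (empirical X w n)) V Q) \<and>
               norm (bm_of_real u - spectral_projection (U_op k (empirical X w n)) V (bm_of_real u))
                 \<le> 4 * C * (\<alpha> / sqrt (real n)) * sqrt (ln (real n))}) \<and>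
           measure P A \<ge>
             1 - 16 * (C\<^sub>L * (8 * M * C\<^sub>\<omega> / (a * ln 2) * (1 / a + 2 * M / a)) powr (m / m')) / \<alpha> powr (2 * m / m')
                   * (\<gamma>' * m' / (\<alpha> * m' - \<gamma>' * m - \<gamma>' * m'))
                   * (1 / (real N - 1) powr (\<alpha> / \<gamma>' - m / (2 * m')))
               - 4 * (C\<^sub>L * (16 * C\<^sub>\<omega> / a) powr (m / m') / C\<^sub>e) * exp (- (real N - 1) * C\<^sub>e))"
    proof (intro impI allI)
      fix N :: nat
      assume q: "\<alpha> / \<gamma>' - m / (2 * m') > 1" and "\<alpha> * m' - \<gamma>' * m - \<gamma>' * m' > 0" and N: "2 \<le> N"
      then have r'_eq: "\<gamma>' * m' / (\<alpha> * m' - \<gamma>' * m - \<gamma>' * m') = 1 / r'" and r': "0 < r'"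
        using pos \<gamma>' by (auto simp: r'_def field_simps)
      have \<rho>: "0 < m / m'" "m / m' \<le> \<alpha>" using pos r' \<alpha>\<gamma> by (auto simp: r'_def)
      have q': "0 \<le> \<alpha> / \<gamma>' - m / (2 * m')" "\<alpha> / \<gamma>' - m / (2 * m') \<le> \<alpha>"
      proof -
        have "0 < m / (2 * m')" using pos by simp
        then show "0 \<le> \<alpha> / \<gamma>' - m / (2 * m')" "\<alpha> / \<gamma>' - m / (2 * m') \<le> \<alpha>" using q \<alpha>\<gamma> by linarith+
      qed
      have r'_le: "r' \<le> \<alpha>" using \<alpha>\<gamma> \<rho>(1) by (simp add: r'_def)
      obtain A where A: "A \<in> events"
        "\<And>w n. w \<in> A \<Longrightarrow> N \<le> n \<Longrightarrow> (\<forall>x. a / 2 \<le> degree_fun k (empirical X w n) x) \<and>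
          norm (T_op k (empirical X w n) u - T_op k \<mu> u)
            \<le> ((2 * M * norm u / a\<^sup>2 + 1 / a + 1) * (4 * b) + 3 * M / a * norm u * (16 / a))
               * (c\<^sub>0 * \<alpha> * sqrt (ln (real n) / real n))"
        "1 - 16 * (C\<^sub>L * (D * C\<^sub>\<omega>) powr (m / m')) / \<alpha> powr (2 * (m / m')) * (1 / r')
             * (1 / (real N - 1) powr (\<alpha> / \<gamma>' - m / (2 * m')))
           - 4 * (C\<^sub>L * (16 * C\<^sub>\<omega> / a) powr (m / m') / C\<^sub>e) * exp (- (real N - 1) * C\<^sub>e) \<le> prob A"
        by (rule convergence_event[OF net aM(2) pos(1,2) D pos(5) \<rho> q' r' r'_le c\<^sub>0 N b_def C\<^sub>e_def]) blast
      show "\<exists>A\<in>sets P.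
           A \<subseteq> (\<Inter>n\<in>{N..}. {w \<in> space P.
               0 < (INF x. degree_fun k (empirical X w n) x) \<and>
               (\<exists>!Q. is_spectral_projection (U_op k (empirical X w n)) V Q) \<and>
               norm (bm_of_real u - spectral_projection (U_op k (empirical X w n)) V (bm_of_real u))
                 \<le> 4 * C * (\<alpha> / sqrt (real n)) * sqrt (ln (real n))}) \<and>
           measure P A \<ge>
             1 - 16 * (C\<^sub>L * (8 * M * C\<^sub>\<omega> / (a * ln 2) * (1 / a + 2 * M / a)) powr (m / m')) / \<alpha> powr (2 * m / m')
                   * (\<gamma>' * m' / (\<alpha> * m' - \<gamma>' * m - \<gamma>' * m'))
                   * (1 / (real N - 1) powr (\<alpha> / \<gamma>' - m / (2 * m')))
               - 4 * (C\<^sub>L * (16 * C\<^sub>\<omega> / a) powr (m / m') / C\<^sub>e) * exp (- (real N - 1) * C\<^sub>e)"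
      proof (intro bexI[OF _ A(1)] conjI)
        have "8 * M * C\<^sub>\<omega> / (a * ln 2) * (1 / a + 2 * M / a) = D * C\<^sub>\<omega>"
          by (simp add: D_def)
        then show "1 - 16 * (C\<^sub>L * (8 * M * C\<^sub>\<omega> / (a * ln 2) * (1 / a + 2 * M / a)) powr (m / m')) / \<alpha> powr (2 * m / m')
                   * (\<gamma>' * m' / (\<alpha> * m' - \<gamma>' * m - \<gamma>' * m'))
                   * (1 / (real N - 1) powr (\<alpha> / \<gamma>' - m / (2 * m')))
               - 4 * (C\<^sub>L * (16 * C\<^sub>\<omega> / a) powr (m / m') / C\<^sub>e) * exp (- (real N - 1) * C\<^sub>e) \<le> prob A"
          using A(3) unfolding r'_eq by simp
      next
        show "A \<subseteq> (\<Inter>n\<in>{N..}. {w \<in> space P.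
               0 < (INF x. degree_fun k (empirical X w n) x) \<and>
               (\<exists>!Q. is_spectral_projection (U_op k (empirical X w n)) V Q) \<and>
               norm (bm_of_real u - spectral_projection (U_op k (empirical X w n)) V (bm_of_real u))
                 \<le> 4 * C * (\<alpha> / sqrt (real n)) * sqrt (ln (real n))})"
        proof (intro subsetI INT_I CollectI conjI)
          fix w n assume w: "w \<in> A" and "n \<in> {N..}"
          then have n: "N \<le> n" "1 \<le> n" using N by auto
          show "w \<in> space P" using w A(1) sets.sets_into_space by blast
          let ?e = "K\<^sub>1 * (c\<^sub>0 * \<alpha> * sqrt (ln (real n) / real n))"
          have deg: "\<And>x. a / 2 \<le> degree_fun k (empirical X w n) x"
            and dist: "norm (T_op k (empirical X w n) u - \<tau> *\<^sub>R u) \<le> ?e"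
            using A(2)[OF w n(1)] by (auto simp: K\<^sub>1_def T_u)
          have "a / 2 \<le> (INF x. degree_fun k (empirical X w n) x)"
            using deg by (intro cINF_greatest) auto
          then show "0 < (INF x. degree_fun k (empirical X w n) x)" using aM(1) by linarith
          interpret S: sampled_kernel "T_op k (empirical X w n)" "normalized_kernel k (empirical X w n)"
            "\<lambda>i. X i w" n "2 * M / a" by (rule empirical_sampled_kernel[OF n(2) deg])
          note pr = S.projection_error[OF \<tau> r c dist, folded U_op_def]
          show "\<exists>!Q. is_spectral_projection (U_op k (empirical X w n)) V Q" by (rule pr(1))
          have "norm (bm_of_real u - spectral_projection (U_op k (empirical X w n)) V (bm_of_real u)) \<le> K\<^sub>2 * ?e"
            using pr(2) unfolding K\<^sub>2_def .
          also have "\<dots> = C * (\<alpha> / sqrt (real n) * sqrt (ln (real n)))"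
            by (simp add: C_def real_sqrt_divide)
          also have "\<dots> \<le> 4 * (C * (\<alpha> / sqrt (real n) * sqrt (ln (real n))))"
          proof -
            have "0 \<le> C * (\<alpha> / sqrt (real n) * sqrt (ln (real n)))" using C pos n by simp
            then show ?thesis by linarith
          qed
          finally show "norm (bm_of_real u - spectral_projection (U_op k (empirical X w n)) V (bm_of_real u))
                 \<le> 4 * C * (\<alpha> / sqrt (real n)) * sqrt (ln (real n))"
            by (simp only: mult.assoc)
        qed
      qed
    qed
    then show "let \<gamma> = 32 * M\<^sup>2 / a\<^sup>2 + 8 / 3 * M / a;
         \<gamma>' = M\<^sup>2 * \<gamma> / a;
         C' = C\<^sub>L * (8 * M * C\<^sub>\<omega> / (a * ln 2) * (1 / a + 2 * M / a)) powr (m / m');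
         C\<^sub>a = C\<^sub>L * (16 * C\<^sub>\<omega> / a) powr (m / m');
         C\<^sub>e = (a / 2)\<^sup>2 / (32 * M\<^sup>2 + 8 / 3 * M * (a / 2))
     in \<alpha> / \<gamma>' - m / (2 * m') > 1 \<longrightarrow>
        \<alpha> * m' - \<gamma>' * m - \<gamma>' * m' > 0 \<longrightarrow>
        (\<forall>N\<ge>2. \<exists>A\<in>sets P.
           A \<subseteq> (\<Inter>n\<in>{N..}. {w \<in> space P.
               0 < (INF x. degree_fun k (empirical X w n) x) \<and>
               (\<exists>!Q. is_spectral_projection (U_op k (empirical X w n)) V Q) \<and>
               norm (bm_of_real u - spectral_projection (U_op k (empirical X w n)) V (bm_of_real u))
                 \<le> 4 * C * (\<alpha> / sqrt (real n)) * sqrt (ln (real n))}) \<and>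
           measure P A \<ge>
             1 - 16 * C' / \<alpha> powr (2 * m / m')
                   * (\<gamma>' * m' / (\<alpha> * m' - \<gamma>' * m - \<gamma>' * m'))
                   * (1 / (real N - 1) powr (\<alpha> / \<gamma>' - m / (2 * m')))
               - 4 * (C\<^sub>a / C\<^sub>e) * exp (- (real N - 1) * C\<^sub>e))"
      unfolding Let_def \<gamma>'_def \<gamma>_def C\<^sub>e_def .
  qed
qed

end
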